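(* Let $K_1$ and $K_2$ be cones in $\mathbb{R}^{N_1}$ and $\mathbb{R}^{N_2}$, respectively. Let $\{\mu_u\colon u\in K_2\}$ be a $1$-dimensional Gaussian $K_2$-parameter convolution semigroup (on $\mathbb{R}$), let $\{\rho_s\colon s\in K_1\}$ be a $K_1$-parameter convolution semigroup on $\mathbb{R}^{N_2}$ supported on $K_2$, and let $\{\sigma_s\colon s\in K_1\}$ be the $K_1$-parameter convolution semigroup on $\mathbb{R}$ obtained by subordination of $\{\mu_u\}$ by $\{\rho_s\}$, i.e. $\sigma_s(B)=\int_{K_2}\mu_u(B)\,\rho_s(du)$ for Borel $B\subseteq\mathbb{R}$. Fix $s\in K_1$. If $\rho_s$ is selfdecomposable, then $\sigma_s$ is selfdecomposable.
   Context: A subset $K$ of $\mathbb{R}^N$ is called a cone if it is a non-empty closed convex set, closed under multiplication by nonnegative reals, contains no straight line through $0$, and $K\neq\{0\}$. Given a cone $K$, a $K$-parameter convolution semigroup on $\mathbb{R}^d$ is a family $\{\mu_s\colon s\in K\}$ of probability measures on $\mathbb{R}^d$ such that $\mu_{s_1}*\mu_{s_2}=\mu_{s_1+s_2}$ for all $s_1,s_2\in K$, and $\mu_{ts}\to\delta_0$ weakly as $t\downarrow 0$ for each $s\in K$. It is supported on a set $K'$ if $\mathrm{Supp}(\mu_s)\subseteq K'$ for all $s\in K$. Subordination: if $\{\mu_u\colon u\in K_2\}$ is a $K_2$-parameter convolution semigroup on $\mathbb{R}^d$ and $\{\rho_s\colon s\in K_1\}$ is a $K_1$-parameter convolution semigroup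 on $\mathbb{R}^{N_2}$ supported on $K_2\subseteq\mathbb{R}^{N_2}$, then the measures $\sigma_s(B)=\int_{K_2}\mu_u(B)\,\rho_s(du)$, $B$ Borel in $\mathbb{R}^d$, form a $K_1$-parameter convolution semigroup $\{\sigma_s\colon s\in K_1\}$ on $\mathbb{R}^d$, called subordinated; $\{\mu_u\}$ is the subordinand and $\{\rho_s\}$ the subordinating semigroup. $G_{a,\gamma}$ denotes the Gaussian distribution on $\mathbb{R}$ with variance $a\ge 0$ and mean $\gamma\in\mathbb{R}$, where $G_{0,\gamma}=\delta_\gamma$. A $K$-parameter convolution semigroup $\{\mu_u\colon u\in K\}$ on $\mathbb{R}$ is called $1$-dimensional Gaussian if, for each $u\in K$, $\mu_u=G_{a,\gamma}$ for some $a\ge0$ and $\gamma\in\mathbb{R}$ (depending on $u$; the mean need not be $0$). A distribution $\mu$ on $\mathbb{R}^d$ is selfdecomposable if for each $b>1$ there is a probability distribution $\mu'$ on $\mathbb{R}^d$ such that $\widehat\mu(z)=\widehat\mu(b^{-1}z)\,\widehat{\mu'}(z)$ for all $z\in\mathbb{R}^d$, where $\widehat{\ \cdot\ }$ denotes the characteristic function. *)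

theory Defs
  imports "HOL-Probability.Probability"
begin

definition parameter_cone :: "'a::euclidean_space set \<Rightarrow> bool" where
  "parameter_cone K \<longleftrightarrow>
     K \<noteq> {} \<and> closed K \<and> convex K \<and> cone K \<and>
     \<not> (\<exists>x. x \<noteq> 0 \<and> range (\<lambda>t::real. t *\<^sub>R x) \<subseteq> K) \<and>
     K \<noteq> {0}"

definition borel_prob :: "'a::topological_space measure \<Rightarrow> bool" where
  "borel_prob M \<longleftrightarrow> prob_space M \<and> sets M = sets borel"

text \<open>The library notion \<open>weak_conv_m\<close> covers only sequences of measures on the real line.\<close>

definition weakly_tendsto ::
    "('i \<Rightarrow> 'a::topological_space measure) \<Rightarrow> 'a measure \<Rightarrow> 'i filter \<Rightarrow> bool" where
  "weakly_tendsto M N F \<longleftrightarrow>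
     (\<forall>f::'a \<Rightarrow> real. continuous_on UNIV f \<longrightarrow> bounded (range f) \<longrightarrow>
        ((\<lambda>i. integral\<^sup>L (M i) f) \<longlongrightarrow> integral\<^sup>L N f) F)"

text \<open>A family indexed by \<open>K\<close> is a total function whose values outside \<open>K\<close> are irrelevant.\<close>

definition convolution_semigroup ::
    "'k::euclidean_space set \<Rightarrow> ('k \<Rightarrow> 'a::ordered_euclidean_space measure) \<Rightarrow> bool" where
  "convolution_semigroup K \<mu> \<longleftrightarrow>
     (\<forall>s\<in>K. borel_prob (\<mu> s)) \<and>
     (\<forall>s1\<in>K. \<forall>s2\<in>K. convolution (\<mu> s1) (\<mu> s2) = \<mu> (s1 + s2)) \<and>
     (\<forall>s\<in>K. weakly_tendsto (\<lambda>t::real. \<mu> (t *\<^sub>R s)) (return borel 0) (at_right 0))"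

definition measure_support :: "'a::topological_space measure \<Rightarrow> 'a set" where
  "measure_support M = {x. \<forall>U. open U \<longrightarrow> x \<in> U \<longrightarrow> 0 < emeasure M U}"

definition semigroup_supported_on ::
    "'k set \<Rightarrow> ('k \<Rightarrow> 'a::topological_space measure) \<Rightarrow> 'a set \<Rightarrow> bool" where
  "semigroup_supported_on K \<mu> K' \<longleftrightarrow> (\<forall>s\<in>K. measure_support (\<mu> s) \<subseteq> K')"

text \<open>
  \<open>measure_of\<close> yields the null measure if the given set function is not countably additive on
  the Borel sets. For a convolution semigroup \<open>\<mu>\<close> over a cone \<open>K\<close> the integrand is measurable,
  so the set function is indeed a measure.
\<close>

definition subordinated ::
    "'k::euclidean_space set \<Rightarrow> ('k \<Rightarrow> 'a::topological_space measure) \<Rightarrow>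
     ('s \<Rightarrow> 'k measure) \<Rightarrow> 's \<Rightarrow> 'a measure" where
  "subordinated K \<mu> \<rho> s =
     measure_of UNIV (sets borel) (\<lambda>B. \<integral>\<^sup>+u\<in>K. emeasure (\<mu> u) B \<partial>(\<rho> s))"

text \<open>Parametrised by variance and mean, whereas \<open>normal_density\<close> takes mean and standard deviation.\<close>

definition gaussian :: "real \<Rightarrow> real \<Rightarrow> real measure" where
  "gaussian a \<gamma> =
     (if a = 0 then return borel \<gamma> else density lborel (normal_density \<gamma> (sqrt a)))"

definition gaussian_semigroup ::
    "'k::euclidean_space set \<Rightarrow> ('k \<Rightarrow> real measure) \<Rightarrow> bool" where
  "gaussian_semigroup K \<mu> \<longleftrightarrow>
     convolution_semigroup K \<mu> \<and> (\<forall>u\<in>K. \<exists>a \<gamma>. a \<ge> 0 \<and> \<mu> u = gaussian a \<gamma>)"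

definition charfun :: "'a::euclidean_space measure \<Rightarrow> 'a \<Rightarrow> complex" where
  "charfun M z = (CLINT x|M. iexp (z \<bullet> x))"

lemma charfun_real: "charfun M = char M" for M :: "real measure"
  by (simp add: fun_eq_iff charfun_def char_def)

definition selfdecomposable :: "'a::euclidean_space measure \<Rightarrow> bool" where
  "selfdecomposable M \<longleftrightarrow>
     borel_prob M \<and>
     (\<forall>b>1. \<exists>M'. borel_prob M' \<and>
        (\<forall>z. charfun M z = charfun M (inverse b *\<^sub>R z) * charfun M' z))"

end

(*
Mixing Gaussian laws of mean r * g and variance r * a over dr / r on (0, c] gives a Levy density that, up to
the factor 1 / |x|, is the probability that a Brownian motion with drift reaches x before time c.  This is
monotone in |x|, which is why selfdecomposability survives the drift.

The proof avoids the Levy-Khintchine formula.  Mean and variance of mu_u are linear in u, so sigma_s has the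
characteristic function Phi(z) = E exp (w_U(z)) with w_u(z) = i <g,u> z - <a,u> z^2 / 2 and U of law rho_s.
Put ein(c) = sum_{n >= 1} c^n / (n * n!), so that c * ein'(c) = exp c - 1, and let R_h be the cofactor of
rho_s for the contraction exp (-h).  The characteristic functions of the maximum and the minimum over [0, 1]
of the Brownian motion with drift <g,u> and variance <a,u> add up to 2 + z * w_u'(z) * ein'(w_u(z)).
Integrating along z * exp (-t), one sees that n * E (ein (w_V(z)) - ein (w_V(z / b))), with V of law R_{1/n},
is the exponent of a compound Poisson law.  As the cone is pointed, a one-sided Laplace transform controls
R_h, and the exponentials of these exponents, multiplied by Phi(z / b), converge to Phi(z).  Tightness of the
products passes to the factors, and a limit law is the required cofactor of sigma_s.
*)

theory Submission
  imports Defs "HOL-Real_Asymp.Real_Asymp"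
begin

section \<open>Characteristic functions\<close>

text \<open>Without drift, \<open>w_u(z / b)\<close> is \<open>w_u(z)\<close> divided by
  \<open>b\<^sup>2\<close>: contracting \<open>z\<close> contracts \<open>u\<close>, and the law
  subordinated by the cofactor of \<open>\<rho> s\<close> for \<open>b\<^sup>2\<close> already is a
  cofactor. With drift, the terms of degree 1 and 2 in \<open>z\<close> scale differently, and this
  short way is closed. What survives is contraction of the exponent \<open>c\<close> itself. The
  integral of \<open>exp (exp (- t) * c) - 1\<close> over \<open>0 \<le> t \<le> T\<close> equals
  \<open>ein c - ein (exp (- T) * c)\<close>, so for small \<open>h\<close> a product of cofactors
  along geometric contractions is nearly the exponential of the mean of this difference under
  \<open>R h\<close>, divided by \<open>h\<close>. The exponents at \<open>z\<close> and at
  \<open>z / b\<close> are both contracted by one large factor and compared there. What remains is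
  small: its modulus is at most \<open>4 * ln b\<close> however large \<open>u\<close> is, and
  \<open>R h\<close>, even after division by \<open>h\<close>, puts little mass on points that stay
  large under the contraction. The uniform bound comes from the probabilistic formula: two
  characteristic functions minus 2 have modulus at most 4, and \<open>t\<close> runs through
  \<open>[0, ln b]\<close>.\<close>

definition is_char :: "(real \<Rightarrow> complex) \<Rightarrow> bool" where
  "is_char \<phi> \<longleftrightarrow> (\<exists>M. real_distribution M \<and> char M = \<phi>)"

lemma is_char_norm_le_1: "is_char \<phi> \<Longrightarrow> norm (\<phi> t) \<le> 1"
  unfolding is_char_def by (metis real_distribution.cmod_char_le_1)

lemma char_distr:
  assumes "f \<in> borel_measurable M"
  shows "char (distr M borel f) t = (CLINT x|M. iexp (t * f x))"
  using assms by (simp add: char_def integral_distr)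

lemma is_char_1: "is_char (\<lambda>_. 1)"
proof -
  have "real_distribution (return borel 0)"
    by (simp add: real_distribution_def real_distribution_axioms_def prob_space_return)
  moreover have "char (return borel 0) = (\<lambda>_. 1)"
    by (simp add: fun_eq_iff char_def integral_return)
  ultimately show ?thesis by (auto simp: is_char_def)
qed

lemma char_convolution:
  assumes "real_distribution M" "real_distribution N"
  shows "real_distribution (convolution M N)" "char (convolution M N) t = char M t * char N t"
proof -
  interpret M: real_distribution M by fact
  interpret N: real_distribution N by fact
  interpret MN: pair_prob_space M N ..
  show "real_distribution (convolution M N)"
    unfolding convolution_def by (intro MN.real_distribution_distr) simp
  have int: "integrable (M \<Otimes>\<^sub>M N) (\<lambda>(x, y). iexp (t * x) * iexp (t * y))"
    by (rule MN.integrable_const_bound [where B = 1]) (auto simp: norm_mult)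
  have "char (convolution M N) t = (\<integral>(x, y). iexp (t * x) * iexp (t * y) \<partial>(M \<Otimes>\<^sub>M N))"
    unfolding convolution_def
    by (subst char_distr) (auto intro!: Bochner_Integration.integral_cong simp: exp_add [symmetric] algebra_simps)
  also have "\<dots> = (\<integral>x. (\<integral>y. iexp (t * x) * iexp (t * y) \<partial>N) \<partial>M)"
    using MN.integral_fst' [OF int] by simp
  also have "\<dots> = char M t * char N t"
    unfolding char_def by simp
  finally show "char (convolution M N) t = char M t * char N t" .
qed

lemma is_char_mult:
  assumes "is_char \<phi>" "is_char \<psi>"
  shows "is_char (\<lambda>t. \<phi> t * \<psi> t)"
  using assms char_convolution unfolding is_char_def by fastforce

lemma is_char_power: "is_char \<phi> \<Longrightarrow> is_char (\<lambda>t. \<phi> t ^ n)"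
  by (induction n) (auto intro: is_char_1 is_char_mult)

lemma is_char_scale:
  assumes "is_char \<phi>"
  shows "is_char (\<lambda>z. \<phi> (c * z))"
proof -
  obtain M where M: "real_distribution M" "char M = \<phi>" using assms by (auto simp: is_char_def)
  interpret real_distribution M by fact
  have "real_distribution (distr M borel (\<lambda>x. c * x))"
    by (rule real_distribution_distr) simp
  moreover have "char (distr M borel (\<lambda>x. c * x)) = (\<lambda>z. \<phi> (c * z))"
  proof
    fix z
    have "char (distr M borel (\<lambda>x. c * x)) z = (CLINT x|M. iexp (z * (c * x)))"
      by (rule char_distr) simp
    then show "char (distr M borel (\<lambda>x. c * x)) z = \<phi> (c * z)"
      unfolding M(2) [symmetric] char_def by (simp only: mult_ac)
  qed
  ultimately show ?thesis unfolding is_char_def by blast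
qed

lemma is_char_bind:
  assumes M: "prob_space M" and K [measurable]: "K \<in> M \<rightarrow>\<^sub>M subprob_algebra borel"
    and K_real: "\<And>x. x \<in> space M \<Longrightarrow> real_distribution (K x)"
  shows "is_char (\<lambda>t. \<integral>x. char (K x) t \<partial>M)"
proof -
  interpret M: prob_space M by fact
  have ne: "space M \<noteq> {}" by (rule M.not_empty)
  have "real_distribution (M \<bind> K)"
    unfolding real_distribution_def real_distribution_axioms_def
    using ne K_real by (auto intro!: M.prob_space_bind [OF _ K] AE_I2 sets_bind [where N = borel]
        simp: real_distribution_def real_distribution_axioms_def)
  moreover have "char (M \<bind> K) t = (\<integral>x. char (K x) t \<partial>M)" for t
  proof -
    have int: "integrable (K x) (\<lambda>y. iexp (t * y))" if "x \<in> space M" for x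
    proof -
      interpret real_distribution "K x" using that by (rule K_real)
      show ?thesis by (rule integrable_iexp) auto
    qed
    have 1: "integrable (M \<bind> K) (\<lambda>y. iexp (t * y))"
      using \<open>real_distribution (M \<bind> K)\<close> unfolding real_distribution_def real_distribution_axioms_def
      by (intro prob_space.integrable_iexp) (auto simp: measurable_cong_sets [of "M \<bind> K" borel])
    \<comment> \<open>Passing to cosine and sine leaves bounded real integrands, to which
      \<open>integral_bind\<close> applies.\<close>
    have real: "integral\<^sup>L (M \<bind> K) f = (\<integral>x. integral\<^sup>L (K x) f \<partial>M)" "integrable M (\<lambda>x. integral\<^sup>L (K x) f)"
      if [measurable]: "f \<in> borel_measurable borel" and B: "\<And>y. \<bar>f y\<bar> \<le> 1" for f :: "real \<Rightarrow> real"
    proof -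
      show "integral\<^sup>L (M \<bind> K) f = (\<integral>x. integral\<^sup>L (K x) f \<partial>M)"
        by (rule integral_bind [where K = borel and B' = 1 and B = 1])
           (auto simp: B M.finite_measure_axioms intro!: subprob_space.subprob_emeasure_le_1 subprob_space_kernel [OF K])
      show "integrable M (\<lambda>x. integral\<^sup>L (K x) f)"
      proof (rule M.integrable_const_bound [where B = 1], rule AE_I2)
        fix x assume "x \<in> space M"
        then interpret real_distribution "K x" by (rule K_real)
        have "\<bar>integral\<^sup>L (K x) f\<bar> \<le> (\<integral>y. \<bar>f y\<bar> \<partial>K x)" by (rule integral_abs_bound)
        also have "\<dots> \<le> 1" using B by (intro integral_le_const AE_I2 integrable_const_bound [where B = 1]) auto
        finally show "norm (integral\<^sup>L (K x) f) \<le> 1" by simp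
      qed (rule integral_measurable_subprob_algebra [THEN measurable_compose [OF K]], simp)
    qed
    have 2: "(CLINT y|K x. iexp (t * y)) = Complex (\<integral>y. cos (t * y) \<partial>K x) (\<integral>y. sin (t * y) \<partial>K x)"
      if "x \<in> space M" for x
      using int [OF that] by (simp add: complex_eq_iff integral_Re [symmetric] integral_Im [symmetric] Re_exp Im_exp)
    have "char (M \<bind> K) t = Complex (\<integral>y. cos (t * y) \<partial>(M \<bind> K)) (\<integral>y. sin (t * y) \<partial>(M \<bind> K))"
      using 1 by (simp add: char_def complex_eq_iff integral_Re [symmetric] integral_Im [symmetric] Re_exp Im_exp)
    also have "\<dots> = (\<integral>x. Complex (\<integral>y. cos (t * y) \<partial>K x) (\<integral>y. sin (t * y) \<partial>K x) \<partial>M)"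
      using real [of "\<lambda>y. cos (t * y)"] real [of "\<lambda>y. sin (t * y)"]
      by (simp add: Complex_eq)
    also have "\<dots> = (\<integral>x. char (K x) t \<partial>M)"
      unfolding char_def by (intro Bochner_Integration.integral_cong) (simp_all only: 2)
    finally show ?thesis .
  qed
  ultimately show ?thesis unfolding is_char_def by blast
qed

lemma integral_power_poisson:
  fixes c :: complex
  assumes "0 < l" "norm c \<le> 1"
  shows "(\<integral>n. c ^ n \<partial>measure_pmf (poisson_pmf l)) = exp (of_real l * (c - 1))"
proof -
  have *: "(\<lambda>n. (of_real l * c) ^ n /\<^sub>R fact n) sums exp (of_real l * c)"
    by (rule exp_converges)
  have int: "integrable (count_space UNIV) (\<lambda>n. (l ^ n / fact n * exp (-l)) *\<^sub>R c ^ n)"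
  proof (subst integrable_count_space_nat_iff, rule summable_comparison_test')
    show "summable (\<lambda>n. exp (-l) * (l ^ n /\<^sub>R fact n))"
      using exp_converges [of l] by (intro summable_mult) (auto simp: sums_iff)
    show "norm (norm ((l ^ n / fact n * exp (-l)) *\<^sub>R c ^ n)) \<le> exp (-l) * (l ^ n /\<^sub>R fact n)" for n
      using assms power_le_one [of "norm c" n] mult_left_le [of "norm c ^ n" "l ^ n / fact n * exp (-l)"]
      by (simp add: norm_mult norm_power field_simps)
  qed
  have "(\<integral>n. c ^ n \<partial>measure_pmf (poisson_pmf l)) = (\<integral>n. (l ^ n / fact n * exp (-l)) *\<^sub>R c ^ n \<partial>count_space UNIV)"
    using assms
    by (subst measure_pmf_eq_density, subst integral_density)
       (auto intro!: Bochner_Integration.integral_cong simp: mult.commute)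
  also have "\<dots> = (\<Sum>n. (l ^ n / fact n * exp (-l)) *\<^sub>R c ^ n)"
    using int by (rule integral_count_space_nat)
  also have "\<dots> = (\<Sum>n. exp (- of_real l) * ((of_real l * c) ^ n /\<^sub>R fact n))"
    by (intro suminf_cong) (simp add: scaleR_conv_of_real power_mult_distrib field_simps exp_of_real [symmetric])
  also have "\<dots> = exp (- of_real l) * exp (of_real l * c)"
    using * by (subst suminf_mult) (auto simp: sums_iff)
  finally show ?thesis by (simp add: exp_add [symmetric] algebra_simps)
qed

text \<open>Compound Poisson law: mixing the convolution powers over a Poisson number of summands
  yields the Poisson generating function at \<open>\<phi> t\<close>.\<close>

lemma is_char_exp:
  assumes "is_char \<phi>" "0 \<le> l"
  shows "is_char (\<lambda>t. exp (of_real l * (\<phi> t - 1)))"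
proof (cases "l = 0")
  case False
  have "\<forall>n. \<exists>M. real_distribution M \<and> char M = (\<lambda>t. \<phi> t ^ n)"
    using is_char_power [OF assms(1)] unfolding is_char_def by blast
  then obtain K where K: "\<And>n. real_distribution (K n)" "\<And>n. char (K n) = (\<lambda>t. \<phi> t ^ n)"
    by metis
  have "is_char (\<lambda>t. \<integral>n. char (K n) t \<partial>measure_pmf (poisson_pmf l))"
    using K(1)
    by (intro is_char_bind)
       (auto simp: prob_space_measure_pmf space_subprob_algebra real_distribution_def
          real_distribution_axioms_def prob_space_imp_subprob_space)
  also have "(\<lambda>t. \<integral>n. char (K n) t \<partial>measure_pmf (poisson_pmf l)) = (\<lambda>t. exp (of_real l * (\<phi> t - 1)))"
    using is_char_norm_le_1 [OF assms(1)] assms(2) False by (simp add: K(2) integral_power_poisson)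
  finally show ?thesis .
qed (simp add: is_char_1)

section \<open>Tightness of factors\<close>

lemma (in real_distribution) small_tail:
  assumes "0 < e"
  shows "\<exists>R. measure M {x. R \<le> \<bar>x\<bar>} < e"
proof -
  have "(\<lambda>n. measure M {x. real n \<le> \<bar>x\<bar>}) \<longlonglongrightarrow> measure M (\<Inter>n. {x. real n \<le> \<bar>x\<bar>})"
    by (rule finite_Lim_measure_decseq) (auto simp: decseq_def)
  also have "(\<Inter>n. {x::real. real n \<le> \<bar>x\<bar>}) = {}"
  proof -
    have "\<exists>n. \<bar>x\<bar> < real n" for x :: real by (rule reals_Archimedean2)
    then show ?thesis by (auto simp: set_eq_iff not_le)
  qed
  finally have "eventually (\<lambda>n. measure M {x. real n \<le> \<bar>x\<bar>} < e) sequentially"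
    using assms by (intro order_tendstoD) auto
  then show ?thesis by (auto simp: eventually_sequentially)
qed

lemma small_tail_mono:
  assumes "real_distribution M" "R \<le> R'"
  shows "measure M {x. R' \<le> \<bar>x\<bar>} \<le> measure M {x. R \<le> \<bar>x\<bar>}"
proof -
  interpret real_distribution M by fact
  show ?thesis using assms(2) by (intro finite_measure_mono) auto
qed

lemma tight_if_uniform_tail:
  assumes M: "\<And>n. real_distribution (M n)"
    and tail: "\<And>e. 0 < e \<Longrightarrow> \<exists>R. eventually (\<lambda>n. measure (M n) {x. R \<le> \<bar>x\<bar>} < e) sequentially"
  shows "tight M"
  unfolding tight_def
proof (intro conjI allI impI M)
  fix e :: real assume "0 < e"
  then obtain R0 N where R0: "\<And>n. N \<le> n \<Longrightarrow> measure (M n) {x. R0 \<le> \<bar>x\<bar>} < e"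
    using tail unfolding eventually_sequentially by blast
  obtain R where R: "\<And>n. measure (M n) {x. R n \<le> \<bar>x\<bar>} < e"
    using real_distribution.small_tail [OF M \<open>0 < e\<close>] by metis
  \<comment> \<open>The first \<open>N\<close> laws are tight one by one, the others share the
    radius \<open>R0\<close>. The entry 1 makes the interval from \<open>- r\<close> to
    \<open>r\<close> nonempty.\<close>
  define r where "r = Max (insert 1 (insert R0 (R ` {..<N})))"
  have r: "1 \<le> r" "R0 \<le> r" "\<And>n. n < N \<Longrightarrow> R n \<le> r"
    unfolding r_def by (rule Max_ge, simp, simp)+
  have bound: "measure (M n) {x. r \<le> \<bar>x\<bar>} < e" for n
  proof (cases "n < N")
    case True
    with small_tail_mono [OF M r(3)] R show ?thesis by (meson le_less_trans)
  next
    case False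
    with small_tail_mono [OF M r(2)] R0 show ?thesis by (meson le_less_trans not_less)
  qed
  have "1 - e < measure (M n) {-r<..r}" for n
  proof -
    interpret real_distribution "M n" by (rule M)
    have "1 - e < 1 - measure (M n) {x. r \<le> \<bar>x\<bar>}" using bound [of n] by simp
    also have "\<dots> = measure (M n) (UNIV - {x. r \<le> \<bar>x\<bar>})"
      using prob_compl [of "{x. r \<le> \<bar>x\<bar>}"] by simp
    also have "\<dots> \<le> measure (M n) {-r<..r}"
      by (intro finite_measure_mono) auto
    finally show ?thesis .
  qed
  with r(1) show "\<exists>a b. a < b \<and> (\<forall>n. 1 - e < measure (M n) {a<..b})"
    by (intro exI [of _ "-r"] exI [of _ r]) auto
qed

text \<open>A continuous ramp between the indicators of \<open>R + 1 \<le> \<bar>x\<bar>\<close> and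
  \<open>R \<le> \<bar>x\<bar>\<close> hands the tail of the limit law over to the sequence, at the
  price of enlarging the radius by 1.\<close>

lemma weak_conv_uniform_tail:
  assumes M: "\<And>n. real_distribution (M n)" and M': "real_distribution M'" and conv: "weak_conv_m M M'"
    and "0 < e"
  shows "\<exists>R. eventually (\<lambda>n. measure (M n) {x. R \<le> \<bar>x\<bar>} < e) sequentially"
proof -
  interpret M': real_distribution M' by fact
  obtain R where R: "measure M' {x. R \<le> \<bar>x\<bar>} < e"
    using M'.small_tail [OF \<open>0 < e\<close>] by blast
  define f where "f x = min 1 (max 0 (\<bar>x\<bar> - R))" for x :: real
  have f: "0 \<le> f x" "f x \<le> 1" "isCont f x" for x
    unfolding f_def [abs_def] by (auto intro!: continuous_intros)
  have [measurable]: "f \<in> borel_measurable borel"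
    using f(3) by (intro borel_measurable_continuous_onI continuous_at_imp_continuous_on) auto
  have f_int: "integrable N f" if "real_distribution N" for N
  proof -
    interpret real_distribution N by fact
    show ?thesis using f by (intro integrable_const_bound [where B = 1]) auto
  qed
  have "(\<lambda>n. integral\<^sup>L (M n) f) \<longlonglongrightarrow> integral\<^sup>L M' f"
    using f by (intro weak_conv_imp_integral_bdd_continuous_conv [OF M M' conv, where B = 1]) auto
  moreover have "integral\<^sup>L M' f < e"
  proof (rule le_less_trans)
    show "integral\<^sup>L M' f \<le> (\<integral>x. indicator {x. R \<le> \<bar>x\<bar>} x \<partial>M')"
    using f_int [OF M'] by (intro integral_mono M'.integrable_const_bound [where B = 1]) (auto simp: f_def indicator_def)
  qed (use R in simp)
  ultimately have "eventually (\<lambda>n. integral\<^sup>L (M n) f < e) sequentially"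
    by (rule order_tendstoD(2))
  then have "eventually (\<lambda>n. measure (M n) {x. R + 1 \<le> \<bar>x\<bar>} < e) sequentially"
  proof (rule eventually_mono)
    fix n assume "integral\<^sup>L (M n) f < e"
    interpret Mn: real_distribution "M n" by (rule M)
    have "(\<integral>x. indicator {x. R + 1 \<le> \<bar>x\<bar>} x \<partial>M n) \<le> integral\<^sup>L (M n) f"
      using f_int [OF M] by (intro integral_mono Mn.integrable_const_bound [where B = 1]) (auto simp: f_def indicator_def)
    then show "measure (M n) {x. R + 1 \<le> \<bar>x\<bar>} < e"
      using \<open>integral\<^sup>L (M n) f < e\<close> by simp
  qed
  then show ?thesis by blast
qed

text \<open>A summand of size at least \<open>R + r\<close> cannot be brought below \<open>R\<close>
  by an independent one of size less than \<open>r\<close>.\<close>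

lemma convolution_tail:
  assumes "real_distribution M" "real_distribution N"
  shows "measure M {x. R + r \<le> \<bar>x\<bar>} * measure N {x. \<bar>x\<bar> < r} \<le> measure (convolution M N) {x. R \<le> \<bar>x\<bar>}"
proof -
  interpret M: real_distribution M by fact
  interpret N: real_distribution N by fact
  interpret MN: pair_prob_space M N ..
  have "measure M {x. R + r \<le> \<bar>x\<bar>} * measure N {x. \<bar>x\<bar> < r}
    = measure (M \<Otimes>\<^sub>M N) ({x. R + r \<le> \<bar>x\<bar>} \<times> {x. \<bar>x\<bar> < r})"
    by (simp add: measure_def N.emeasure_pair_measure_Times enn2real_mult)
  also have "\<dots> \<le> measure (M \<Otimes>\<^sub>M N) ((\<lambda>(x, y). x + y) -` {x. R \<le> \<bar>x\<bar>} \<inter> space (M \<Otimes>\<^sub>M N))"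
    by (intro MN.finite_measure_mono measurable_sets [where A = borel]) (auto simp: space_pair_measure)
  also have "\<dots> = measure (convolution M N) {x. R \<le> \<bar>x\<bar>}"
    unfolding convolution_def by (rule measure_distr [symmetric]) simp_all
  finally show ?thesis .
qed

text \<open>
  The products \<open>\<psi> n z * \<eta> z\<close> converge to a characteristic function and hence are tight; tightness
  passes to the factor \<open>\<psi> n\<close>.
\<close>

lemma is_char_factor_limit:
  assumes "is_char \<phi>" "is_char \<eta>" "\<And>n. is_char (\<psi> n)"
    and lim: "\<And>z. (\<lambda>n. \<psi> n z * \<eta> z) \<longlonglongrightarrow> \<phi> z"
  shows "\<exists>\<kappa>. is_char \<kappa> \<and> (\<forall>z. \<phi> z = \<eta> z * \<kappa> z)"
proof -
  obtain L where L: "real_distribution L" "char L = \<phi>" using assms(1) by (auto simp: is_char_def)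
  obtain N where N: "real_distribution N" "char N = \<eta>" using assms(2) by (auto simp: is_char_def)
  obtain M where M: "\<And>n. real_distribution (M n)" "\<And>n. char (M n) = \<psi> n"
    using assms(3) unfolding is_char_def by metis
  interpret N: real_distribution N by (rule N)
  have conv: "weak_conv_m (\<lambda>n. convolution (M n) N) L"
    using lim by (intro levy_continuity L(1)) (auto simp: char_convolution M N L)
  \<comment> \<open>More than half of the mass of \<open>N\<close> lies in
    \<open>\<bar>x\<bar> < r\<close>, so the tail of \<open>M n\<close> at \<open>R + r\<close> is
    at most twice the tail of the convolution at \<open>R\<close>.\<close>
  obtain r where r: "measure N {x. r \<le> \<bar>x\<bar>} < 1 / 2"
    using N.small_tail [of "1 / 2"] by auto
  have half: "1 / 2 < measure N {x. \<bar>x\<bar> < r}"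
  proof -
    have "measure N (UNIV - {x. r \<le> \<bar>x\<bar>}) = 1 - measure N {x. r \<le> \<bar>x\<bar>}"
      using N.prob_compl [of "{x. r \<le> \<bar>x\<bar>}"] by simp
    moreover have "UNIV - {x. r \<le> \<bar>x\<bar>} = {x. \<bar>x\<bar> < r}" by auto
    ultimately show ?thesis using r by simp
  qed
  have "tight M"
  proof (rule tight_if_uniform_tail [OF M(1)])
    fix e :: real assume "0 < e"
    then obtain R where R: "eventually (\<lambda>n. measure (convolution (M n) N) {x. R \<le> \<bar>x\<bar>} < e / 2) sequentially"
      using weak_conv_uniform_tail [OF char_convolution(1) [OF M(1) N(1)] L(1) conv, of "e / 2"] by auto
    have "eventually (\<lambda>n. measure (M n) {x. R + r \<le> \<bar>x\<bar>} < e) sequentially"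
      using R
    proof (rule eventually_mono)
      fix n assume *: "measure (convolution (M n) N) {x. R \<le> \<bar>x\<bar>} < e / 2"
      have "measure (M n) {x. R + r \<le> \<bar>x\<bar>} * (1 / 2) \<le> measure (M n) {x. R + r \<le> \<bar>x\<bar>} * measure N {x. \<bar>x\<bar> < r}"
        using half by (intro mult_left_mono) auto
      also have "\<dots> < e / 2"
        using convolution_tail [OF M(1) N(1)] * by (rule le_less_trans)
      finally show "measure (M n) {x. R + r \<le> \<bar>x\<bar>} < e" by simp
    qed
    then show "\<exists>R. eventually (\<lambda>n. measure (M n) {x. R \<le> \<bar>x\<bar>} < e) sequentially" by blast
  qed
  then obtain s K where s: "strict_mono s" and K: "real_distribution K" "weak_conv_m (M \<circ> s) K"
    using tight_imp_convergent_subsubsequence [of M id] by (auto simp: strict_mono_id)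
  have "\<phi> z = \<eta> z * char K z" for z
  proof -
    have "(\<lambda>n. char ((M \<circ> s) n) z) \<longlonglongrightarrow> char K z"
      using M(1) K by (intro levy_continuity1) (auto simp: o_def)
    then have "(\<lambda>n. \<psi> (s n) z * \<eta> z) \<longlonglongrightarrow> char K z * \<eta> z"
      by (intro tendsto_mult) (auto simp: M(2))
    moreover have "(\<lambda>n. \<psi> (s n) z * \<eta> z) \<longlonglongrightarrow> \<phi> z"
      using LIMSEQ_subseq_LIMSEQ [OF lim s] by (simp add: o_def)
    ultimately show ?thesis using LIMSEQ_unique by (metis mult.commute)
  qed
  with K(1) show ?thesis unfolding is_char_def by blast
qed

section \<open>An entire function and Gaussian integrals\<close>

text \<open>In terms of the complementary exponential integral Ein this is - Ein (- c). The term for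
  \<open>n = 0\<close> has denominator 0 and is therefore 0.\<close>

definition ein :: "complex \<Rightarrow> complex" where
  "ein c = (\<Sum>n. 1 / (of_nat n * fact n) * c ^ n)"

text \<open>The value at 0 fills the removable singularity, so that this is the derivative of
  \<open>ein\<close> everywhere.\<close>

definition ein' :: "complex \<Rightarrow> complex" where
  "ein' c = (if c = 0 then 1 else (exp c - 1) / c)"

lemma has_field_derivative_ein: "(ein has_field_derivative ein' c) (at c)"
proof -
  let ?a = "\<lambda>n. 1 / (of_nat n * fact n) :: complex"
  have sm: "summable (\<lambda>n. ?a n * x ^ n)" for x
  proof (rule summable_comparison_test')
    show "summable (\<lambda>n. norm x ^ n /\<^sub>R fact n)" by (rule summable_exp_generic)
    show "norm (?a n * x ^ n) \<le> norm x ^ n /\<^sub>R fact n" for n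
    proof (cases n)
      case (Suc m)
      have "norm x ^ n * 1 \<le> norm x ^ n * real n"
        using Suc by (intro mult_left_mono) auto
      then show ?thesis
        using Suc by (simp add: norm_mult norm_divide norm_power divide_simps del: of_nat_Suc power_Suc)
    qed simp
  qed
  have "(ein has_field_derivative (\<Sum>n. diffs ?a n * c ^ n)) (at c)"
    unfolding ein_def using sm by (rule termdiffs_strong_converges_everywhere)
  also have "(\<Sum>n. diffs ?a n * c ^ n) = (\<Sum>n. c ^ n / fact (Suc n))"
    by (intro suminf_cong) (simp add: diffs_def divide_simps del: of_nat_Suc fact_Suc)
  also have "\<dots> = ein' c"
  proof (cases "c = 0")
    case True
    have "(\<lambda>n. c ^ n / fact (Suc n)) sums (\<Sum>n\<in>{0}. c ^ n / fact (Suc n))"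
      by (rule sums_finite) (auto simp: True)
    with True show ?thesis by (simp add: ein'_def sums_iff)
  next
    case False
    have "(\<lambda>n. c ^ Suc n /\<^sub>R fact (Suc n)) sums (exp c - c ^ 0 /\<^sub>R fact 0)"
      using exp_converges [of c] by (subst sums_Suc_iff) simp
    then have "(\<lambda>n. c ^ Suc n /\<^sub>R fact (Suc n) / c) sums ((exp c - 1) / c)"
      by (intro sums_divide) simp
    moreover have "c ^ Suc n /\<^sub>R fact (Suc n) / c = c ^ n / fact (Suc n)" for n
      using False by (simp add: scaleR_conv_of_real divide_inverse)
    ultimately show ?thesis
      using False by (simp only: sums_iff ein'_def if_False)
  qed
  finally show ?thesis .
qed

text \<open>Completing the square: a shift by \<open>Re k\<close> turns the modulus of the first
  integrand into a constant multiple of the normal density; the phase that is left gives the normal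
  characteristic function at \<open>Im k\<close>.\<close>

lemma integrable_gauss_exp:
  fixes k :: complex
  shows "integrable lborel (\<lambda>x. of_real (std_normal_density x) * exp (k * of_real x))"
    "integrable lborel (\<lambda>x. of_real (std_normal_density x * x) * exp (k * of_real x))"
    "(\<integral>x. of_real (std_normal_density x) * exp (k * of_real x) \<partial>lborel) = exp (k\<^sup>2 / 2)"
proof -
  have shift: "std_normal_density (x + Re k) * exp (Re k * (x + Re k)) = std_normal_density x * exp ((Re k)\<^sup>2 / 2)" for x
    by (simp add: std_normal_density_def exp_add [symmetric] power2_eq_square field_simps)
  have Re_Im: "exp (k * of_real y) = of_real (exp (Re k * y)) * iexp (Im k * y)" for y
    by (simp add: exp_of_real [symmetric] exp_add [symmetric] complex_eq_iff Re_exp Im_exp)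
  have meas: "(\<lambda>x. exp (k * of_real x)) \<in> borel_measurable borel"
    by (intro borel_measurable_continuous_onI continuous_intros)
  have norm_eq: "norm (exp (k * of_real x)) = exp (Re k * x)" for x by simp
  have "integrable lborel (\<lambda>x. std_normal_density x * exp (Re k * x))"
    by (rule lborel_integrable_real_affine_iff [of 1 _ "Re k", THEN iffD1])
       (auto simp: add.commute shift)
  then show "integrable lborel (\<lambda>x. of_real (std_normal_density x) * exp (k * of_real x))"
    by (rule Bochner_Integration.integrable_bound) (use meas in \<open>auto simp: norm_mult\<close>)
  have "integrable lborel (\<lambda>x. std_normal_density x * \<bar>x\<bar> * exp (Re k * x))"
  proof (rule lborel_integrable_real_affine_iff [of 1 _ "Re k", THEN iffD1])
    have "integrable lborel (\<lambda>x. exp ((Re k)\<^sup>2 / 2) * (std_normal_density x * \<bar>x\<bar> + \<bar>Re k\<bar> * std_normal_density x))"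
      using integrable_std_normal_moment_abs [of 1] by simp
    then show "integrable lborel (\<lambda>x. std_normal_density (Re k + 1 * x) * \<bar>Re k + 1 * x\<bar> * exp (Re k * (Re k + 1 * x)))"
    proof (rule Bochner_Integration.integrable_bound)
      show "AE x in lborel. norm (std_normal_density (Re k + 1 * x) * \<bar>Re k + 1 * x\<bar> * exp (Re k * (Re k + 1 * x)))
        \<le> norm (exp ((Re k)\<^sup>2 / 2) * (std_normal_density x * \<bar>x\<bar> + \<bar>Re k\<bar> * std_normal_density x))"
      proof (rule AE_I2)
        fix x
        have "std_normal_density (Re k + x) * \<bar>Re k + x\<bar> * exp (Re k * (Re k + x))
            = exp ((Re k)\<^sup>2 / 2) * std_normal_density x * \<bar>Re k + x\<bar>"
          using shift [of x] by (simp add: algebra_simps)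
        also have "\<dots> \<le> exp ((Re k)\<^sup>2 / 2) * std_normal_density x * (\<bar>x\<bar> + \<bar>Re k\<bar>)"
          by (intro mult_left_mono) auto
        finally show "norm (std_normal_density (Re k + 1 * x) * \<bar>Re k + 1 * x\<bar> * exp (Re k * (Re k + 1 * x)))
        \<le> norm (exp ((Re k)\<^sup>2 / 2) * (std_normal_density x * \<bar>x\<bar> + \<bar>Re k\<bar> * std_normal_density x))"
          by (simp add: algebra_simps abs_mult)
      qed
    qed auto
  qed simp
  then show "integrable lborel (\<lambda>x. of_real (std_normal_density x * x) * exp (k * of_real x))"
    by (rule Bochner_Integration.integrable_bound) (use meas in \<open>auto simp: norm_mult abs_mult\<close>)
  have "(\<integral>x. of_real (std_normal_density x) * exp (k * of_real x) \<partial>lborel)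
      = (\<integral>x. of_real (std_normal_density (Re k + x)) * exp (k * of_real (Re k + x)) \<partial>lborel)"
    by (subst lborel_integral_real_affine [where c = 1 and t = "Re k"]) auto
  also have "\<dots> = (\<integral>x. (exp ((Re k)\<^sup>2 / 2) * iexp (Im k * Re k)) * (std_normal_density x *\<^sub>R iexp (Im k * x)) \<partial>lborel)"
  proof (rule Bochner_Integration.integral_cong [OF refl])
    fix x
    have "of_real (std_normal_density (Re k + x)) * exp (k * of_real (Re k + x))
      = of_real (std_normal_density (x + Re k) * exp (Re k * (x + Re k))) * iexp (Im k * (Re k + x))"
      by (simp only: Re_Im of_real_mult add.commute mult.assoc)
    also have "\<dots> = (exp ((Re k)\<^sup>2 / 2) * iexp (Im k * Re k)) * (std_normal_density x *\<^sub>R iexp (Im k * x))"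
      unfolding shift by (simp add: scaleR_conv_of_real exp_add [symmetric] algebra_simps)
    finally show "of_real (std_normal_density (Re k + x)) * exp (k * of_real (Re k + x)) = \<dots>" .
  qed
  also have "\<dots> = (exp ((Re k)\<^sup>2 / 2) * iexp (Im k * Re k)) * char std_normal_distribution (Im k)"
    unfolding char_def by (subst integral_mult_right_zero, subst integral_density) auto
  also have "\<dots> = exp (k\<^sup>2 / 2)"
    unfolding char_std_normal_distribution
    by (simp add: exp_of_real [symmetric] exp_add [symmetric], rule arg_cong [where f = exp])
       (simp add: complex_eq_iff power2_eq_square field_simps)
  finally show "(\<integral>x. of_real (std_normal_density x) * exp (k * of_real x) \<partial>lborel) = exp (k\<^sup>2 / 2)" .
qed

text \<open>The function \<open>?F\<close> vanishes at both infinities, so its derivative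
  \<open>?f\<close> has integral 0, which expresses the first moment by the Gaussian integral
  without the factor \<open>x\<close>.\<close>

lemma integral_gauss_exp_moment:
  fixes k :: complex
  shows "(\<integral>x. of_real (std_normal_density x * x) * exp (k * of_real x) \<partial>lborel) = k * exp (k\<^sup>2 / 2)"
proof -
  let ?F = "\<lambda>x. of_real (std_normal_density x) * exp (k * of_real x)"
  let ?f = "\<lambda>x. k * (of_real (std_normal_density x) * exp (k * of_real x))
    - of_real (std_normal_density x * x) * exp (k * of_real x)"
  have int: "integrable lborel ?f"
    by (intro Bochner_Integration.integrable_diff integrable_mult_right integrable_gauss_exp)
  have dens: "(std_normal_density has_real_derivative - x * std_normal_density x) (at x)" for x
  proof -
    have "((\<lambda>x. exp (- x\<^sup>2 / 2)) has_real_derivative - x * exp (- x\<^sup>2 / 2)) (at x)"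
      by (auto intro!: derivative_eq_intros)
    from DERIV_cmult [OF this, of "1 / sqrt (2 * pi)"] show ?thesis
      unfolding std_normal_density_def by (simp only: mult_ac)
  qed
  have F_eq: "norm (?F x) = exp ((Re k)\<^sup>2 / 2) * std_normal_density (x - Re k)" for x
  proof -
    have "norm (?F x) = std_normal_density x * exp (Re k * x)"
      by (simp add: norm_mult)
    also have "\<dots> = exp ((Re k)\<^sup>2 / 2) * std_normal_density (x - Re k)"
      by (simp add: std_normal_density_def exp_add [symmetric] power2_eq_square field_simps)
    finally show ?thesis .
  qed
  have "(LBINT x=-\<infinity>..\<infinity>. ?f x) = 0 - 0"
  proof (rule interval_integral_FTC_integrable [where F = ?F])
    show "(?F has_vector_derivative ?f x) (at x)" for x
    proof -
      have 1: "((\<lambda>x. complex_of_real (std_normal_density x)) has_vector_derivative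
          of_real (- x * std_normal_density x)) (at x)"
        using dens by (intro has_vector_derivative_of_real)
          (simp add: has_real_derivative_iff_has_vector_derivative)
      have 2: "((\<lambda>x. exp (k * of_real x)) has_vector_derivative k * exp (k * of_real x)) (at x)"
        by (intro has_vector_derivative_real_field) (auto intro!: derivative_eq_intros)
      show ?thesis
        by (rule has_vector_derivative_eq_rhs [OF has_vector_derivative_mult [OF 1 2]])
          (simp add: algebra_simps)
    qed
    show "isCont ?f x" for x
      unfolding std_normal_density_def by (intro continuous_intros) auto
    show "set_integrable lborel (einterval (-\<infinity>) \<infinity>) ?f"
      using int by (simp add: set_integrable_def)
    have top: "(?F \<longlongrightarrow> 0) at_top"
    proof (rule tendsto_norm_zero_cancel)
      show "((\<lambda>x. norm (?F x)) \<longlongrightarrow> 0) at_top"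
        unfolding F_eq unfolding std_normal_density_def by real_asymp
    qed
    have bot: "(?F \<longlongrightarrow> 0) at_bot"
    proof (rule tendsto_norm_zero_cancel)
      show "((\<lambda>x. norm (?F x)) \<longlongrightarrow> 0) at_bot"
        unfolding F_eq unfolding std_normal_density_def by real_asymp
    qed
    show "((?F \<circ> real_of_ereal) \<longlongrightarrow> 0) (at_right (-\<infinity>))"
      using bot by (simp add: ereal_tendsto_simps)
    show "((?F \<circ> real_of_ereal) \<longlongrightarrow> 0) (at_left \<infinity>)"
      using top by (simp add: ereal_tendsto_simps)
  qed simp
  then have "(\<integral>x. ?f x \<partial>lborel) = 0"
    by (simp add: interval_lebesgue_integral_def set_lebesgue_integral_def)
  then show ?thesis
    unfolding Bochner_Integration.integral_diff [OF integrable_mult_right [OF integrable_gauss_exp(1)] integrable_gauss_exp(2)]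
    by (simp add: integrable_gauss_exp(3))
qed

section \<open>Extremes of a Brownian motion with drift\<close>

lemma exponential_sqrt_substitution:
  fixes h :: "real \<Rightarrow> real"
  assumes [measurable]: "h \<in> borel_measurable borel" and h: "\<And>x. \<bar>h x\<bar> \<le> B"
  shows "integrable lborel (\<lambda>s. indicator {\<bar>y\<bar><..} s * (s * exp ((y\<^sup>2 - s\<^sup>2) / 2) * h s))"
    "(\<integral>e. h (sqrt (y\<^sup>2 + 2 * e)) \<partial>density lborel (exponential_density 1))
      = (\<integral>s. indicator {\<bar>y\<bar><..} s * (s * exp ((y\<^sup>2 - s\<^sup>2) / 2) * h s) \<partial>lborel)"
proof -
  let ?f = "\<lambda>e. exp (- e) * h (sqrt (y\<^sup>2 + 2 * e))"
  \<comment> \<open>Inverse of the substitution \<open>s = sqrt (y\<^sup>2 + 2 * e)\<close>. Its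
    derivative \<open>s\<close> is the extra factor in the transformed integral.\<close>
  let ?g = "\<lambda>s. (s\<^sup>2 - y\<^sup>2) / 2"
  let ?S = "{\<bar>y\<bar><..}"
  have image: "?g ` ?S = {0<..}"
  proof (intro equalityI subsetI)
    fix e :: real assume "e \<in> {0<..}"
    then have "e = ?g (sqrt (y\<^sup>2 + 2 * e))" and "\<bar>y\<bar> < sqrt (y\<^sup>2 + 2 * e)"
      by (auto intro!: real_less_rsqrt)
    then show "e \<in> ?g ` ?S" by blast
  next
    fix e assume "e \<in> ?g ` ?S"
    then obtain s where s: "\<bar>y\<bar> < s" "e = ?g s" by blast
    then have "\<bar>y\<bar>\<^sup>2 < s\<^sup>2" by (intro power_strict_mono) auto
    with s show "e \<in> {0<..}" by simp
  qed
  have inj: "inj_on ?g ?S"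
    by (rule inj_onI) (auto simp: power2_eq_iff)
  have der: "(?g has_field_derivative s) (at s within ?S)" for s
    by (auto intro!: derivative_eq_intros)
  have prob: "prob_space (density lborel (exponential_density 1))"
    by (rule prob_space_exponential_density) simp
  have int_h: "integrable (density lborel (exponential_density 1)) (\<lambda>e. h (sqrt (y\<^sup>2 + 2 * e)))"
    using h by (intro finite_measure.integrable_const_bound [where B = B] prob_space.finite_measure prob) auto
  have f_eq: "exponential_density 1 e * h (sqrt (y\<^sup>2 + 2 * e)) = indicator {0..} e * ?f e" for e
    by (simp add: exponential_density_def indicator_def)
  have "integrable lborel (\<lambda>e. indicator {0..} e * ?f e)"
    using int_h by (subst (asm) integrable_density) (auto simp: f_eq exponential_density_nonneg)
  then have f0: "set_integrable lborel {0..} ?f"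
    by (simp add: set_integrable_def)
  then have f: "set_integrable lborel {0<..} ?f"
    by (rule set_integrable_subset) auto
  have f_abs: "?f absolutely_integrable_on ?g ` ?S"
    unfolding image using f by (simp add: set_integrable_def integrable_completion)
  have fg: "\<bar>s\<bar> * ?f (?g s) = s * exp ((y\<^sup>2 - s\<^sup>2) / 2) * h s" if "s \<in> ?S" for s
  proof -
    have "0 < s" using that by auto
    moreover have "- ?g s = (y\<^sup>2 - s\<^sup>2) / 2" by (simp add: field_simps)
    moreover have "y\<^sup>2 + 2 * ?g s = s\<^sup>2" by (simp add: field_simps)
    then have "sqrt (y\<^sup>2 + 2 * ?g s) = s" using \<open>0 < s\<close> by (simp only: real_sqrt_abs abs_of_pos)
    ultimately show ?thesis by (simp only: mult.assoc abs_of_pos)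
  qed
  have *: "(\<lambda>s. \<bar>s\<bar> * ?f (?g s)) absolutely_integrable_on ?S"
    "integral ?S (\<lambda>s. \<bar>s\<bar> * ?f (?g s)) = integral (?g ` ?S) ?f"
    using has_absolute_integral_change_of_variables_1' [OF _ der inj, of ?f "integral (?g ` ?S) ?f"] f_abs by auto
  have "(\<lambda>s. s * exp ((y\<^sup>2 - s\<^sup>2) / 2) * h s) absolutely_integrable_on ?S"
    using *(1) fg by (subst (asm) set_integrable_cong) auto
  then have G: "set_integrable lborel ?S (\<lambda>s. s * exp ((y\<^sup>2 - s\<^sup>2) / 2) * h s)"
    by (simp add: set_integrable_def integrable_completion)
  then show "integrable lborel (\<lambda>s. indicator ?S s * (s * exp ((y\<^sup>2 - s\<^sup>2) / 2) * h s))"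
    by (simp add: set_integrable_def)
  have "(\<integral>e. h (sqrt (y\<^sup>2 + 2 * e)) \<partial>density lborel (exponential_density 1))
      = (LBINT e:{0..}. ?f e)"
    unfolding set_lebesgue_integral_def
    by (subst integral_density) (auto simp: f_eq exponential_density_nonneg)
  also have "\<dots> = (LBINT e:{0<..}. ?f e)"
    by (rule set_integral_cong_set)
       (auto simp: set_borel_measurable_def intro!: AE_I [where N = "{0}"] split: split_indicator)
  also have "\<dots> = integral (?g ` ?S) ?f"
    unfolding image using f by (rule set_borel_integral_eq_integral)
  also have "\<dots> = integral ?S (\<lambda>s. s * exp ((y\<^sup>2 - s\<^sup>2) / 2) * h s)"
    unfolding *(2) [symmetric] using fg by (intro integral_cong) auto
  also have "\<dots> = (LBINT s:?S. s * exp ((y\<^sup>2 - s\<^sup>2) / 2) * h s)"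
    using G by (rule set_borel_integral_eq_integral(2) [symmetric])
  finally show "(\<integral>e. h (sqrt (y\<^sup>2 + 2 * e)) \<partial>density lborel (exponential_density 1))
      = (\<integral>s. indicator ?S s * (s * exp ((y\<^sup>2 - s\<^sup>2) / 2) * h s) \<partial>lborel)"
    by (simp add: set_lebesgue_integral_def)
qed

lemma integral_exp_interval:
  fixes k :: complex
  assumes "k \<noteq> 0" "0 \<le> s"
  shows "integrable lborel (\<lambda>y. indicator {-s<..<s} y *\<^sub>R exp (k * of_real y))"
    "(\<integral>y. indicator {-s<..<s} y *\<^sub>R exp (k * of_real y) \<partial>lborel) = (exp (k * s) - exp (- k * s)) / k"
proof -
  have cont: "continuous_on {-s..s} (\<lambda>y. exp (k * of_real y))"
    by (intro continuous_intros)
  have int: "set_integrable lborel {-s..s} (\<lambda>y. exp (k * of_real y))"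
    using cont by (intro borel_integrable_atLeastAtMost') 
  then show "integrable lborel (\<lambda>y. indicator {-s<..<s} y *\<^sub>R exp (k * of_real y))"
    unfolding set_integrable_def [symmetric] by (rule set_integrable_subset) auto
  have "(LBINT y=-s..s. exp (k * of_real y)) = exp (k * s) / k - exp (k * of_real (-s)) / k"
  proof (rule interval_integral_FTC_finite)
    show "continuous_on {min (- s) s..max (- s) s} (\<lambda>y. exp (k * of_real y))"
      by (intro continuous_intros)
    show "((\<lambda>y. exp (k * of_real y) / k) has_vector_derivative exp (k * of_real y)) (at y within {min (- s) s..max (- s) s})" for y :: real
      using assms(1)
      by (auto intro!: derivative_eq_intros has_vector_derivative_real_field simp: field_simps)
  qed
  then show "(\<integral>y. indicator {-s<..<s} y *\<^sub>R exp (k * of_real y) \<partial>lborel) = (exp (k * s) - exp (- k * s)) / k"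
    using assms by (simp add: interval_lebesgue_integral_def einterval_eq set_lebesgue_integral_def diff_divide_distrib)
qed

text \<open>This is the case of variance 1 and drift \<open>d\<close>. Given the end point
  \<open>y\<close> of the path, its maximum exceeds \<open>m\<close> with probability
  \<open>exp (- 2 * m * (m - y))\<close>; hence \<open>2 * m * (m - y)\<close> is a standard
  exponential variable \<open>e\<close>, and \<open>s = 2 * m - y\<close> is the square root in the
  statement. Sum of the exponentials at maximum and minimum: twice a cosine of
  \<open>z * s / 2\<close> times a phase in \<open>y\<close>. Exchanging the order of integration
  makes the integral over \<open>\<bar>y\<bar> < s\<close> elementary; the factor
  \<open>\<i> * z + 2 * d\<close> clears its denominator.\<close>

lemma max_min_transform_1:
  fixes z d :: real
  defines "S \<equiv> std_normal_distribution" and "X \<equiv> density lborel (exponential_density (1::real))"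
  shows "(\<integral>x. iexp (z * (x + d) / 2) * of_real (\<integral>e. 2 * cos (z / 2 * sqrt ((x + d)\<^sup>2 + 2 * e)) \<partial>X) \<partial>S)
     * (\<i> * z + 2 * d) = 2 * ((d + \<i> * z) * exp (\<i> * d * z - z\<^sup>2 / 2) + d)"
proof (cases "\<i> * z + 2 * d = 0")
  case True
  then have "z = 0" "d = 0" by (auto simp: complex_eq_iff)
  then show ?thesis by simp
next
  case False
  define k where "k = \<i> * z / 2 + d"
  have k: "k \<noteq> 0" "2 * k = \<i> * z + 2 * d" using False by (auto simp: k_def field_simps)
  define h where "h s = 2 * cos (z / 2 * s)" for s :: real
  have [measurable]: "h \<in> borel_measurable borel" by (simp add: h_def [abs_def])
  have h: "\<bar>h s\<bar> \<le> 2" for s by (simp add: h_def abs_mult)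
  define \<phi> where "\<phi> = std_normal_density"
  have [measurable]: "\<phi> \<in> borel_measurable borel" by (simp add: \<phi>_def)
  have \<phi>_nonneg: "0 \<le> \<phi> x" for x by (simp add: \<phi>_def)
  define D where "D = exp (- d\<^sup>2 / 2)"
  define F where "F y s = indicator {\<bar>y\<bar><..} s *\<^sub>R (of_real (s * \<phi> s * D * h s) * exp (k * of_real y))" for y s :: real
  have F_meas [measurable]: "(\<lambda>(y, s). F y s) \<in> borel_measurable (borel \<Otimes>\<^sub>M borel)"
  proof -
    have [measurable]: "(\<lambda>y. exp (k * of_real y)) \<in> borel_measurable borel"
      by (intro borel_measurable_continuous_onI continuous_intros)
    have "F y s = (if \<bar>y\<bar> < s then of_real (s * \<phi> s * D * h s) * exp (k * of_real y) else 0)" for y s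
      by (simp add: F_def)
    then show ?thesis by simp
  qed
  \<comment> \<open>Cameron-Martin: the drift becomes the factor \<open>D * exp (d * y)\<close>, and
    apart from it the joint density of \<open>y\<close> and \<open>s\<close> depends on
    \<open>s\<close> only.\<close>
  have dens: "\<phi> (y - d) * exp ((y\<^sup>2 - s\<^sup>2) / 2) = \<phi> s * D * exp (d * y)" for y s
    by (simp add: \<phi>_def D_def std_normal_density_def exp_add [symmetric] power2_eq_square field_simps)
  have exp_k: "exp (k * of_real y) = of_real (exp (d * y)) * iexp (z * y / 2)" for y
    by (simp add: k_def exp_of_real [symmetric] exp_add [symmetric] algebra_simps)
  let ?G = "\<lambda>y s. indicator {\<bar>y\<bar><..} s * (s * exp ((y\<^sup>2 - s\<^sup>2) / 2) * h s)"
  have F_eq: "F y s = (of_real (\<phi> (y - d)) * iexp (z * y / 2)) * of_real (?G y s)" for y s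
  proof -
    have "(of_real (\<phi> (y - d)) * iexp (z * y / 2)) * of_real (?G y s)
      = indicator {\<bar>y\<bar><..} s *\<^sub>R (of_real (s * h s * (\<phi> (y - d) * exp ((y\<^sup>2 - s\<^sup>2) / 2))) * iexp (z * y / 2))"
      by (simp add: scaleR_conv_of_real indicator_def)
    also have "\<dots> = F y s"
      unfolding dens F_def exp_k by (simp add: scaleR_conv_of_real mult_ac)
    finally show ?thesis by simp
  qed
  note sub = exponential_sqrt_substitution [of h, OF _ h, folded X_def, simplified]
  interpret X: prob_space X
    unfolding X_def by (rule prob_space_exponential_density) simp
  have [measurable_cong]: "sets X = sets borel" by (simp add: X_def)
  have int1: "integrable lborel (F y)" for y
    unfolding F_eq [abs_def] using sub(1) [of y] by (intro integrable_mult_right integrable_of_real)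
  have inner1: "(\<integral>s. F y s \<partial>lborel) = of_real (\<phi> (y - d)) * (iexp (z * y / 2) * of_real (\<integral>e. h (sqrt (y\<^sup>2 + 2 * e)) \<partial>X))" for y
    unfolding F_eq sub(2) integral_mult_right_zero integral_complex_of_real by (simp only: mult.assoc)
  have norm1: "(\<integral>s. norm (F y s) \<partial>lborel) = \<phi> (y - d) * (\<integral>e. \<bar>h (sqrt (y\<^sup>2 + 2 * e))\<bar> \<partial>X)" for y
  proof -
    have "norm (F y s) = \<phi> (y - d) * (indicator {\<bar>y\<bar><..} s * (s * exp ((y\<^sup>2 - s\<^sup>2) / 2) * \<bar>h s\<bar>))" for s
      unfolding F_eq by (auto simp: norm_mult \<phi>_nonneg abs_mult indicator_def)
    then show ?thesis
      using exponential_sqrt_substitution(2) [of "\<lambda>s. \<bar>h s\<bar>" 2 y, folded X_def] h by simp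
  qed
  have int: "integrable (lborel \<Otimes>\<^sub>M lborel) (\<lambda>(y, s). F y s)"
  proof (rule lborel_pair.Fubini_integrable)
    have "integrable lborel (\<lambda>y. \<phi> (y - d) * 2)"
      unfolding \<phi>_def by (intro integrable_mult_left, rule lborel_integrable_real_affine_iff [of 1 _ d, THEN iffD1]) auto
    then show "integrable lborel (\<lambda>y. \<integral>s. norm (case (y, s) of (y, s) \<Rightarrow> F y s) \<partial>lborel)"
    proof (rule Bochner_Integration.integrable_bound)
      show "AE y in lborel. norm (\<integral>s. norm (case (y, s) of (y, s) \<Rightarrow> F y s) \<partial>lborel) \<le> norm (\<phi> (y - d) * 2)"
      proof (rule AE_I2)
        fix y
        have "0 \<le> (\<integral>e. \<bar>h (sqrt (y\<^sup>2 + 2 * e))\<bar> \<partial>X)" by (rule integral_nonneg_AE) simp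
        moreover have "(\<integral>e. \<bar>h (sqrt (y\<^sup>2 + 2 * e))\<bar> \<partial>X) \<le> 2"
          by (intro X.integral_le_const X.integrable_const_bound [where B = 2] AE_I2) (auto simp: h X_def)
        ultimately show "norm (\<integral>s. norm (case (y, s) of (y, s) \<Rightarrow> F y s) \<partial>lborel) \<le> norm (\<phi> (y - d) * 2)"
          by (simp add: norm1 \<phi>_nonneg abs_mult mult_left_mono)
      qed
    qed simp
  qed (use int1 in auto)
  have inner2: "(\<integral>y. F y s \<partial>lborel) = indicator {0<..} s *\<^sub>R (of_real (s * \<phi> s * D * h s) * ((exp (k * s) - exp (- k * s)) / k))" for s
  proof (cases "0 < s")
    case True
    have "(\<integral>y. F y s \<partial>lborel) = (\<integral>y. of_real (s * \<phi> s * D * h s) * (indicator {-s<..<s} y *\<^sub>R exp (k * of_real y)) \<partial>lborel)"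
      by (intro Bochner_Integration.integral_cong) (auto simp: F_def indicator_def)
    also have "\<dots> = of_real (s * \<phi> s * D * h s) * ((exp (k * s) - exp (- k * s)) / k)"
      unfolding integral_mult_right_zero using integral_exp_interval(2) [OF k(1), of s] True by simp
    finally show ?thesis using True by simp
  next
    case False
    then have "F y s = 0" for y by (simp add: F_def)
    with False show ?thesis by simp
  qed
  \<comment> \<open>The cosine splits into two exponentials that shift \<open>k * s\<close> to
    \<open>(d + \<i> * z) * s\<close> and to \<open>d * s\<close>; the two summands are Gaussian
    first moments.\<close>
  define g where "g s = of_real (s * \<phi> s) * exp ((d + \<i> * z) * of_real s) + of_real (s * \<phi> s) * exp (complex_of_real d * of_real s)" for s :: real
  have g_int: "integrable lborel g"
    unfolding g_def \<phi>_def using integrable_gauss_exp(2) [of "d + \<i> * z"] integrable_gauss_exp(2) [of "of_real d"]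
    by (intro Bochner_Integration.integrable_add) (simp_all add: mult_ac)
  have g_eq: "of_real (s * \<phi> s * h s) * exp (k * s) = g s" for s :: real
  proof -
    have "of_real (h s) = iexp (z * s / 2) + exp (- (\<i> * (z * s / 2)))"
      unfolding h_def by (simp add: cos_exp_eq cos_of_real [symmetric] mult_ac)
    then show ?thesis
      unfolding g_def k_def by (simp add: exp_add [symmetric] algebra_simps)
  qed
  \<comment> \<open>The term with \<open>exp (- k * s)\<close> mirrors the other one at 0, so the
    integral over the half-line unfolds to one over the whole line.\<close>
  have g_minus: "of_real (s * \<phi> s * h s) * exp (- k * s) = - g (- s)" for s :: real
    unfolding g_eq [symmetric] by (simp add: \<phi>_def std_normal_density_def h_def)
  have "(\<integral>x. iexp (z * (x + d) / 2) * of_real (\<integral>e. h (sqrt ((x + d)\<^sup>2 + 2 * e)) \<partial>X) \<partial>S)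
    = (\<integral>x. of_real (\<phi> x) * (iexp (z * (x + d) / 2) * of_real (\<integral>e. h (sqrt ((x + d)\<^sup>2 + 2 * e)) \<partial>X)) \<partial>lborel)"
    unfolding S_def \<phi>_def by (subst integral_density) (auto simp: scaleR_conv_of_real)
  also have "\<dots> = (\<integral>y. of_real (\<phi> (y - d)) * (iexp (z * y / 2) * of_real (\<integral>e. h (sqrt (y\<^sup>2 + 2 * e)) \<partial>X)) \<partial>lborel)"
    by (subst (2) lborel_integral_real_affine [where c = 1 and t = d]) (auto simp: add.commute)
  also have "\<dots> = (\<integral>y. (\<integral>s. F y s \<partial>lborel) \<partial>lborel)"
    by (simp only: inner1)
  also have "\<dots> = (\<integral>s. (\<integral>y. F y s \<partial>lborel) \<partial>lborel)"
    using lborel_pair.Fubini_integral [OF int] by simp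
  also have "\<dots> = (\<integral>s. D / k * (indicator {0<..} s *\<^sub>R g s + indicator {0<..} s *\<^sub>R g (- s)) \<partial>lborel)"
  proof (rule Bochner_Integration.integral_cong [OF refl])
    fix s
    have "of_real (s * \<phi> s * D * h s) * ((exp (k * s) - exp (- k * s)) / k)
      = D / k * (of_real (s * \<phi> s * h s) * exp (k * s) - of_real (s * \<phi> s * h s) * exp (- k * s))"
      by (simp add: algebra_simps diff_divide_distrib)
    also have "\<dots> = D / k * (g s + g (- s))"
      unfolding g_eq g_minus by simp
    finally show "(\<integral>y. F y s \<partial>lborel) = D / k * (indicator {0<..} s *\<^sub>R g s + indicator {0<..} s *\<^sub>R g (- s))"
      unfolding inner2 by (simp add: indicator_def)
  qed
  also have "\<dots> = D / k * (\<integral>s. g s \<partial>lborel)"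
  proof -
    have 1: "integrable lborel (\<lambda>s. indicator {0<..} s *\<^sub>R g s)" "integrable lborel (\<lambda>s. indicator {..<0} s *\<^sub>R g s)"
      using g_int by (auto intro!: integrable_mult_indicator)
    have 2: "indicator {..<0} (- s) *\<^sub>R g (- s) = indicator {0<..} s *\<^sub>R g (- s)" for s :: real
      by (simp add: indicator_def)
    have 3: "integrable lborel (\<lambda>s. indicator {0<..} s *\<^sub>R g (- s))"
      using lborel_integrable_real_affine [OF 1(2), of "-1" 0] by (simp add: 2)
    have 4: "(\<integral>s. indicator {0<..} s *\<^sub>R g (- s) \<partial>lborel) = (\<integral>s. indicator {..<0} s *\<^sub>R g s \<partial>lborel)"
      by (subst lborel_integral_real_affine [where c = "-1" and t = 0]) (auto simp: indicator_def intro!: Bochner_Integration.integral_cong)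
    have "(\<integral>s. indicator {0<..} s *\<^sub>R g s \<partial>lborel) + (\<integral>s. indicator {0<..} s *\<^sub>R g (- s) \<partial>lborel)
      = (\<integral>s. indicator {0<..} s *\<^sub>R g s + indicator {..<0} s *\<^sub>R g s \<partial>lborel)"
      unfolding 4 using 1 by simp
    also have "\<dots> = (\<integral>s. g s \<partial>lborel)"
    proof (rule integral_cong_AE)
      show "AE s in lborel. indicator {0<..} s *\<^sub>R g s + indicator {..<0} s *\<^sub>R g s = g s"
        by (rule AE_I [where N = "{0}"]) (auto simp: indicator_def)
    qed (use g_int in auto)
    finally show ?thesis
      using 1 3 by simp
  qed
  also have "(\<integral>s. g s \<partial>lborel) = (d + \<i> * z) * exp ((d + \<i> * z)\<^sup>2 / 2) + d * exp ((complex_of_real d)\<^sup>2 / 2)"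
    unfolding g_def \<phi>_def
    using integrable_gauss_exp(2) [of "d + \<i> * z"] integrable_gauss_exp(2) [of "of_real d"]
      integral_gauss_exp_moment [of "d + \<i> * z"] integral_gauss_exp_moment [of "of_real d"]
    by (subst Bochner_Integration.integral_add) (simp_all add: mult_ac)
  also have "D / k * \<dots> = ((d + \<i> * z) * exp (\<i> * d * z - z\<^sup>2 / 2) + d) / k"
  proof -
    have "of_real D * exp ((d + \<i> * z)\<^sup>2 / 2) = exp (\<i> * d * z - z\<^sup>2 / 2)"
      unfolding D_def exp_of_real [symmetric] exp_add [symmetric]
      by (rule arg_cong [where f = exp]) (simp add: power2_eq_square field_simps)
    moreover have "of_real D * exp ((complex_of_real d)\<^sup>2 / 2) = (1 :: complex)"
      unfolding D_def exp_of_real [symmetric] exp_add [symmetric] by simp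
    ultimately show ?thesis by (simp add: algebra_simps add_divide_distrib)
  qed
  finally show ?thesis
    unfolding h_def k(2) [symmetric] using k(1) by simp
qed


text \<open>
  By the joint law of a Brownian motion with drift and its running maximum (minimum), for
  \<open>x\<close> standard normal, \<open>e\<close> standard exponential and \<open>X = sqrt a * x + g\<close>, the variables
  \<open>(X + sqrt (X\<^sup>2 + 2 * a * e)) / 2\<close> and \<open>(X - sqrt (X\<^sup>2 + 2 * a * e)) / 2\<close> are distributed as the maximum
  and the minimum over the time interval \<open>[0, 1]\<close> of a Brownian motion with drift \<open>g\<close> and variance \<open>a\<close>.
\<close>

lemma max_min_transform:
  fixes z a g :: real
  assumes "0 \<le> a"
  defines "S \<equiv> std_normal_distribution" and "X \<equiv> density lborel (exponential_density (1::real))"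
  defines "w \<equiv> \<i> * g * z - a * z\<^sup>2 / 2"
  shows "(\<integral>x. iexp (z * (sqrt a * x + g) / 2) * of_real (\<integral>e. 2 * cos (z / 2 * sqrt ((sqrt a * x + g)\<^sup>2 + 2 * a * e)) \<partial>X) \<partial>S)
     = 2 + (\<i> * g * z - a * z\<^sup>2) * ein' w"
    (is "?L = _")
proof -
  interpret S: prob_space S
    unfolding S_def by (rule prob_space_normal_density) simp
  interpret X: prob_space X
    unfolding X_def by (rule prob_space_exponential_density) simp
  have key: "?L * (\<i> * a * z + 2 * g) = 2 * ((g + \<i> * a * z) * exp w + g)"
  proof (cases "a = 0")
    \<comment> \<open>Without variance the path is a straight line, with extremes \<open>g\<close>
      and 0.\<close>
    case True
    have "sqrt ((sqrt a * x + g)\<^sup>2 + 2 * a * e) = \<bar>g\<bar>" for x e using True by simp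
    then have "?L = iexp (z * g / 2) * of_real (2 * cos (z / 2 * \<bar>g\<bar>))"
      using True by (simp add: S.prob_space X.prob_space)
    also have "cos (z / 2 * \<bar>g\<bar>) = cos (z * g / 2)"
      by (simp add: abs_if)
    also have "iexp (z * g / 2) * of_real (2 * cos (z * g / 2)) = exp w + 1"
      unfolding w_def True by (simp add: cos_exp_eq cos_of_real [symmetric] algebra_simps exp_add [symmetric])
    finally show ?thesis using True by (simp add: algebra_simps)
  next
    case False
    \<comment> \<open>Brownian scaling: division by \<open>sqrt a\<close> leads to variance 1 and
      replaces \<open>z\<close> by \<open>z * sqrt a\<close>.\<close>
    define d where "d = g / sqrt a"
    have a: "0 < sqrt a" "sqrt a * sqrt a = a" using assms False by auto
    have g: "g = sqrt a * d" using a by (simp add: d_def)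
    have g': "sqrt a * x + g = sqrt a * (x + d)" for x by (simp add: g algebra_simps)
    have R: "sqrt ((sqrt a * (x + d))\<^sup>2 + 2 * a * e) = sqrt a * sqrt ((x + d)\<^sup>2 + 2 * e)" for x e
    proof -
      have "(sqrt a * (x + d))\<^sup>2 + 2 * a * e = a * ((x + d)\<^sup>2 + 2 * e)"
        using assms(1) by (simp only: power_mult_distrib real_sqrt_pow2) (simp add: algebra_simps)
      then show ?thesis by (simp only: real_sqrt_mult)
    qed
    have "?L * (\<i> * (z * sqrt a) + 2 * d) = 2 * ((d + \<i> * (z * sqrt a)) * exp (\<i> * d * (z * sqrt a) - (z * sqrt a)\<^sup>2 / 2) + d)"
      using max_min_transform_1 [of "z * sqrt a" d] unfolding g' R S_def X_def by (simp add: mult_ac)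
    also have "\<i> * d * (z * sqrt a) - (z * sqrt a)\<^sup>2 / 2 = w"
      using assms unfolding w_def g by (simp add: power_mult_distrib of_real_power [symmetric] mult_ac del: of_real_power)
    finally have "sqrt a * (?L * (\<i> * (z * sqrt a) + 2 * d)) = sqrt a * (2 * ((d + \<i> * (z * sqrt a)) * exp w + d))"
      by simp
    moreover have "complex_of_real a = of_real (sqrt a) * of_real (sqrt a)"
      unfolding of_real_mult [symmetric] using a by simp
    ultimately show ?thesis by (simp add: g algebra_simps)
  qed
  \<comment> \<open>The factor \<open>\<i> * a * z + 2 * g\<close> of \<open>key\<close> divides
    \<open>2 * w\<close>; multiplying \<open>key\<close> by \<open>\<i> * z\<close> thus produces
    the quotient by \<open>w\<close> that defines \<open>ein'\<close>.\<close>
  have w2: "2 * w = \<i> * z * (\<i> * a * z + 2 * g)"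
    unfolding w_def by (simp add: algebra_simps power2_eq_square)
  define L where "L = ?L"
  have "L = 2 + (\<i> * g * z - a * z\<^sup>2) * ein' w"
  proof (cases "w = 0")
    case False
    then have nz: "\<i> * a * z + 2 * g \<noteq> 0" "z \<noteq> 0" using w2 by auto
    have "(L - 2) * (\<i> * a * z + 2 * g) = 2 * ((g + \<i> * a * z) * (exp w - 1))"
      using key unfolding L_def [symmetric] by (simp add: algebra_simps)
    then have "\<i> * z * ((L - 2) * (\<i> * a * z + 2 * g)) = 2 * ((\<i> * g * z - a * z\<^sup>2) * (exp w - 1))"
      by (simp only:) (simp add: algebra_simps power2_eq_square)
    then have "(L - 2) * (2 * w) = 2 * ((\<i> * g * z - a * z\<^sup>2) * (exp w - 1))"
      unfolding w2 by (simp only: mult_ac)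
    then have "2 * ((L - 2) * w) = 2 * ((\<i> * g * z - a * z\<^sup>2) * (exp w - 1))"
      by (simp only: mult_ac)
    then have "(L - 2) * w = (\<i> * g * z - a * z\<^sup>2) * (exp w - 1)"
      by (simp only: mult_cancel_left) simp
    with False have "L - 2 = (\<i> * g * z - a * z\<^sup>2) * ((exp w - 1) / w)"
      by (simp add: eq_divide_eq)
    then show ?thesis using False by (simp add: ein'_def diff_eq_eq add.commute)
  next
    case True
    then have "z = 0 \<or> \<i> * a * z + 2 * g = 0" using w2 by auto
    then have "z = 0 \<or> a = 0 \<and> g = 0" by (auto simp: complex_eq_iff)
    then show ?thesis
      by (auto simp: L_def S.prob_space X.prob_space)
  qed
  then show ?thesis unfolding L_def .
qed

lemma isCont_ein: "isCont ein c"
  using has_field_derivative_ein by (rule DERIV_isCont)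

lemma isCont_ein': "isCont ein' c"
proof (cases "c = 0")
  case True
  have "((\<lambda>h. (exp (0 + h) - exp (0::complex)) / h) \<longlongrightarrow> exp 0) (at 0)"
    using DERIV_exp [of "0::complex"] by (simp only: DERIV_def)
  then have "(ein' \<longlongrightarrow> 1) (at 0)"
    by (subst (asm) exp_zero, elim Lim_transform_eventually) (auto simp: ein'_def eventually_at_filter)
  with True show ?thesis by (simp add: isCont_def ein'_def)
next
  case False
  have "isCont (\<lambda>c. (exp c - 1) / c) c"
    using False by (intro continuous_intros) auto
  moreover have "eventually (\<lambda>c. (exp c - 1) / c = ein' c) (nhds c)"
    using t1_space_nhds [OF False] by (rule eventually_mono) (simp add: ein'_def)
  ultimately show ?thesis by (simp only: isCont_cong [of "\<lambda>c. (exp c - 1) / c"])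
qed

lemma borel_measurable_ein [measurable]: "ein \<in> borel_measurable borel"
  by (intro borel_measurable_continuous_onI continuous_at_imp_continuous_on ballI isCont_ein)

lemma borel_measurable_ein' [measurable]: "ein' \<in> borel_measurable borel"
  by (intro borel_measurable_continuous_onI continuous_at_imp_continuous_on ballI isCont_ein')

section \<open>Compound Poisson exponents from the extremes\<close>

lemma prob_integral_fst:
  fixes f :: "'a \<times> 'b \<Rightarrow> 'c::{banach, second_countable_topology}"
  assumes "prob_space M" "prob_space N" and [measurable]: "f \<in> borel_measurable (M \<Otimes>\<^sub>M N)"
    and "\<And>x. norm (f x) \<le> B"
  shows "integral\<^sup>L (M \<Otimes>\<^sub>M N) f = (\<integral>x. \<integral>y. f (x, y) \<partial>N \<partial>M)"
proof -
  interpret M: prob_space M by fact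
  interpret N: prob_space N by fact
  interpret pair_prob_space M N ..
  have "integrable (M \<Otimes>\<^sub>M N) f"
    using assms by (intro integrable_const_bound [where B = B]) auto
  then show ?thesis by (rule integral_fst' [symmetric])
qed

text \<open>A function that is not integrable has integral 0 by convention, which obeys the bound as
  well.\<close>

lemma (in prob_space) norm_integral_le:
  fixes f :: "'a \<Rightarrow> 'b::{banach, second_countable_topology}"
  assumes "AE x in M. norm (f x) \<le> B" "0 \<le> B"
  shows "norm (integral\<^sup>L M f) \<le> B"
proof (cases "integrable M f")
  case True
  have "norm (integral\<^sup>L M f) \<le> (\<integral>x. norm (f x) \<partial>M)" by (rule integral_norm_bound)
  also have "\<dots> \<le> B" using True assms(1) by (intro integral_le_const integrable_norm)
  finally show ?thesis .
qed (use assms(2) in \<open>simp add: not_integrable_integral_eq\<close>)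

text \<open>The integrand is minus the derivative of \<open>ein (w (z * exp (- t)))\<close> in
  \<open>t\<close>: the factor in front of \<open>ein'\<close> is the logarithmic derivative
  \<open>y * w' y\<close> at \<open>y = z * exp (- t)\<close>.\<close>

lemma ein_integral:
  fixes a g z L :: real
  assumes "0 \<le> L"
  defines "w \<equiv> \<lambda>z::real. \<i> * g * z - a * z\<^sup>2 / 2"
  shows "(LBINT t:{0..L}. (\<i> * g * (z * exp (-t)) - a * (z * exp (-t))\<^sup>2) * ein' (w (z * exp (-t))))
    = ein (w z) - ein (w (z * exp (- L)))"
proof -
  let ?y = "\<lambda>t. z * exp (-t)"
  let ?f = "\<lambda>t. (\<i> * g * of_real (?y t) - a * (complex_of_real (?y t))\<^sup>2) * ein' (w (?y t))"
  have "(LBINT t=ereal 0..ereal L. ?f t) = (- ein (w (?y L))) - (- ein (w (?y 0)))"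
  proof (rule interval_integral_FTC_finite)
    show "continuous_on {min 0 L..max 0 L} ?f"
    proof -
      have 1: "continuous_on UNIV ein'"
        by (intro continuous_at_imp_continuous_on ballI isCont_ein')
      have 2: "continuous_on {min 0 L..max 0 L} (\<lambda>t. w (?y t))"
        unfolding w_def by (intro continuous_intros) auto
      show ?thesis
        by (intro continuous_on_mult continuous_on_compose2 [OF 1 2]) (auto intro!: continuous_intros)
    qed
    fix t assume "min 0 L \<le> t" "t \<le> max 0 L"
    have "((\<lambda>t. w (?y t)) has_vector_derivative - (\<i> * g * of_real (?y t) - a * (complex_of_real (?y t))\<^sup>2)) (at t within {min 0 L..max 0 L})"
    proof -
      have 1: "((\<lambda>t. complex_of_real (?y t)) has_vector_derivative of_real (- ?y t)) (at t within {min 0 L..max 0 L})"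
        by (rule has_vector_derivative_of_real)
           (auto intro!: derivative_eq_intros simp: has_real_derivative_iff_has_vector_derivative [symmetric])
      have "((\<lambda>c. \<i> * g * c - a * c\<^sup>2 / 2) has_field_derivative \<i> * g - a * c) (at c within S)" for c :: complex and S
        by (auto intro!: derivative_eq_intros)
      from field_vector_diff_chain_within [OF 1 this [of "of_real (?y t)"]]
      show ?thesis
        unfolding w_def by (simp add: o_def algebra_simps power2_eq_square)
    qed
    from has_vector_derivative_minus [OF field_vector_diff_chain_within
        [OF this has_field_derivative_at_within [OF has_field_derivative_ein]], unfolded o_def]
    show "((\<lambda>t. - ein (w (?y t))) has_vector_derivative ?f t) (at t within {min 0 L..max 0 L})"
      by (rule has_vector_derivative_eq_rhs) (simp add: algebra_simps)
  qed
  then show ?thesis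
    using assms(1) by (simp add: interval_integral_Icc w_def)
qed

text \<open>By \<open>max_min_transform\<close> and \<open>ein_integral\<close>, the mean of the
  difference is \<open>L\<close> times the excess over 2 of a sum of two characteristic functions.
  They belong to the maximum and the minimum of a path with parameters \<open>\<gamma> u\<close>,
  \<open>\<alpha> u\<close>, both multiplied by \<open>exp (- t)\<close>, where \<open>u\<close> has
  law \<open>M\<close> and \<open>t\<close> is uniform on \<open>{0..L}\<close>. So the exponent is
  a sum of two compound Poisson exponents of rate \<open>l * L\<close>. For fixed \<open>u\<close>
  that excess has modulus at most 4, whence the bound \<open>4 * L\<close>.\<close>

lemma is_char_exp_ein:
  fixes \<alpha> \<gamma> :: "'a \<Rightarrow> real"
  assumes M: "prob_space M" and [measurable]: "\<alpha> \<in> borel_measurable M" "\<gamma> \<in> borel_measurable M"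
    and \<alpha>: "\<And>u. 0 \<le> \<alpha> u" and "0 < L" "0 \<le> l"
  defines "w \<equiv> \<lambda>u z::real. \<i> * \<gamma> u * z - \<alpha> u * z\<^sup>2 / 2"
  shows "is_char (\<lambda>z. exp (of_real l * (\<integral>u. ein (w u z) - ein (w u (z * exp (- L))) \<partial>M)))"
    and "\<And>u z. norm (ein (w u z) - ein (w u (z * exp (- L)))) \<le> 4 * L"
proof -
  define S where "S = std_normal_distribution"
  define X where "X = density lborel (exponential_density (1::real))"
  define U where "U = uniform_measure lborel {0..L}"
  interpret M: prob_space M by fact
  interpret S: prob_space S
    unfolding S_def by (rule prob_space_normal_density) simp
  interpret X: prob_space X
    unfolding X_def by (rule prob_space_exponential_density) simp
  interpret U: prob_space U
    unfolding U_def using \<open>0 < L\<close> by (intro prob_space_uniform_measure) auto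
  have [measurable_cong]: "sets S = sets borel" "sets X = sets borel" "sets U = sets borel"
    by (simp_all add: S_def X_def U_def)
  have SX: "prob_space (S \<Otimes>\<^sub>M X)"
    by (rule prob_space_pair) unfold_locales
  then interpret SX: prob_space "S \<Otimes>\<^sub>M X" .
  have USX: "prob_space (U \<Otimes>\<^sub>M (S \<Otimes>\<^sub>M X))"
    by (rule prob_space_pair [OF _ SX]) unfold_locales
  define P where "P = M \<Otimes>\<^sub>M (U \<Otimes>\<^sub>M (S \<Otimes>\<^sub>M X))"
  interpret P: prob_space P
    unfolding P_def by (rule prob_space_pair [OF M USX])
  define Y where "Y u x = sqrt (\<alpha> u) * x + \<gamma> u" for u x
  define R where "R u x e = sqrt ((Y u x)\<^sup>2 + 2 * \<alpha> u * e)" for u x e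
  \<comment> \<open>The maximum for \<open>s = 1\<close>, the minimum for
    \<open>s = -1\<close>.\<close>
  define V where "V s = (\<lambda>(u, t, x, e). exp (- t) * ((Y u x + s * R u x e) / 2))" for s :: real
  define J where "J u y = 2 + (\<i> * \<gamma> u * y - \<alpha> u * y\<^sup>2) * ein' (w u y)" for u and y :: real
  have [measurable]: "V s \<in> borel_measurable P" for s
    unfolding V_def R_def Y_def P_def by measurable
  have VP: "real_distribution (distr P borel (V s))" for s
    by (rule P.real_distribution_distr) simp
  define \<psi> where "\<psi> s z = char (distr P borel (V s)) z" for s z
  have char_\<psi>: "is_char (\<psi> s)" for s
    unfolding is_char_def \<psi>_def using VP by blast
  have iexp_pm: "iexp (z * V 1 (u, t, x, e)) + iexp (z * V (-1) (u, t, x, e))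
      = iexp (z * exp (-t) * Y u x / 2) * of_real (2 * cos (z * exp (-t) / 2 * R u x e))" for z u t x e
    by (simp add: V_def cos_exp_eq cos_of_real [symmetric] exp_add [symmetric] algebra_simps add_divide_distrib diff_divide_distrib)
  have V_meas [measurable]: "(\<lambda>q. V s (u, t, q)) \<in> borel_measurable (S \<Otimes>\<^sub>M X)" for s u t
    unfolding V_def R_def Y_def by (simp add: split_beta)
  have inner: "(\<integral>q. iexp (z * V 1 (u, t, q)) + iexp (z * V (-1) (u, t, q)) \<partial>(S \<Otimes>\<^sub>M X))
      = J u (z * exp (-t))" for z u t
  proof -
    have "(\<integral>q. iexp (z * V 1 (u, t, q)) + iexp (z * V (-1) (u, t, q)) \<partial>(S \<Otimes>\<^sub>M X))
      = (\<integral>x. \<integral>e. iexp (z * exp (-t) * Y u x / 2) * of_real (2 * cos (z * exp (-t) / 2 * R u x e)) \<partial>X \<partial>S)"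
      unfolding iexp_pm [symmetric]
    proof (rule prob_integral_fst [OF S.prob_space_axioms X.prob_space_axioms, where B = 2])
      show "norm (iexp (z * V 1 (u, t, q)) + iexp (z * V (-1) (u, t, q))) \<le> 2" for q
        by (rule order_trans [OF norm_triangle_ineq]) simp
    qed measurable
    also have "\<dots> = (\<integral>x. iexp (z * exp (-t) * Y u x / 2) * of_real (\<integral>e. 2 * cos (z * exp (-t) / 2 * R u x e) \<partial>X) \<partial>S)"
      unfolding integral_mult_right_zero integral_complex_of_real ..
    also have "\<dots> = J u (z * exp (-t))"
      using max_min_transform [OF \<alpha>, of "z * exp (-t)" u "\<gamma> u"]
      unfolding R_def Y_def S_def X_def J_def w_def by simp
    finally show ?thesis .
  qed
  have norm_J: "norm (J u (z * exp (-t))) \<le> 2" for z u t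
    unfolding inner [symmetric]
    by (intro SX.norm_integral_le AE_I2) (auto intro!: order_trans [OF norm_triangle_ineq])
  have J_meas [measurable]: "(\<lambda>t. J u (z * exp (-t))) \<in> borel_measurable borel" for u z
    unfolding J_def w_def by measurable
  have mean_J: "(\<integral>t. J u (z * exp (-t)) \<partial>U) = 2 + (ein (w u z) - ein (w u (z * exp (- L)))) / L" for u z
  proof -
    let ?f = "\<lambda>t. (\<i> * \<gamma> u * (z * exp (-t)) - \<alpha> u * (z * exp (-t))\<^sup>2) * ein' (w u (z * exp (-t)))"
    have J_eq: "J u (z * exp (-t)) = 2 + ?f t" for t
      by (simp add: J_def)
    have int_J: "integrable U (\<lambda>t. J u (z * exp (-t)))"
      using norm_J by (intro U.integrable_const_bound [where B = 2]) auto
    then have "integrable U ?f"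
      using Bochner_Integration.integrable_diff [OF int_J U.integrable_const [of 2]] by (simp add: J_eq)
    then have "(\<integral>t. J u (z * exp (-t)) \<partial>U) = 2 + (\<integral>t. ?f t \<partial>U)"
      unfolding J_eq by (subst Bochner_Integration.integral_add) (auto simp: U.prob_space)
    also have "(\<integral>t. ?f t \<partial>U) = (LBINT t:{0..L}. ?f t) / L"
    proof -
      have "U = density lborel (\<lambda>t. ennreal (indicator {0..L} t / L))"
        unfolding U_def uniform_measure_def using \<open>0 < L\<close>
        by (intro arg_cong2 [where f = density]) (auto simp: fun_eq_iff divide_ennreal ennreal_indicator [symmetric])
      then have "(\<integral>t. ?f t \<partial>U) = (\<integral>t. (indicator {0..L} t / L) *\<^sub>R ?f t \<partial>lborel)"
        using \<open>0 < L\<close> by (simp only:) (subst integral_density, auto simp: w_def)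
      also have "\<dots> = (\<integral>t. indicator {0..L} t *\<^sub>R ?f t / L \<partial>lborel)"
        by (intro Bochner_Integration.integral_cong) (auto simp: scaleR_conv_of_real)
      finally show ?thesis by (simp add: set_lebesgue_integral_def)
    qed
    also have "(LBINT t:{0..L}. ?f t) = ein (w u z) - ein (w u (z * exp (- L)))"
      using ein_integral [of L "\<gamma> u" z "\<alpha> u"] \<open>0 < L\<close> unfolding w_def by simp
    finally show ?thesis .
  qed
  show bound: "norm (ein (w u z) - ein (w u (z * exp (- L)))) \<le> 4 * L" for u z
  proof -
    have "norm (2 + (ein (w u z) - ein (w u (z * exp (- L)))) / L) \<le> 2"
      unfolding mean_J [symmetric] using norm_J by (intro U.norm_integral_le AE_I2) auto
    then have "norm ((ein (w u z) - ein (w u (z * exp (- L)))) / L) \<le> 4"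
      using norm_triangle_ineq4 [of "2 + (ein (w u z) - ein (w u (z * exp (- L)))) / L" 2] by simp
    with \<open>0 < L\<close> show ?thesis by (simp add: norm_divide field_simps)
  qed
  have \<psi>_sum: "of_real L * ((\<psi> 1 z - 1) + (\<psi> (-1) z - 1)) = (\<integral>u. ein (w u z) - ein (w u (z * exp (- L))) \<partial>M)" for z
  proof -
    have [measurable]: "V s \<in> borel_measurable (M \<Otimes>\<^sub>M (U \<Otimes>\<^sub>M (S \<Otimes>\<^sub>M X)))" for s
      unfolding P_def [symmetric] by measurable
    have "integrable P (\<lambda>p. iexp (z * V s p))" for s
      by (intro P.integrable_const_bound [where B = 1]) auto
    then have "\<psi> 1 z + \<psi> (-1) z = (\<integral>p. iexp (z * V 1 p) + iexp (z * V (-1) p) \<partial>P)"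
      unfolding \<psi>_def by (simp add: char_distr)
    also have "\<dots> = (\<integral>u. \<integral>q. iexp (z * V 1 (u, q)) + iexp (z * V (-1) (u, q)) \<partial>(U \<Otimes>\<^sub>M (S \<Otimes>\<^sub>M X)) \<partial>M)"
      unfolding P_def
      by (rule prob_integral_fst [OF M USX, where B = 2]) (auto intro!: order_trans [OF norm_triangle_ineq])
    also have "\<dots> = (\<integral>u. \<integral>t. \<integral>q. iexp (z * V 1 (u, t, q)) + iexp (z * V (-1) (u, t, q)) \<partial>(S \<Otimes>\<^sub>M X) \<partial>U \<partial>M)"
      by (intro Bochner_Integration.integral_cong refl prob_integral_fst [OF U.prob_space_axioms SX, where B = 2])
         (auto intro!: order_trans [OF norm_triangle_ineq])
    also have "\<dots> = (\<integral>u. \<integral>t. J u (z * exp (-t)) \<partial>U \<partial>M)"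
      by (simp only: inner)
    also have "\<dots> = (\<integral>u. 2 + (ein (w u z) - ein (w u (z * exp (- L)))) / L \<partial>M)"
      by (simp only: mean_J)
    also have "\<dots> = 2 + (\<integral>u. ein (w u z) - ein (w u (z * exp (- L))) \<partial>M) / L"
    proof -
      have "integrable M (\<lambda>u. ein (w u z) - ein (w u (z * exp (- L))))"
        using bound by (intro M.integrable_const_bound [where B = "4 * L"]) (auto simp: w_def)
      then show ?thesis
        by (subst Bochner_Integration.integral_add) (auto simp: M.prob_space)
    qed
    finally show ?thesis
      using \<open>0 < L\<close> by (simp add: field_simps)
  qed
  have "is_char (\<lambda>z. exp (of_real (l * L) * (\<psi> 1 z - 1)) * exp (of_real (l * L) * (\<psi> (-1) z - 1)))"
    using \<open>0 \<le> l\<close> \<open>0 < L\<close> by (intro is_char_mult is_char_exp char_\<psi>) auto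
  also have "(\<lambda>z. exp (of_real (l * L) * (\<psi> 1 z - 1)) * exp (of_real (l * L) * (\<psi> (-1) z - 1)))
    = (\<lambda>z. exp (of_real l * (\<integral>u. ein (w u z) - ein (w u (z * exp (- L))) \<partial>M)))"
  proof
    fix z
    have "of_real (l * L) * (\<psi> 1 z - 1) + of_real (l * L) * (\<psi> (-1) z - 1)
        = of_real l * (of_real L * ((\<psi> 1 z - 1) + (\<psi> (-1) z - 1)))"
      by (simp add: algebra_simps)
    then show "exp (of_real (l * L) * (\<psi> 1 z - 1)) * exp (of_real (l * L) * (\<psi> (-1) z - 1))
        = exp (of_real l * (\<integral>u. ein (w u z) - ein (w u (z * exp (- L))) \<partial>M))"
      by (simp only: exp_add [symmetric] \<psi>_sum)
  qed
  finally show "is_char (\<lambda>z. exp (of_real l * (\<integral>u. ein (w u z) - ein (w u (z * exp (- L))) \<partial>M)))" .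
qed

section \<open>Estimates for exponents\<close>

lemma norm_exp_diff_le:
  fixes u v :: complex
  assumes "Re u \<le> 0" "Re v \<le> 0"
  shows "norm (exp u - exp v) \<le> norm (u - v)"
proof -
  have "norm (exp u - exp v) \<le> 1 * norm (u - v)"
  proof (rule field_differentiable_bound [where S = "{z. Re z \<le> 0}" and f' = exp])
    show "convex {z. Re z \<le> 0}" by (rule convex_halfspace_Re_le)
  qed (use assms in \<open>auto intro!: derivative_eq_intros\<close>)
  then show ?thesis by simp
qed

lemma norm_exp_diff_le_2:
  fixes u v :: complex
  assumes "Re u \<le> 0" "Re v \<le> 0"
  shows "norm (exp u - exp v) \<le> 2"
proof -
  have "norm (exp u) \<le> 1" "norm (exp v) \<le> 1" using assms by simp_all
  then show ?thesis using norm_triangle_ineq4 [of "exp u" "exp v"] by linarith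
qed

lemma norm_exp_minus_1_le:
  fixes v :: complex
  assumes "Re v \<le> 0"
  shows "norm (exp v - 1) \<le> norm v" "norm (exp v - 1) \<le> 2"
  using norm_exp_diff_le [of v 0] norm_exp_diff_le_2 [of v 0] assms by auto

lemma norm_exp_minus_1_minus_le:
  fixes v :: complex
  assumes "Re v \<le> 0"
  shows "norm (exp v - 1 - v) \<le> (norm v)\<^sup>2"
proof -
  have "norm ((exp v - v) - (exp 0 - 0)) \<le> norm v * norm (v - 0)"
  proof (rule field_differentiable_bound [where S = "closed_segment 0 v" and f' = "\<lambda>z. exp z - 1"])
    fix z assume "z \<in> closed_segment 0 v"
    then obtain t where t: "0 \<le> t" "t \<le> 1" "z = t *\<^sub>R v" by (auto simp: in_segment)
    with assms have "Re z \<le> 0" by (simp add: mult_nonneg_nonpos)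
    then have "norm (exp z - 1) \<le> norm z" by (rule norm_exp_minus_1_le)
    also have "\<dots> \<le> norm v" using t by (simp add: mult_left_le_one_le)
    finally show "norm (exp z - 1) \<le> norm v" .
  qed (auto intro!: derivative_eq_intros)
  then show ?thesis by (simp add: power2_eq_square algebra_simps)
qed

lemma ein_0: "ein 0 = 0"
proof -
  have "(\<lambda>n. 1 / (of_nat n * fact n) * (0::complex) ^ n) sums (\<Sum>n\<in>{}. 1 / (of_nat n * fact n) * 0 ^ n)"
    by (rule sums_finite) (auto simp: power_0_left)
  then show ?thesis by (simp add: ein_def sums_iff)
qed

lemma norm_ein'_le: "Re c \<le> 0 \<Longrightarrow> norm (ein' c) \<le> 1"
  using norm_exp_minus_1_le(1) [of c] by (simp add: ein'_def norm_divide)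

lemma norm_ein_le:
  assumes "Re c \<le> 0"
  shows "norm (ein c) \<le> norm c"
proof -
  have "norm (ein c - ein 0) \<le> 1 * norm (c - 0)"
  proof (rule field_differentiable_bound [where S = "{z. Re z \<le> 0}" and f' = ein'])
    show "convex {z. Re z \<le> 0}" by (rule convex_halfspace_Re_le)
  qed (use assms in \<open>auto intro!: has_field_derivative_at_within has_field_derivative_ein norm_ein'_le\<close>)
  then show ?thesis by (simp add: ein_0)
qed

lemma mult_ein': "c * ein' c = exp c - 1"
  by (simp add: ein'_def)

text \<open>The curve \<open>ein (exp (- s) *\<^sub>R v)\<close> has derivative
  \<open>- (exp (exp (- s) *\<^sub>R v) - 1)\<close>, and this is one step of a left Riemann sum for
  it. The alternative 2 keeps the error bounded for large \<open>v\<close>, so that it can be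
  integrated without a first moment.\<close>

lemma ein_step:
  fixes v :: complex
  assumes "Re v \<le> 0" "0 \<le> h"
  shows "norm (ein v - ein (exp (- h) *\<^sub>R v) - h *\<^sub>R (exp v - 1)) \<le> h * min 2 (h * norm v)"
proof -
  let ?f' = "\<lambda>s. - (exp (exp (- s) *\<^sub>R v) - 1)"
  have "norm (ein (exp (- h) *\<^sub>R v) - ein (exp (- 0) *\<^sub>R v) - (h - 0) *\<^sub>R ?f' 0) \<le> norm (h - 0) * min 2 (h * norm v)"
  proof (rule vector_differentiable_bound_linearization [where S = "{0..h}" and f' = ?f'])
    fix s assume "s \<in> {0..h}"
    have "((\<lambda>s. exp (- s) *\<^sub>R v) has_vector_derivative - (exp (- s) *\<^sub>R v)) (at s within {0..h})"
      by (auto intro!: derivative_eq_intros)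
    from field_vector_diff_chain_within [OF this has_field_derivative_at_within [OF has_field_derivative_ein], unfolded o_def]
    show "((\<lambda>s. ein (exp (- s) *\<^sub>R v)) has_vector_derivative ?f' s) (at s within {0..h})"
      by (rule has_vector_derivative_eq_rhs) (simp only: mult_minus_left mult_ein')
    have Re: "Re (exp (- s) *\<^sub>R v) \<le> 0"
      using assms by (simp add: mult_nonneg_nonpos)
    have "norm (?f' s - ?f' 0) = norm (exp (exp (- s) *\<^sub>R v) - exp v)"
      by (simp add: norm_minus_commute)
    moreover have "norm (exp (exp (- s) *\<^sub>R v) - exp v) \<le> norm (exp (- s) *\<^sub>R v - v)"
      using Re assms by (intro norm_exp_diff_le)
    moreover have "exp (- s) *\<^sub>R v - v = (exp (- s) - 1) *\<^sub>R v"
      by (simp add: scaleR_diff_left)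
    moreover have "\<bar>exp (- s) - 1\<bar> \<le> h"
      using exp_ge_add_one_self [of "- s"] \<open>s \<in> {0..h}\<close> by auto
    moreover have "norm (exp (exp (- s) *\<^sub>R v) - exp v) \<le> 2"
      using Re assms by (intro norm_exp_diff_le_2)
    ultimately show "norm (?f' s - ?f' 0) \<le> min 2 (h * norm v)"
      by (simp add: order_trans [OF _ mult_right_mono])
  qed (use assms in \<open>auto simp: closed_segment_eq_real_ivl\<close>)
  also have "ein (exp (- h) *\<^sub>R v) - ein (exp (- 0) *\<^sub>R v) - (h - 0) *\<^sub>R ?f' 0
      = - (ein v - ein (exp (- h) *\<^sub>R v) - h *\<^sub>R (exp v - 1))"
    by (simp add: algebra_simps)
  finally show ?thesis using assms by (simp only: norm_minus_cancel) simp
qed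

text \<open>The sum is a Riemann sum of mesh \<open>h\<close> for the integral of
  \<open>exp (exp (- t) *\<^sub>R v) - 1\<close> over \<open>0 \<le> t \<le> m * h\<close>. Under
  \<open>R h\<close> its terms become the deviations from 1 of the factors in a product of
  \<open>m\<close> cofactors.\<close>

lemma ein_telescope:
  fixes v :: complex and h :: real and m :: nat
  assumes "Re v \<le> 0" "0 \<le> h"
  shows "norm (ein v - ein (exp (- (m * h)) *\<^sub>R v) - (\<Sum>k<m. h *\<^sub>R (exp (exp (- (k * h)) *\<^sub>R v) - 1)))
    \<le> m * (h * min 2 (h * norm v))"
proof (induction m)
  case (Suc m)
  let ?v = "exp (- (m * h)) *\<^sub>R v"
  have "norm ?v \<le> norm v" using assms by (simp add: mult_left_le_one_le)
  then have 1: "h * min 2 (h * norm ?v) \<le> h * min 2 (h * norm v)"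
    using assms by (intro mult_left_mono min.mono order_refl) auto
  have 2: "norm (ein ?v - ein (exp (- h) *\<^sub>R ?v) - h *\<^sub>R (exp ?v - 1)) \<le> h * min 2 (h * norm ?v)"
    using assms by (intro ein_step) (auto simp: mult_nonneg_nonpos)
  have 3: "exp (- h) *\<^sub>R ?v = exp (- (Suc m * h)) *\<^sub>R v"
    by (simp add: exp_add [symmetric] algebra_simps)
  have "norm (ein ?v - ein (exp (- (Suc m * h)) *\<^sub>R v) - h *\<^sub>R (exp ?v - 1)) \<le> h * min 2 (h * norm v)"
    using order_trans [OF 2 1] unfolding 3 .
  from norm_triangle_mono [OF Suc.IH this]
  show ?case by (simp add: algebra_simps)
qed simp

section \<open>Laplace-Fourier transforms on a cone\<close>

definition lf_exponent :: "'a::euclidean_space \<Rightarrow> 'a \<Rightarrow> 'a \<Rightarrow> complex" where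
  "lf_exponent p q x = - of_real (p \<bullet> x) + \<i> * of_real (q \<bullet> x)"

text \<open>Laplace transform in \<open>p\<close> and Fourier transform in \<open>q\<close>. At
  \<open>p = (z\<^sup>2 / 2) *\<^sub>R a\<close> and \<open>q = z *\<^sub>R g\<close> it is the
  characteristic function of the Gaussian mixture with variance \<open>a \<bullet> x\<close> and
  mean \<open>g \<bullet> x\<close>.\<close>

definition laplace_fourier :: "'a::euclidean_space measure \<Rightarrow> 'a \<Rightarrow> 'a \<Rightarrow> complex" where
  "laplace_fourier M p q = (CLINT x|M. exp (lf_exponent p q x))"

lemma Re_lf_exponent [simp]: "Re (lf_exponent p q x) = - (p \<bullet> x)"
  by (simp add: lf_exponent_def)

lemma lf_exponent_scaleR: "lf_exponent (r *\<^sub>R p) (r *\<^sub>R q) x = r *\<^sub>R lf_exponent p q x"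
  by (simp add: lf_exponent_def scaleR_conv_of_real algebra_simps)

lemma borel_measurable_lf_exponent [measurable]: "lf_exponent p q \<in> borel_measurable borel"
  unfolding lf_exponent_def by measurable

text \<open>Through this inequality the value of a Laplace transform at one point bounds a truncated
  first moment.\<close>

lemma one_minus_exp_ge:
  fixes x :: real
  assumes "0 \<le> x"
  shows "min 1 x \<le> 2 * (1 - exp (- x))"
proof -
  have *: "exp (- y) \<le> 1 - y / 2" if "0 \<le> y" "y \<le> 1" for y :: real
  proof -
    have "exp y \<ge> 1 + y" by (rule exp_ge_add_one_self)
    then have "exp (- y) \<le> 1 / (1 + y)"
      using that by (simp add: exp_minus inverse_eq_divide frac_le del: exp_minus_inverse)
    also have "\<dots> \<le> 1 - y / 2"
      using that by (simp add: field_simps power2_eq_square [symmetric]) (simp add: power2_eq_square mult_left_le)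
    finally show ?thesis .
  qed
  show ?thesis
  proof (cases "x \<le> 1")
    case True
    with * [of x] assms show ?thesis by simp
  next
    case False
    then have "exp (- x) \<le> exp (- 1)" by simp
    also have "\<dots> \<le> 1 / 2" using * [of 1] by simp
    finally show ?thesis using False by simp
  qed
qed

text \<open>The simpler bound \<open>h * a\<close> would call for a first moment of the law of
  \<open>a\<close>. The weight \<open>a * exp (- (a / 3))\<close> is bounded, and still of order
  \<open>a\<close> near 0.\<close>

lemma exp_scaled_diff_le:
  fixes a h :: real
  assumes "0 \<le> a" "0 \<le> h" "h \<le> 1"
  shows "exp (- (exp (- h) * a)) - exp (- a) \<le> h * (a * exp (- (a / 3)))"
proof -
  have "exp (- (exp (- h) * a)) - exp (- a) = exp (- (exp (- h) * a)) * (1 - exp (- (a * (1 - exp (- h)))))"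
  proof -
    have "exp (- (exp (- h) * a)) * exp (- (a * (1 - exp (- h)))) = exp (- a)"
      by (simp add: exp_add [symmetric] algebra_simps)
    then show ?thesis by (simp only: right_diff_distrib mult_1_right)
  qed
  also have "\<dots> \<le> exp (- (a / 3)) * (a * h)"
  proof (rule mult_mono)
    have "exp (-1) \<le> exp (- h)" using assms by simp
    \<comment> \<open>The constant 3 is the bound for \<open>exp 1\<close>, since
      \<open>exp (- h)\<close> is at least \<open>exp (- 1)\<close>.\<close>
    moreover have "1 / 3 \<le> exp (- 1 :: real)"
      using exp_le by (simp add: exp_minus inverse_eq_divide frac_le)
    ultimately have "1 / 3 \<le> exp (- h)" by linarith
    from mult_right_mono [OF this assms(1)] show "exp (- (exp (- h) * a)) \<le> exp (- (a / 3))" by simp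
    have "1 - exp (- (a * (1 - exp (- h)))) \<le> a * (1 - exp (- h))"
      using exp_ge_add_one_self [of "- (a * (1 - exp (- h)))"] by simp
    also have "\<dots> \<le> a * h"
      using exp_ge_add_one_self [of "- h"] assms by (intro mult_left_mono) auto
    finally show "1 - exp (- (a * (1 - exp (- h)))) \<le> a * h" .
    show "0 \<le> 1 - exp (- (a * (1 - exp (- h))))" using assms by simp
  qed simp
  finally show ?thesis by (simp add: mult_ac)
qed

lemma mult_exp_le_3:
  fixes a :: real
  shows "a * exp (- (a / 3)) \<le> 3"
proof -
  have "a / 3 \<le> exp (a / 3)" using exp_ge_add_one_self [of "a / 3"] by linarith
  then show ?thesis by (simp add: exp_minus field_simps)
qed

text \<open>
  \<open>R h\<close> is the cofactor of \<open>M\<close> for the contraction factor \<open>exp (- h)\<close>; the functional \<open>\<theta>\<close> plays the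
  role of a norm on the cone carrying \<open>M\<close>.
\<close>

locale selfdecomposable_on_cone =
  fixes M :: "'a::euclidean_space measure" and R :: "real \<Rightarrow> 'a measure" and \<theta> :: 'a
  assumes prob_M: "prob_space M" and sets_M [measurable_cong]: "sets M = sets borel"
    and prob_R: "\<And>h. 0 < h \<Longrightarrow> prob_space (R h)" and sets_R: "\<And>h. 0 < h \<Longrightarrow> sets (R h) = sets borel"
    and nonneg_R: "\<And>h p. 0 < h \<Longrightarrow> (AE x in M. 0 \<le> p \<bullet> x) \<Longrightarrow> (AE x in R h. 0 \<le> p \<bullet> x)"
    and factor: "\<And>h p q. 0 < h \<Longrightarrow> (AE x in M. 0 \<le> p \<bullet> x) \<Longrightarrow>
      laplace_fourier M p q = laplace_fourier M (exp (- h) *\<^sub>R p) (exp (- h) *\<^sub>R q) * laplace_fourier (R h) p q"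
    and \<theta>_nonneg: "AE x in M. 0 \<le> \<theta> \<bullet> x"
begin

sublocale prob_space M by (rule prob_M)

text \<open>For \<open>h\<close> and \<open>d\<close> up to 1, \<open>h * small_jumps d\<close>
  bounds the mean of \<open>min 1 (d * (\<theta> \<bullet> x))\<close> under \<open>R h\<close>. The
  numerator stems from the increment of the Laplace transform of \<open>\<theta> \<bullet> x\<close>
  between \<open>exp (- h) * d\<close> and \<open>d\<close>, the denominator is the value of that
  transform at 1, and the 2 comes from \<open>one_minus_exp_ge\<close>.\<close>

definition small_jumps :: "real \<Rightarrow> real" where
  "small_jumps d = 2 * (\<integral>x. d * (\<theta> \<bullet> x) * exp (- (d * (\<theta> \<bullet> x) / 3)) \<partial>M) / (\<integral>x. exp (- (\<theta> \<bullet> x)) \<partial>M)"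

lemma integrable_exp_M: "0 \<le> d \<Longrightarrow> integrable M (\<lambda>x. exp (- (d * (\<theta> \<bullet> x))))"
  using \<theta>_nonneg by (intro integrable_const_bound [where B = 1]) (auto elim!: eventually_mono)

lemma laplace_pos: "0 < (\<integral>x. exp (- (\<theta> \<bullet> x)) \<partial>M)"
proof -
  have int: "integrable M (\<lambda>x. exp (- (\<theta> \<bullet> x)))" using integrable_exp_M [of 1] by simp
  then have "0 \<le> (\<integral>x. exp (- (\<theta> \<bullet> x)) \<partial>M)" by (intro integral_nonneg_AE) auto
  moreover have "(\<integral>x. exp (- (\<theta> \<bullet> x)) \<partial>M) \<noteq> 0"
    using int by (subst integral_nonneg_eq_0_iff_AE) (auto simp: AE_False)
  ultimately show ?thesis by linarith
qed

lemma integrable_jump: "0 \<le> d \<Longrightarrow> integrable M (\<lambda>x. d * (\<theta> \<bullet> x) * exp (- (d * (\<theta> \<bullet> x) / 3)))"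
  using \<theta>_nonneg
  by (intro integrable_const_bound [where B = 3]) (auto elim!: eventually_mono intro!: mult_exp_le_3)

lemma small_jumps_tendsto:
  assumes "d \<longlonglongrightarrow> 0" "\<And>n. 0 \<le> d n"
  shows "(\<lambda>n. small_jumps (d n)) \<longlonglongrightarrow> 0"
proof -
  have "(\<lambda>n. \<integral>x. d n * (\<theta> \<bullet> x) * exp (- (d n * (\<theta> \<bullet> x) / 3)) \<partial>M) \<longlonglongrightarrow> (\<integral>x. 0 \<partial>M)"
  proof (rule integral_dominated_convergence [where w = "\<lambda>_. 3"])
    show "AE x in M. (\<lambda>n. d n * (\<theta> \<bullet> x) * exp (- (d n * (\<theta> \<bullet> x) / 3))) \<longlonglongrightarrow> 0"
      using assms(1) by (intro AE_I2) (auto intro!: tendsto_eq_intros)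
    show "AE x in M. norm (d n * (\<theta> \<bullet> x) * exp (- (d n * (\<theta> \<bullet> x) / 3))) \<le> 3" for n
      using \<theta>_nonneg assms(2) by (auto elim!: eventually_mono intro!: mult_exp_le_3)
  qed auto
  then have "(\<lambda>n. small_jumps (d n)) \<longlonglongrightarrow> 2 * 0 / (\<integral>x. exp (- (\<theta> \<bullet> x)) \<partial>M)"
    unfolding small_jumps_def using laplace_pos by (intro tendsto_intros) auto
  then show ?thesis by simp
qed

lemma integrable_min_jump:
  assumes "0 < h" "0 \<le> d" shows "integrable (R h) (\<lambda>x. min 1 (d * (\<theta> \<bullet> x)))"
proof -
  interpret R: prob_space "R h" using assms by (intro prob_R)
  note [measurable_cong] = sets_R [OF assms(1)]
  show ?thesis
    using nonneg_R [OF assms(1) \<theta>_nonneg] assms(2)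
    by (intro R.integrable_const_bound [where B = 1]) (auto elim!: eventually_mono)
qed

text \<open>At Laplace arguments on the ray of \<open>\<theta>\<close> the factorisation gives
  \<open>eq\<close>: the defect \<open>1 - lap (R h) d\<close> times a quantity at least
  \<open>lap M 1\<close> equals an increment of order \<open>h\<close>. Thus \<open>R h\<close> has
  a truncated first moment of order \<open>h\<close>, with a constant that vanishes with
  \<open>d\<close>.\<close>

lemma min_jump_le:
  assumes "0 < h" "h \<le> 1" "0 \<le> d" "d \<le> 1"
  shows "(\<integral>x. min 1 (d * (\<theta> \<bullet> x)) \<partial>R h) \<le> h * small_jumps d"
proof -
  interpret R: prob_space "R h" using assms by (intro prob_R)
  note [measurable_cong] = sets_R [OF assms(1)]
  note \<theta>_R = nonneg_R [OF assms(1) \<theta>_nonneg]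
  define lap where "lap N d = (\<integral>x. exp (- (d * (\<theta> \<bullet> x))) \<partial>N)" for N d
  have lap: "laplace_fourier N (d *\<^sub>R \<theta>) 0 = of_real (lap N d)" for N d
    unfolding laplace_fourier_def lf_exponent_def lap_def
    by (simp add: integral_complex_of_real [symmetric] exp_of_real [symmetric] del: integral_complex_of_real)
  have int_R: "integrable (R h) (\<lambda>x. exp (- (d * (\<theta> \<bullet> x))))"
    using \<theta>_R assms(3) by (intro R.integrable_const_bound [where B = 1]) (auto elim!: eventually_mono)
  have "AE x in M. 0 \<le> (d *\<^sub>R \<theta>) \<bullet> x" using \<theta>_nonneg assms(3) by auto
  from factor [OF assms(1) this, of 0] have "lap M d = lap M (exp (- h) * d) * lap (R h) d"
    by (simp add: lap scaleR_scaleR of_real_mult [symmetric] del: of_real_mult)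
  then have eq: "lap M (exp (- h) * d) * (1 - lap (R h) d) = lap M (exp (- h) * d) - lap M d"
    by (simp add: algebra_simps)
  have d': "0 \<le> exp (- h) * d" "exp (- h) * d \<le> 1"
    using assms mult_mono [of "exp (- h)" 1 d 1] by auto
  have lap_ge: "lap M 1 \<le> lap M (exp (- h) * d)"
    unfolding lap_def
  proof (rule integral_mono_AE)
    show "AE x in M. exp (- (1 * (\<theta> \<bullet> x))) \<le> exp (- (exp (- h) * d * (\<theta> \<bullet> x)))"
      using \<theta>_nonneg d' by (auto elim!: eventually_mono intro: mult_left_le_one_le)
  qed (use d' in \<open>auto intro!: integrable_exp_M [of 1, simplified] integrable_exp_M\<close>)
  have lap_R: "lap (R h) d \<le> 1"
    unfolding lap_def using \<theta>_R assms(3) by (intro R.integral_le_const int_R) (auto elim!: eventually_mono)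
  have diff: "lap M (exp (- h) * d) - lap M d \<le> h * (\<integral>x. d * (\<theta> \<bullet> x) * exp (- (d * (\<theta> \<bullet> x) / 3)) \<partial>M)"
  proof -
    have "lap M (exp (- h) * d) - lap M d = (\<integral>x. exp (- (exp (- h) * d * (\<theta> \<bullet> x))) - exp (- (d * (\<theta> \<bullet> x))) \<partial>M)"
      unfolding lap_def using assms d' by (intro Bochner_Integration.integral_diff [symmetric] integrable_exp_M)
    also have "\<dots> \<le> (\<integral>x. h * (d * (\<theta> \<bullet> x) * exp (- (d * (\<theta> \<bullet> x) / 3))) \<partial>M)"
    proof (rule integral_mono_AE)
      show "AE x in M. exp (- (exp (- h) * d * (\<theta> \<bullet> x))) - exp (- (d * (\<theta> \<bullet> x)))
          \<le> h * (d * (\<theta> \<bullet> x) * exp (- (d * (\<theta> \<bullet> x) / 3)))"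
        using \<theta>_nonneg
      proof (rule eventually_mono)
        fix x assume "0 \<le> \<theta> \<bullet> x"
        then show "exp (- (exp (- h) * d * (\<theta> \<bullet> x))) - exp (- (d * (\<theta> \<bullet> x)))
          \<le> h * (d * (\<theta> \<bullet> x) * exp (- (d * (\<theta> \<bullet> x) / 3)))"
          using exp_scaled_diff_le [of "d * (\<theta> \<bullet> x)" h] assms by (simp add: mult.assoc)
      qed
    qed (use assms d' in \<open>auto intro!: integrable_exp_M integrable_jump Bochner_Integration.integrable_diff integrable_mult_right\<close>)
    finally show ?thesis by simp
  qed
  have "(\<integral>x. min 1 (d * (\<theta> \<bullet> x)) \<partial>R h) \<le> (\<integral>x. 2 * (1 - exp (- (d * (\<theta> \<bullet> x)))) \<partial>R h)"
  proof (rule integral_mono_AE)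
    show "AE x in R h. min 1 (d * (\<theta> \<bullet> x)) \<le> 2 * (1 - exp (- (d * (\<theta> \<bullet> x))))"
      using \<theta>_R by (rule eventually_mono) (use assms(3) in \<open>intro one_minus_exp_ge, simp\<close>)
  qed (use assms int_R in \<open>auto intro!: integrable_min_jump integrable_mult_right Bochner_Integration.integrable_diff\<close>)
  also have "\<dots> = 2 * (1 - lap (R h) d)"
    unfolding lap_def using int_R by (simp add: R.prob_space)
  also have "1 - lap (R h) d \<le> h * (\<integral>x. d * (\<theta> \<bullet> x) * exp (- (d * (\<theta> \<bullet> x) / 3)) \<partial>M) / lap M 1"
  proof -
    have "0 < lap M 1" using laplace_pos by (simp add: lap_def)
    moreover have "lap M 1 * (1 - lap (R h) d) \<le> lap M (exp (- h) * d) * (1 - lap (R h) d)"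
      using lap_ge lap_R by (intro mult_right_mono) auto
    ultimately show ?thesis using eq diff by (simp add: field_simps)
  qed
  finally show ?thesis by (simp add: small_jumps_def lap_def mult_ac)
qed


lemma norm_integral_R_le:
  fixes f :: "'a \<Rightarrow> complex"
  assumes h: "0 < h" "h \<le> 1" and d: "0 \<le> d" "d \<le> 1" and "0 \<le> B"
    and f [measurable]: "f \<in> borel_measurable borel"
    and le: "AE x in R h. norm (f x) \<le> B * min 1 (d * (\<theta> \<bullet> x))"
  shows "integrable (R h) f" "norm (\<integral>x. f x \<partial>R h) \<le> B * (h * small_jumps d)"
proof -
  interpret R: prob_space "R h" using h by (intro prob_R)
  note [measurable_cong] = sets_R [OF h(1)]
  have int: "integrable (R h) (\<lambda>x. B * min 1 (d * (\<theta> \<bullet> x)))"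
    using h d by (intro integrable_mult_right integrable_min_jump)
  show f_int: "integrable (R h) f"
    by (rule Bochner_Integration.integrable_bound [OF int]) (use le in \<open>auto elim!: eventually_mono\<close>)
  have "norm (\<integral>x. f x \<partial>R h) \<le> (\<integral>x. norm (f x) \<partial>R h)" by (rule integral_norm_bound)
  also have "\<dots> \<le> (\<integral>x. B * min 1 (d * (\<theta> \<bullet> x)) \<partial>R h)"
    using le f_int int by (intro integral_mono_AE integrable_norm) auto
  also have "\<dots> \<le> B * (h * small_jumps d)"
    using min_jump_le [OF h d] \<open>0 \<le> B\<close> by (simp add: mult_left_mono)
  finally show "norm (\<integral>x. f x \<partial>R h) \<le> B * (h * small_jumps d)" .
qed

text \<open>The bounds of \<open>p\<close> and of the modulus of \<open>q\<close> by a multiple of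
  \<open>\<theta>\<close> are spelled out as signs of linear functionals, since almost sure
  nonnegativity of such functionals is what \<open>nonneg_R\<close> carries over from
  \<open>M\<close> to \<open>R h\<close>.\<close>

definition dominated :: "real \<Rightarrow> 'a \<Rightarrow> 'a \<Rightarrow> bool" where
  "dominated C p q \<longleftrightarrow> 0 \<le> C \<and> (AE x in M. 0 \<le> p \<bullet> x) \<and> (AE x in M. 0 \<le> (C *\<^sub>R \<theta> - p) \<bullet> x) \<and>
     (AE x in M. 0 \<le> (C *\<^sub>R \<theta> - q) \<bullet> x) \<and> (AE x in M. 0 \<le> (C *\<^sub>R \<theta> + q) \<bullet> x)"

lemma dominated_R:
  assumes "0 < h" "dominated C p q"
  shows "AE x in R h. 0 \<le> \<theta> \<bullet> x \<and> 0 \<le> p \<bullet> x \<and> norm (lf_exponent p q x) \<le> 2 * C * (\<theta> \<bullet> x)"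
proof -
  have "AE x in R h. 0 \<le> p \<bullet> x" "AE x in R h. 0 \<le> (C *\<^sub>R \<theta> - p) \<bullet> x" "AE x in R h. 0 \<le> \<theta> \<bullet> x"
    "AE x in R h. 0 \<le> (C *\<^sub>R \<theta> - q) \<bullet> x" "AE x in R h. 0 \<le> (C *\<^sub>R \<theta> + q) \<bullet> x"
    using assms(2) \<theta>_nonneg unfolding dominated_def by (auto intro!: nonneg_R [OF assms(1)])
  then show ?thesis
  proof eventually_elim
    case (elim x)
    have "norm (lf_exponent p q x) \<le> \<bar>p \<bullet> x\<bar> + \<bar>q \<bullet> x\<bar>"
      unfolding lf_exponent_def by (rule order_trans [OF norm_triangle_ineq]) (simp add: norm_mult)
    also have "\<dots> \<le> C * (\<theta> \<bullet> x) + C * (\<theta> \<bullet> x)"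
      using elim by (intro add_mono) (auto simp: inner_diff_left inner_add_left abs_le_iff)
    finally show ?case using elim by simp
  qed
qed

text \<open>For \<open>s * (\<theta> \<bullet> x) \<le> 1\<close> the exponent itself is controlled
  by \<open>2 * C\<close>, otherwise the truncation at 2 takes over; the constant is the sum of the
  two.\<close>

lemma min_lf_exponent_le:
  assumes "0 < h" "dominated C p q" "0 \<le> s"
  shows "AE x in R h. min 2 (s * norm (lf_exponent p q x)) \<le> (2 + 2 * C) * min 1 (s * (\<theta> \<bullet> x))"
  using dominated_R [OF assms(1,2)]
proof eventually_elim
  case (elim x)
  have C: "0 \<le> C" using assms(2) by (simp add: dominated_def)
  show ?case
  proof (cases "s * (\<theta> \<bullet> x) \<le> 1")
    case True
    have "s * norm (lf_exponent p q x) \<le> s * (2 * C * (\<theta> \<bullet> x))"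
      using elim assms(3) by (intro mult_left_mono) auto
    moreover have "0 \<le> s * (\<theta> \<bullet> x)" using elim assms(3) by simp
    ultimately have "s * norm (lf_exponent p q x) \<le> (2 + 2 * C) * (s * (\<theta> \<bullet> x))"
      by (simp add: algebra_simps)
    with True show ?thesis by (simp add: min.coboundedI2)
  next
    case False
    with C show ?thesis by (simp add: min.coboundedI1)
  qed
qed

text \<open>The estimate is of order \<open>h\<close> uniformly in the contraction \<open>s\<close>,
  because the factors of the product in \<open>factor_prod\<close> are taken at all the contractions
  \<open>exp (- (k * h))\<close>.\<close>

lemma norm_lf_R_minus_1_le:
  assumes "0 < h" "h \<le> 1" "dominated C p q" "0 \<le> s" "s \<le> 1"
  shows "norm (laplace_fourier (R h) (s *\<^sub>R p) (s *\<^sub>R q) - 1) \<le> (2 + 2 * C) * (h * small_jumps 1)"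
    and "norm (laplace_fourier (R h) (s *\<^sub>R p) (s *\<^sub>R q)) \<le> 1"
    and "integrable (R h) (\<lambda>x. exp (s *\<^sub>R lf_exponent p q x))"
proof -
  interpret R: prob_space "R h" using assms by (intro prob_R)
  note [measurable_cong] = sets_R [OF assms(1)]
  have C: "0 \<le> C" using assms(3) by (simp add: dominated_def)
  have le: "AE x in R h. norm (exp (s *\<^sub>R lf_exponent p q x)) \<le> 1"
    using dominated_R [OF assms(1,3)] by (rule eventually_mono) (use assms in auto)
  show int: "integrable (R h) (\<lambda>x. exp (s *\<^sub>R lf_exponent p q x))"
    using le by (intro R.integrable_const_bound [where B = 1]) auto
  show "norm (laplace_fourier (R h) (s *\<^sub>R p) (s *\<^sub>R q)) \<le> 1"
    unfolding laplace_fourier_def lf_exponent_scaleR using le by (intro R.norm_integral_le) auto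
  have "laplace_fourier (R h) (s *\<^sub>R p) (s *\<^sub>R q) - 1 = (\<integral>x. exp (s *\<^sub>R lf_exponent p q x) - 1 \<partial>R h)"
    unfolding laplace_fourier_def lf_exponent_scaleR using int by (simp add: R.prob_space)
  also have "norm \<dots> \<le> (2 + 2 * C) * (h * small_jumps 1)"
  proof (rule norm_integral_R_le)
    show "AE x in R h. norm (exp (s *\<^sub>R lf_exponent p q x) - 1) \<le> (2 + 2 * C) * min 1 (1 * (\<theta> \<bullet> x))"
      using dominated_R [OF assms(1,3)] min_lf_exponent_le [OF assms(1,3) zero_le_one]
    proof eventually_elim
      case (elim x)
      then have Re: "Re (s *\<^sub>R lf_exponent p q x) \<le> 0" using assms by simp
      have "norm (exp (s *\<^sub>R lf_exponent p q x) - 1) \<le> min 2 (norm (s *\<^sub>R lf_exponent p q x))"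
        using norm_exp_minus_1_le [OF Re] by simp
      also have "\<dots> \<le> min 2 (1 * norm (lf_exponent p q x))"
        using assms by (intro min.mono order_refl) (auto intro!: mult_left_le_one_le)
      finally show ?case using elim by linarith
    qed
  qed (use assms C in auto)
  finally show "norm (laplace_fourier (R h) (s *\<^sub>R p) (s *\<^sub>R q) - 1) \<le> (2 + 2 * C) * (h * small_jumps 1)" .
qed

section \<open>Products of cofactors along geometric contractions\<close>

lemma factor_prod:
  fixes h :: real and m :: nat
  assumes "0 < h" "AE x in M. 0 \<le> p \<bullet> x"
  shows "laplace_fourier M p q = laplace_fourier M (exp (- (m * h)) *\<^sub>R p) (exp (- (m * h)) *\<^sub>R q)
    * (\<Prod>k<m. laplace_fourier (R h) (exp (- (k * h)) *\<^sub>R p) (exp (- (k * h)) *\<^sub>R q))"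
proof (induction m)
  case (Suc m)
  have "AE x in M. 0 \<le> (exp (- (m * h)) *\<^sub>R p) \<bullet> x" using assms(2) by auto
  moreover have "exp (- h) * exp (- (m * h)) = exp (- (Suc m * h))"
    by (simp add: exp_add [symmetric] algebra_simps)
  ultimately show ?case
    using factor [OF assms(1), of "exp (- (m * h)) *\<^sub>R p" "exp (- (m * h)) *\<^sub>R q"]
    unfolding Suc.IH by (simp add: mult_ac)
qed simp

text \<open>With mesh \<open>1 / Suc n\<close>, exactly \<open>l * Suc n\<close> cofactors contract
  by \<open>exp (- l)\<close>. Replacing each factor \<open>L n k\<close> by
  \<open>exp (L n k - 1)\<close> costs an error of order \<open>h\<^sup>2\<close>, in total of order
  \<open>h\<close>. Replacing the resulting exponent \<open>S n\<close> by the mean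
  \<open>P n\<close> costs the Riemann error, which is at most a multiple of
  \<open>small_jumps (h n)\<close>.\<close>

lemma ein_diff_integral_tendsto:
  fixes l :: nat
  assumes dom: "dominated C p q"
  defines "h \<equiv> \<lambda>n. 1 / real (Suc n)"
  shows "(\<lambda>n. exp (Suc n *\<^sub>R (\<integral>x. ein (lf_exponent p q x) - ein (exp (- real l) *\<^sub>R lf_exponent p q x) \<partial>R (h n)))
      * laplace_fourier M (exp (- real l) *\<^sub>R p) (exp (- real l) *\<^sub>R q)) \<longlonglongrightarrow> laplace_fourier M p q"
    and "\<And>n. integrable (R (h n)) (\<lambda>x. ein (lf_exponent p q x) - ein (exp (- real l) *\<^sub>R lf_exponent p q x))"
proof -
  have h: "0 < h n" "h n \<le> 1" "Suc n * h n = 1" for n by (auto simp: h_def)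
  have h_lim: "h \<longlonglongrightarrow> 0" unfolding h_def using LIMSEQ_inverse_real_of_nat by (simp add: inverse_eq_divide)
  have C: "0 \<le> C" and p: "AE x in M. 0 \<le> p \<bullet> x" using dom by (auto simp: dominated_def)
  define m where "m n = l * Suc n" for n
  have m: "m n * h n = l" for n unfolding m_def of_nat_mult mult.assoc h(3) by simp
  define c where "c = lf_exponent p q"
  have [measurable]: "c \<in> borel_measurable borel" by (simp add: c_def)
  define L where "L n k = laplace_fourier (R (h n)) (exp (- (k * h n)) *\<^sub>R p) (exp (- (k * h n)) *\<^sub>R q)" for n and k :: nat
  define S where "S n = (\<Sum>k<m n. L n k - 1)" for n
  define f where "f x = ein (c x) - ein (exp (- real l) *\<^sub>R c x)" for x
  define g where "g n x = (\<Sum>k<m n. h n *\<^sub>R (exp (exp (- (k * h n)) *\<^sub>R c x) - 1))" for n x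
  have [measurable]: "f \<in> borel_measurable borel" "g n \<in> borel_measurable borel" for n
    unfolding f_def g_def by measurable
  have s: "0 \<le> exp (- (k * h n))" "exp (- (k * h n)) \<le> 1" for k :: nat and n using h(1) [of n] by auto
  have intg: "integrable (R (h n)) (\<lambda>x. exp (exp (- (k * h n)) *\<^sub>R c x))" for k :: nat and n
    unfolding c_def using norm_lf_R_minus_1_le(3) [OF h(1,2) dom s] .
  have gn: "integrable (R (h n)) (g n)" "Suc n *\<^sub>R (\<integral>x. g n x \<partial>R (h n)) = S n" for n
  proof -
    interpret R: prob_space "R (h n)" using h by (intro prob_R)
    show "integrable (R (h n)) (g n)"
      unfolding g_def using intg by (intro Bochner_Integration.integrable_sum integrable_scaleR_right Bochner_Integration.integrable_diff) auto
    have "(\<integral>x. g n x \<partial>R (h n)) = h n *\<^sub>R S n"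
      unfolding g_def S_def L_def laplace_fourier_def lf_exponent_scaleR c_def [symmetric]
      using intg by (subst Bochner_Integration.integral_sum) (auto simp: R.prob_space scaleR_sum_right)
    then show "Suc n *\<^sub>R (\<integral>x. g n x \<partial>R (h n)) = S n"
      using h(3) by (simp del: of_nat_Suc)
  qed
  have fg_ae: "AE x in R (h n). norm (f x - g n x) \<le> (l * (2 + 2 * C)) * min 1 (h n * (\<theta> \<bullet> x))" for n
    using dominated_R [OF h(1) dom, of n] min_lf_exponent_le [OF h(1) dom less_imp_le [OF h(1)], of n n]
  proof eventually_elim
    case (elim x)
    have "norm (f x - g n x) \<le> m n * (h n * min 2 (h n * norm (c x)))"
      using ein_telescope [of "c x" "h n" "m n"] elim h(1) [of n] unfolding f_def g_def m by (simp add: c_def)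
    also have "\<dots> = l * min 2 (h n * norm (c x))"
      using m [of n] by (simp add: mult.assoc [symmetric])
    also have "\<dots> \<le> l * ((2 + 2 * C) * min 1 (h n * (\<theta> \<bullet> x)))"
      using elim by (intro mult_left_mono) (auto simp: c_def)
    finally show ?case by (simp add: mult.assoc)
  qed
  have fg: "integrable (R (h n)) (\<lambda>x. f x - g n x)"
    "norm (\<integral>x. f x - g n x \<partial>R (h n)) \<le> (l * (2 + 2 * C)) * (h n * small_jumps (h n))" for n
    using norm_integral_R_le [OF h(1,2) less_imp_le [OF h(1)] h(2) _ _ fg_ae] C by auto
  have f_int: "integrable (R (h n)) f" for n
    using Bochner_Integration.integrable_add [OF fg(1) gn(1)] by simp
  then show "\<And>n. integrable (R (h n)) (\<lambda>x. ein (lf_exponent p q x) - ein (exp (- real l) *\<^sub>R lf_exponent p q x))"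
    unfolding f_def c_def .
  define P where "P n = Suc n *\<^sub>R (\<integral>x. f x \<partial>R (h n))" for n
  have "norm (P n - S n) \<le> (l * (2 + 2 * C)) * small_jumps (h n)" for n
  proof -
    have "P n - S n = Suc n *\<^sub>R (\<integral>x. f x - g n x \<partial>R (h n))"
      unfolding gn(2) [symmetric] P_def using f_int gn(1) by (simp add: scaleR_diff_right del: of_nat_Suc)
    then have "norm (P n - S n) \<le> Suc n * ((l * (2 + 2 * C)) * (h n * small_jumps (h n)))"
      using fg(2) [of n] by (simp add: mult_left_mono del: of_nat_Suc)
    also have "\<dots> = (l * (2 + 2 * C)) * (Suc n * h n) * small_jumps (h n)"
      by (simp only: mult_ac)
    finally show ?thesis unfolding h(3) by simp
  qed
  moreover have "(\<lambda>n. (l * (2 + 2 * C)) * small_jumps (h n)) \<longlonglongrightarrow> 0"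
    using small_jumps_tendsto [OF h_lim] h(1) by (auto intro!: tendsto_eq_intros less_imp_le)
  ultimately have PS: "(\<lambda>n. P n - S n) \<longlonglongrightarrow> 0"
    by (intro Lim_null_comparison [of "\<lambda>n. P n - S n"]) auto
  have L: "norm (L n k - 1) \<le> (2 + 2 * C) * (h n * small_jumps 1)" "norm (L n k) \<le> 1" for n k
    unfolding L_def using norm_lf_R_minus_1_le(1,2) [OF h(1,2) dom s] by auto
  have Re_L: "Re (L n k) \<le> 1" for n k
    using complex_Re_le_cmod [of "L n k"] L(2) [of n k] by linarith
  have exp_S: "norm (exp (S n)) \<le> 1" for n
    using Re_L by (auto simp: S_def Re_sum intro!: sum_nonpos)
  have "norm (exp (S n) - (\<Prod>k<m n. L n k)) \<le> l * ((2 + 2 * C) * small_jumps 1)\<^sup>2 * h n" for n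
  proof -
    have "norm ((\<Prod>k<m n. exp (L n k - 1)) - (\<Prod>k<m n. L n k)) \<le> (\<Sum>k<m n. norm (exp (L n k - 1) - L n k))"
      using Re_L L by (intro norm_prod_diff) auto
    also have "\<dots> \<le> (\<Sum>k<m n. ((2 + 2 * C) * (h n * small_jumps 1))\<^sup>2)"
    proof (rule sum_mono)
      fix k
      have "norm (exp (L n k - 1) - L n k) \<le> (norm (L n k - 1))\<^sup>2"
        using norm_exp_minus_1_minus_le [of "L n k - 1"] Re_L by simp
      also have "\<dots> \<le> ((2 + 2 * C) * (h n * small_jumps 1))\<^sup>2"
        using L(1) by (intro power_mono) auto
      finally show "norm (exp (L n k - 1) - L n k) \<le> ((2 + 2 * C) * (h n * small_jumps 1))\<^sup>2" .
    qed
    also have "\<dots> = (m n * h n) * ((2 + 2 * C) * small_jumps 1)\<^sup>2 * h n"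
      by (simp add: power2_eq_square)
    finally show ?thesis
      unfolding m by (simp add: S_def exp_sum)
  qed
  moreover have "(\<lambda>n. l * ((2 + 2 * C) * small_jumps 1)\<^sup>2 * h n) \<longlonglongrightarrow> 0"
    using h_lim by (auto intro!: tendsto_eq_intros)
  ultimately have SL: "(\<lambda>n. exp (S n) - (\<Prod>k<m n. L n k)) \<longlonglongrightarrow> 0"
    by (intro Lim_null_comparison [of "\<lambda>n. exp (S n) - (\<Prod>k<m n. L n k)"]) auto
  have PS1: "(\<lambda>n. exp (P n - S n) - 1) \<longlonglongrightarrow> 0"
    using tendsto_diff [OF tendsto_exp [OF PS] tendsto_const [of 1]] by simp
  \<comment> \<open>Taking out \<open>exp (S n)\<close>, of norm at most 1, leaves an expression in
    \<open>P n - S n\<close> alone.\<close>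
  have le: "norm (exp (P n) - exp (S n)) \<le> norm (exp (P n - S n) - 1)" for n
  proof -
    have "exp (P n) - exp (S n) = exp (S n) * (exp (P n - S n) - 1)"
      by (simp add: exp_diff algebra_simps)
    then show ?thesis
      using exp_S [of n] by (simp only: norm_mult) (simp add: mult_left_le_one_le)
  qed
  have "(\<lambda>n. exp (P n) - exp (S n)) \<longlonglongrightarrow> 0"
    by (rule Lim_null_comparison [OF _ tendsto_norm_zero [OF PS1]]) (simp add: le)
  from tendsto_add [OF this SL] have "(\<lambda>n. exp (P n) - (\<Prod>k<m n. L n k)) \<longlonglongrightarrow> 0" by simp
  then have "(\<lambda>n. (exp (P n) - (\<Prod>k<m n. L n k)) * laplace_fourier M (exp (- real l) *\<^sub>R p) (exp (- real l) *\<^sub>R q)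
      + laplace_fourier M p q) \<longlonglongrightarrow> 0 * laplace_fourier M (exp (- real l) *\<^sub>R p) (exp (- real l) *\<^sub>R q) + laplace_fourier M p q"
    by (intro tendsto_intros)
  moreover have "(exp (P n) - (\<Prod>k<m n. L n k)) * laplace_fourier M (exp (- real l) *\<^sub>R p) (exp (- real l) *\<^sub>R q)
      + laplace_fourier M p q = exp (P n) * laplace_fourier M (exp (- real l) *\<^sub>R p) (exp (- real l) *\<^sub>R q)" for n
    using factor_prod [OF h(1) [of n] p, of q "m n"] unfolding m L_def by (simp add: algebra_simps)
  ultimately show "(\<lambda>n. exp (Suc n *\<^sub>R (\<integral>x. ein (lf_exponent p q x) - ein (exp (- real l) *\<^sub>R lf_exponent p q x) \<partial>R (h n)))
      * laplace_fourier M (exp (- real l) *\<^sub>R p) (exp (- real l) *\<^sub>R q)) \<longlonglongrightarrow> laplace_fourier M p q"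
    by (simp add: P_def f_def c_def del: of_nat_Suc)
qed


section \<open>Convergence for arguments on different rays\<close>

lemma norm_laplace_fourier_le_1:
  assumes "AE x in M. 0 \<le> p \<bullet> x"
  shows "norm (laplace_fourier M p q) \<le> 1"
  unfolding laplace_fourier_def using assms by (intro norm_integral_le) (auto elim!: eventually_mono)

lemma laplace_fourier_scale_tendsto:
  assumes "AE x in M. 0 \<le> p \<bullet> x"
  shows "(\<lambda>l::nat. laplace_fourier M (exp (- real l) *\<^sub>R p) (exp (- real l) *\<^sub>R q)) \<longlonglongrightarrow> 1"
proof -
  have e: "(\<lambda>l::nat. exp (- real l)) \<longlonglongrightarrow> 0" by real_asymp
  have "(\<lambda>l::nat. \<integral>x. exp (exp (- real l) *\<^sub>R lf_exponent p q x) \<partial>M) \<longlonglongrightarrow> (\<integral>x. 1 \<partial>M)"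
  proof (rule integral_dominated_convergence [where w = "\<lambda>_. 1"])
    show "AE x in M. (\<lambda>l::nat. exp (exp (- real l) *\<^sub>R lf_exponent p q x)) \<longlonglongrightarrow> 1"
    proof (rule AE_I2)
      fix x
      have "(\<lambda>l::nat. exp (exp (- real l) *\<^sub>R lf_exponent p q x)) \<longlonglongrightarrow> exp (0 *\<^sub>R lf_exponent p q x)"
        by (intro tendsto_intros e)
      then show "(\<lambda>l::nat. exp (exp (- real l) *\<^sub>R lf_exponent p q x)) \<longlonglongrightarrow> 1" by simp
    qed
    show "AE x in M. norm (exp (exp (- real l) *\<^sub>R lf_exponent p q x)) \<le> 1" for l :: nat
      using assms by (auto elim!: eventually_mono)
  qed auto
  then show ?thesis
    unfolding laplace_fourier_def lf_exponent_scaleR by (simp add: prob_space)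
qed

text \<open>No contraction need lead from one argument to the other, so both are contracted by
  \<open>d = exp (- l)\<close>, and \<open>E n = P n - P' n + T n\<close>. The first two exponents
  fall under \<open>ein_diff_integral_tendsto\<close>. The integrand of \<open>T n\<close> compares
  the contracted arguments: it is at most \<open>B\<close> where
  \<open>d * (\<theta> \<bullet> x)\<close> exceeds 1 and at most a multiple of
  \<open>d * (\<theta> \<bullet> x)\<close> elsewhere. Hence \<open>T n\<close> is of order
  \<open>small_jumps d\<close>, uniformly in \<open>n\<close>, and \<open>l\<close> can be fixed
  before \<open>n\<close> grows.\<close>

lemma exp_ein_integral_tendsto:
  assumes dom: "dominated C p q" "dominated C p' q'" and "0 \<le> B"
    and bound: "\<And>x r. 0 \<le> p \<bullet> x \<Longrightarrow> 0 \<le> p' \<bullet> x \<Longrightarrow> 0 \<le> r \<Longrightarrow>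
      norm (ein (r *\<^sub>R lf_exponent p q x) - ein (r *\<^sub>R lf_exponent p' q' x)) \<le> B"
  defines "E \<equiv> \<lambda>n. Suc n *\<^sub>R (\<integral>x. ein (lf_exponent p q x) - ein (lf_exponent p' q' x) \<partial>R (1 / Suc n))"
  assumes E_le: "\<And>n. norm (exp (E n)) \<le> 1"
  shows "(\<lambda>n. exp (E n) * laplace_fourier M p' q') \<longlonglongrightarrow> laplace_fourier M p q"
proof (rule tendstoI)
  fix e :: real assume "0 < e"
  define h where "h n = 1 / real (Suc n)" for n
  have h: "0 < h n" "h n \<le> 1" "Suc n * h n = 1" for n by (auto simp: h_def)
  have C: "0 \<le> C" and p: "AE x in M. 0 \<le> p \<bullet> x" "AE x in M. 0 \<le> p' \<bullet> x"
    using dom by (auto simp: dominated_def)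
  define a where "a l = laplace_fourier M (exp (- real l) *\<^sub>R p) (exp (- real l) *\<^sub>R q)" for l
  define a' where "a' l = laplace_fourier M (exp (- real l) *\<^sub>R p') (exp (- real l) *\<^sub>R q')" for l
  define A where "A = laplace_fourier M p q"
  define A' where "A' = laplace_fourier M p' q'"
  have A: "norm A \<le> 1" "norm A' \<le> 1" "norm (a' l) \<le> 1" for l
    unfolding A_def A'_def a'_def using p by (auto intro!: norm_laplace_fourier_le_1)
  have "isCont (exp :: complex \<Rightarrow> complex) 0" by simp
  then obtain s where s: "0 < s" "\<And>z :: complex. norm z < s \<Longrightarrow> norm (exp z - 1) < e / 8"
    using \<open>0 < e\<close> unfolding continuous_at_eps_delta dist_norm
    by (metis diff_zero exp_zero half_gt_zero_iff zero_less_divide_iff zero_less_numeral)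
  have "(\<lambda>l. (B + 4 * C) * small_jumps (exp (- real l))) \<longlonglongrightarrow> (B + 4 * C) * 0"
    by (intro tendsto_intros small_jumps_tendsto) (real_asymp, simp)
  then have "eventually (\<lambda>l. (B + 4 * C) * small_jumps (exp (- real l)) < s) sequentially"
    using s(1) by (intro order_tendstoD) auto
  moreover have "eventually (\<lambda>l. dist (a l) 1 < e / 8) sequentially" "eventually (\<lambda>l. dist (a' l) 1 < e / 8) sequentially"
    unfolding a_def a'_def using \<open>0 < e\<close>
    by (intro tendstoD [OF laplace_fourier_scale_tendsto] p, simp)+
  ultimately have "eventually (\<lambda>l. (B + 4 * C) * small_jumps (exp (- real l)) < s \<and>
      dist (a l) 1 < e / 8 \<and> dist (a' l) 1 < e / 8) sequentially"
    by (intro eventually_conj)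
  from eventually_happens' [OF sequentially_bot this]
  obtain l where l: "(B + 4 * C) * small_jumps (exp (- real l)) < s" "norm (a l - 1) < e / 8" "norm (a' l - 1) < e / 8"
    unfolding dist_norm by blast
  define d where "d = exp (- real l)"
  have d: "0 \<le> d" "d \<le> 1" by (auto simp: d_def)
  define c where "c = lf_exponent p q"
  define c' where "c' = lf_exponent p' q'"
  have [measurable]: "c \<in> borel_measurable borel" "c' \<in> borel_measurable borel" by (simp_all add: c_def c'_def)
  define P where "P n = Suc n *\<^sub>R (\<integral>x. ein (c x) - ein (d *\<^sub>R c x) \<partial>R (h n))" for n
  define P' where "P' n = Suc n *\<^sub>R (\<integral>x. ein (c' x) - ein (d *\<^sub>R c' x) \<partial>R (h n))" for n
  define T where "T n = Suc n *\<^sub>R (\<integral>x. ein (d *\<^sub>R c x) - ein (d *\<^sub>R c' x) \<partial>R (h n))" for n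
  have P_lim: "(\<lambda>n. exp (P n) * a l) \<longlonglongrightarrow> A" "(\<lambda>n. exp (P' n) * a' l) \<longlonglongrightarrow> A'"
    unfolding P_def P'_def a_def a'_def A_def A'_def h_def d_def c_def c'_def
    using ein_diff_integral_tendsto(1) [OF dom(1)] ein_diff_integral_tendsto(1) [OF dom(2)] by auto
  have P_int: "integrable (R (h n)) (\<lambda>x. ein (c x) - ein (d *\<^sub>R c x))"
    "integrable (R (h n)) (\<lambda>x. ein (c' x) - ein (d *\<^sub>R c' x))" for n
    unfolding h_def d_def c_def c'_def
    using ein_diff_integral_tendsto(2) [OF dom(1)] ein_diff_integral_tendsto(2) [OF dom(2)] by auto
  have T_ae: "AE x in R (h n). norm (ein (d *\<^sub>R c x) - ein (d *\<^sub>R c' x)) \<le> (B + 4 * C) * min 1 (d * (\<theta> \<bullet> x))" for n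
    using dominated_R [OF h(1) dom(1)] dominated_R [OF h(1) dom(2)]
  proof eventually_elim
    case (elim x)
    show ?case
    proof (cases "d * (\<theta> \<bullet> x) \<le> 1")
      case True
      have "norm (ein (d *\<^sub>R c x) - ein (d *\<^sub>R c' x)) \<le> norm (ein (d *\<^sub>R c x)) + norm (ein (d *\<^sub>R c' x))"
        by (rule norm_triangle_ineq4)
      also have "\<dots> \<le> norm (d *\<^sub>R c x) + norm (d *\<^sub>R c' x)"
        using elim d by (intro add_mono norm_ein_le) (auto simp: c_def c'_def)
      also have "\<dots> \<le> d * (2 * C * (\<theta> \<bullet> x)) + d * (2 * C * (\<theta> \<bullet> x))"
        using elim d unfolding c_def c'_def by (intro add_mono) (auto intro!: mult_left_mono)
      also have "\<dots> = 4 * C * (d * (\<theta> \<bullet> x))" by simp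
      also have "\<dots> \<le> (B + 4 * C) * (d * (\<theta> \<bullet> x))"
        using elim d \<open>0 \<le> B\<close> by (intro mult_right_mono) auto
      finally show ?thesis using True by simp
    next
      case False
      with bound [of x d] elim d C show ?thesis by (simp add: c_def c'_def)
    qed
  qed
  have T: "integrable (R (h n)) (\<lambda>x. ein (d *\<^sub>R c x) - ein (d *\<^sub>R c' x))" "norm (T n) < s" for n
  proof -
    note * = norm_integral_R_le [OF h(1,2) d _ _ T_ae]
    show "integrable (R (h n)) (\<lambda>x. ein (d *\<^sub>R c x) - ein (d *\<^sub>R c' x))"
      using * C \<open>0 \<le> B\<close> by simp
    have "norm (T n) \<le> Suc n * ((B + 4 * C) * (h n * small_jumps d))"
      unfolding T_def using *(2) C \<open>0 \<le> B\<close> by (simp add: mult_left_mono del: of_nat_Suc)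
    also have "\<dots> = (B + 4 * C) * small_jumps d * (Suc n * h n)" by (simp only: mult_ac)
    finally show "norm (T n) < s" using l(1) unfolding h(3) d_def by simp
  qed
  have E_eq: "E n = P n - P' n + T n" for n
  proof -
    have "P n - P' n + T n = Suc n *\<^sub>R ((\<integral>x. ein (c x) - ein (d *\<^sub>R c x) \<partial>R (h n))
        - (\<integral>x. ein (c' x) - ein (d *\<^sub>R c' x) \<partial>R (h n)) + (\<integral>x. ein (d *\<^sub>R c x) - ein (d *\<^sub>R c' x) \<partial>R (h n)))"
      by (simp add: P_def P'_def T_def scaleR_add_right scaleR_diff_right)
    also have "\<dots> = Suc n *\<^sub>R (\<integral>x. (ein (c x) - ein (d *\<^sub>R c x)) - (ein (c' x) - ein (d *\<^sub>R c' x))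
        + (ein (d *\<^sub>R c x) - ein (d *\<^sub>R c' x)) \<partial>R (h n))"
      by (simp only: Bochner_Integration.integral_add [OF Bochner_Integration.integrable_diff [OF P_int] T(1)]
          Bochner_Integration.integral_diff [OF P_int])
    also have "\<dots> = E n"
      unfolding E_def h_def c_def c'_def by (simp add: algebra_simps)
    finally show ?thesis by simp
  qed
  define y where "y n = exp (T n) * a' l" for n
  have y: "norm (y n - 1) < e / 4" for n
  proof -
    have "y n - 1 = (exp (T n) - 1) * a' l + (a' l - 1)" by (simp add: y_def algebra_simps)
    then have "norm (y n - 1) \<le> norm (exp (T n) - 1) * norm (a' l) + norm (a' l - 1)"
      by (metis norm_mult norm_triangle_ineq)
    also have "\<dots> \<le> norm (exp (T n) - 1) * 1 + norm (a' l - 1)"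
      using A(3) by (intro add_mono mult_left_mono) auto
    also have "\<dots> < e / 4" using s(2) [OF T(2) [of n]] l(3) by simp
    finally show ?thesis .
  qed
  have "(\<lambda>n. exp (P' n) * a' l * a l) \<longlonglongrightarrow> A' * a l" by (intro tendsto_mult P_lim tendsto_const)
  then have "eventually (\<lambda>n. dist (exp (P' n) * a' l * a l) (A' * a l) < e / 8) sequentially"
    using \<open>0 < e\<close> by (intro tendstoD) auto
  \<comment> \<open>This tolerance becomes \<open>e / 4\<close> after multiplication by
    \<open>norm (y n) \<le> 1 + e / 4\<close>.\<close>
  moreover have "eventually (\<lambda>n. dist (exp (P n) * a l) A < e / 4 / (1 + e / 4)) sequentially"
    using \<open>0 < e\<close> by (intro tendstoD P_lim) auto
  ultimately show "eventually (\<lambda>n. dist (exp (E n) * laplace_fourier M p' q') (laplace_fourier M p q) < e) sequentially"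
  proof eventually_elim
    case (elim n)
    define u where "u = exp (P n) * a l"
    define v where "v = exp (P' n) * a' l * a l"
    have "norm (A' - v) \<le> norm (A' * a l - v) + norm (A' * (1 - a l))"
      using norm_triangle_ineq [of "A' * a l - v" "A' * (1 - a l)"] by (simp add: algebra_simps)
    also have "norm (A' * (1 - a l)) \<le> 1 * norm (a l - 1)"
      unfolding norm_mult using A(2) by (intro mult_mono) (auto simp: norm_minus_commute)
    finally have v: "norm (A' - v) < e / 4"
      using elim(1) l(2) by (simp add: v_def dist_norm norm_minus_commute)
    have "norm (y n) \<le> 1 + e / 4"
      using y [of n] norm_triangle_ineq [of "y n - 1" 1] by simp
    then have "norm ((u - A) * y n) \<le> e / 4 / (1 + e / 4) * (1 + e / 4)"
      unfolding norm_mult using elim(2) \<open>0 < e\<close> by (intro mult_mono) (auto simp: u_def dist_norm)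
    moreover have "e / 4 / k * k = e / 4" if "0 < k" for k using that by simp
    ultimately have u: "norm ((u - A) * y n) \<le> e / 4" using \<open>0 < e\<close> by (metis add_pos_pos divide_pos_pos zero_less_numeral zero_less_one)
    have "norm (A * (y n - 1)) \<le> 1 * norm (y n - 1)"
      unfolding norm_mult using A(1) by (intro mult_right_mono) auto
    then have Ay: "norm (A * (y n - 1)) < e / 4" using y [of n] by simp
    \<comment> \<open>Multiplying by \<open>v\<close>, which is close to \<open>A'\<close>, stands
      in for a division by \<open>exp (P' n)\<close>, whose modulus has no lower bound at hand. The
      error \<open>A' - v\<close> is then multiplied by \<open>exp (E n)\<close>, which
      \<open>E_le\<close> controls.\<close>
    have "exp (E n) * v = u * y n"
      unfolding E_eq u_def v_def y_def by (simp add: exp_add exp_diff)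
    then have eqn: "exp (E n) * A' - A = exp (E n) * (A' - v) + ((u - A) * y n + A * (y n - 1))"
      by (simp add: algebra_simps)
    have "norm (exp (E n) * A' - A) \<le> norm (exp (E n) * (A' - v)) + (norm ((u - A) * y n) + norm (A * (y n - 1)))"
      unfolding eqn using norm_triangle_ineq [of "exp (E n) * (A' - v)" "(u - A) * y n + A * (y n - 1)"]
        norm_triangle_ineq [of "(u - A) * y n" "A * (y n - 1)"] by linarith
    moreover have "norm (exp (E n) * (A' - v)) \<le> 1 * norm (A' - v)"
      unfolding norm_mult using E_le by (intro mult_right_mono) auto
    ultimately have "norm (exp (E n) * A' - A) < e"
      using u v Ay \<open>0 < e\<close> by linarith
    then show ?case by (simp add: dist_norm A_def A'_def)
  qed
qed

text \<open>Taking \<open>L = ln b\<close> in \<open>is_char_exp_ein\<close> serves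
  \<open>exp_ein_integral_tendsto\<close> twice: \<open>exp (E n z)\<close> is a characteristic
  function, hence of norm at most 1, and the differences are bounded by \<open>4 * L\<close>. With
  the convergence established, \<open>is_char_factor_limit\<close> extracts the cofactor.\<close>

lemma is_char_cofactor:
  fixes a g :: 'a and b C :: real
  assumes "1 < b" and dom: "dominated C a g"
  defines "\<Phi> \<equiv> \<lambda>z. laplace_fourier M ((z\<^sup>2 / 2) *\<^sub>R a) (z *\<^sub>R g)"
  assumes \<Phi>: "is_char \<Phi>"
  shows "\<exists>\<kappa>. is_char \<kappa> \<and> (\<forall>z. \<Phi> z = \<Phi> (inverse b * z) * \<kappa> z)"
proof -
  have C: "0 \<le> C" and a: "AE x in M. 0 \<le> a \<bullet> x" using dom by (auto simp: dominated_def)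
  define L where "L = ln b"
  have L: "0 < L" "exp (- L) = inverse b" using \<open>1 < b\<close> by (auto simp: L_def exp_minus)
  define w where "w x z = lf_exponent ((z\<^sup>2 / 2) *\<^sub>R a) (z *\<^sub>R g) x" for x z
  define E where "E n z = Suc n *\<^sub>R (\<integral>x. ein (w x z) - ein (w x (inverse b * z)) \<partial>R (1 / Suc n))" for n z
  \<comment> \<open>The variance \<open>a \<bullet> x\<close> is nonnegative almost everywhere,
    whereas \<open>is_char_exp_ein\<close> asks for this at every point; hence the positive
    part.\<close>
  have w_eq: "w x z = \<i> * (g \<bullet> x) * z - max 0 (a \<bullet> x) * z\<^sup>2 / 2" if "0 \<le> a \<bullet> x" for x z
    using that by (simp add: w_def lf_exponent_def max_def)
  have char_E: "is_char (\<lambda>z. exp (E n z))" for n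
  proof -
    define h where "h = 1 / real (Suc n)"
    have h: "0 < h" by (simp add: h_def)
    note [measurable_cong] = sets_R [OF h]
    let ?w = "\<lambda>x z::real. \<i> * (g \<bullet> x) * z - max 0 (a \<bullet> x) * z\<^sup>2 / 2"
    have "(\<integral>x. ein (w x z) - ein (w x (inverse b * z)) \<partial>R h)
        = (\<integral>x. ein (?w x z) - ein (?w x (z * exp (- L))) \<partial>R h)" for z
    proof (rule integral_cong_AE)
      show "AE x in R h. ein (w x z) - ein (w x (inverse b * z)) = ein (?w x z) - ein (?w x (z * exp (- L)))"
        using nonneg_R [OF h a] by (rule eventually_mono) (simp add: w_eq L mult.commute)
    qed (auto simp: w_def)
    moreover have "is_char (\<lambda>z. exp (of_real (Suc n) * (\<integral>x. ein (?w x z) - ein (?w x (z * exp (- L))) \<partial>R h)))"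
      using L(1) by (intro is_char_exp_ein prob_R h) auto
    ultimately show ?thesis by (simp add: E_def h_def [symmetric] scaleR_conv_of_real del: of_nat_Suc)
  qed
  \<comment> \<open>A multiple \<open>r\<close> of the exponent is the exponent with variance
    \<open>r * (a \<bullet> x)\<close> and mean \<open>r * (g \<bullet> x)\<close>, so the bound
    does not depend on \<open>r\<close>.\<close>
  have bound: "norm (ein (r *\<^sub>R w x z) - ein (r *\<^sub>R w x (inverse b * z))) \<le> 4 * L" if "0 \<le> a \<bullet> x" "0 \<le> r" for r x z
  proof -
    have "r *\<^sub>R w x z = \<i> * (r * (g \<bullet> x)) * z - (r * (a \<bullet> x)) * z\<^sup>2 / 2" for z
      using that by (simp add: w_def lf_exponent_def scaleR_conv_of_real algebra_simps)
    then show ?thesis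
      using is_char_exp_ein(2) [OF prob_M, of "\<lambda>_. r * (a \<bullet> x)" "\<lambda>_. r * (g \<bullet> x)" L 1 x z] that L
      by (simp add: mult.commute)
  qed
  have "(\<lambda>n. exp (E n z) * \<Phi> (inverse b * z)) \<longlonglongrightarrow> \<Phi> z" for z
  proof -
    \<comment> \<open>One constant that serves all \<open>y\<close> with
      \<open>\<bar>y\<bar> \<le> \<bar>z\<bar>\<close>, in particular \<open>z\<close> and
      \<open>inverse b * z\<close>.\<close>
    define D where "D = max (C * (z\<^sup>2 / 2)) (C * \<bar>z\<bar>)"
    have dom_z: "dominated D ((y\<^sup>2 / 2) *\<^sub>R a) (y *\<^sub>R g)" if y: "\<bar>y\<bar> \<le> \<bar>z\<bar>" for y
    proof -
      have "y\<^sup>2 \<le> z\<^sup>2" using y by (simp add: abs_le_square_iff)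
      then have D: "C * (y\<^sup>2 / 2) \<le> D" "C * \<bar>y\<bar> \<le> D" "0 \<le> D"
        using y C unfolding D_def by (auto simp: le_max_iff_disj mult_left_mono)
      have "AE x in M. 0 \<le> \<theta> \<bullet> x \<and> 0 \<le> a \<bullet> x \<and> a \<bullet> x \<le> C * (\<theta> \<bullet> x) \<and> \<bar>g \<bullet> x\<bar> \<le> C * (\<theta> \<bullet> x)"
      proof -
        have "AE x in M. 0 \<le> (C *\<^sub>R \<theta> - a) \<bullet> x" "AE x in M. 0 \<le> (C *\<^sub>R \<theta> - g) \<bullet> x" "AE x in M. 0 \<le> (C *\<^sub>R \<theta> + g) \<bullet> x"
          using dom by (simp_all add: dominated_def)
        with a \<theta>_nonneg show ?thesis
          by eventually_elim (auto simp: inner_diff_left inner_add_left abs_le_iff)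
      qed
      then have "AE x in M. 0 \<le> (y\<^sup>2 / 2) * (a \<bullet> x) \<and> (y\<^sup>2 / 2) * (a \<bullet> x) \<le> D * (\<theta> \<bullet> x) \<and> \<bar>y * (g \<bullet> x)\<bar> \<le> D * (\<theta> \<bullet> x)"
      proof eventually_elim
        case (elim x)
        have "(y\<^sup>2 / 2) * (a \<bullet> x) \<le> (y\<^sup>2 / 2) * (C * (\<theta> \<bullet> x))" using elim by (intro mult_left_mono) auto
        also have "\<dots> = C * (y\<^sup>2 / 2) * (\<theta> \<bullet> x)" by simp
        also have "\<dots> \<le> D * (\<theta> \<bullet> x)" using D elim by (intro mult_right_mono) auto
        finally have 1: "(y\<^sup>2 / 2) * (a \<bullet> x) \<le> D * (\<theta> \<bullet> x)" .
        have "\<bar>y * (g \<bullet> x)\<bar> \<le> \<bar>y\<bar> * (C * (\<theta> \<bullet> x))" unfolding abs_mult using elim by (intro mult_left_mono) auto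
        also have "\<dots> = C * \<bar>y\<bar> * (\<theta> \<bullet> x)" by simp
        also have "\<dots> \<le> D * (\<theta> \<bullet> x)" using D elim by (intro mult_right_mono) auto
        finally show ?case using 1 elim by simp
      qed
      then show ?thesis
        unfolding dominated_def
        by (intro conjI D(3); elim eventually_mono) (auto simp: inner_diff_left inner_add_left abs_le_iff)
    qed
    have le: "\<bar>inverse b * z\<bar> \<le> \<bar>z\<bar>"
      using \<open>1 < b\<close> mult_right_mono [of 1 b "\<bar>z\<bar>"] by (simp add: abs_mult field_simps)
    show ?thesis
      unfolding \<Phi>_def E_def w_def
    proof (rule exp_ein_integral_tendsto [OF dom_z dom_z, where B = "4 * L"])
      fix x r assume *: "0 \<le> (z\<^sup>2 / 2) *\<^sub>R a \<bullet> x" "0 \<le> (r::real)"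
      show "norm (ein (r *\<^sub>R lf_exponent ((z\<^sup>2 / 2) *\<^sub>R a) (z *\<^sub>R g) x)
          - ein (r *\<^sub>R lf_exponent (((inverse b * z)\<^sup>2 / 2) *\<^sub>R a) ((inverse b * z) *\<^sub>R g) x)) \<le> 4 * L"
      \<comment> \<open>At \<open>z = 0\<close> the assumption reveals nothing about the sign of
        \<open>a \<bullet> x\<close>, but then both exponents vanish.\<close>
      proof (cases "z = 0")
        case True
        then show ?thesis using L by simp
      next
        case False
        then have "0 \<le> a \<bullet> x" using * by (simp add: zero_le_mult_iff)
        then show ?thesis using bound [of x r z] * by (simp add: w_def)
      qed
    next
      show "norm (exp (Suc n *\<^sub>R (\<integral>x. ein (lf_exponent ((z\<^sup>2 / 2) *\<^sub>R a) (z *\<^sub>R g) x)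
          - ein (lf_exponent (((inverse b * z)\<^sup>2 / 2) *\<^sub>R a) ((inverse b * z) *\<^sub>R g) x) \<partial>R (1 / Suc n)))) \<le> 1" for n
        using is_char_norm_le_1 [OF char_E [of n], of z] unfolding E_def w_def .
    qed (use le L in auto)
  qed
  from is_char_factor_limit [OF \<Phi> is_char_scale [OF \<Phi>] char_E this] show ?thesis .
qed

end

section \<open>Uniqueness for linear functionals\<close>

lemma borel_prob_bounded_integrable:
  fixes f :: "'a::topological_space \<Rightarrow> 'b::{banach, second_countable_topology}"
  assumes "borel_prob M" "f \<in> borel_measurable borel" "\<And>x. norm (f x) \<le> B"
  shows "integrable M f"
proof -
  interpret prob_space M using assms(1) by (simp add: borel_prob_def)
  show ?thesis
    using assms by (intro integrable_const_bound [where B = B]) (auto simp: borel_prob_def measurable_cong_sets [of M borel])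
qed

text \<open>A weight between 1 and 3 can be normalised to a probability density, and Levy uniqueness
  on the line applies to the law of \<open>p \<bullet> x\<close> under it. A weight that depends on
  a second functional makes this a statement on two functionals at once.\<close>

lemma weighted_law_eq:
  fixes M N :: "'a::euclidean_space measure" and k :: "'a \<Rightarrow> real" and h :: "real \<Rightarrow> complex"
  assumes M: "borel_prob M" and N: "borel_prob N"
    and [measurable]: "k \<in> borel_measurable borel" and k: "\<And>x. 1 \<le> k x" "\<And>x. k x \<le> 3"
    and eq: "\<And>t. (\<integral>x. of_real (k x) * iexp (t * (p \<bullet> x)) \<partial>M) = (\<integral>x. of_real (k x) * iexp (t * (p \<bullet> x)) \<partial>N)"
    and [measurable]: "h \<in> borel_measurable borel"
  shows "(\<integral>x. of_real (k x) * h (p \<bullet> x) \<partial>M) = (\<integral>x. of_real (k x) * h (p \<bullet> x) \<partial>N)"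
proof -
  define c where "c P = (\<integral>x. k x \<partial>P)" for P :: "'a measure"
  define Q where "Q P = distr (density P (\<lambda>x. k x / c P)) borel (\<lambda>x. p \<bullet> x)" for P :: "'a measure"
  have Q: "1 \<le> c P" "real_distribution (Q P)"
    "\<And>h :: real \<Rightarrow> complex. h \<in> borel_measurable borel \<Longrightarrow>
      (\<integral>x. h x \<partial>Q P) = (\<integral>x. of_real (k x) * h (p \<bullet> x) \<partial>P) / of_real (c P)"
    if P: "borel_prob P" for P
  proof -
    interpret P: prob_space P using P by (simp add: borel_prob_def)
    have [measurable_cong]: "sets P = sets borel" using P by (simp add: borel_prob_def)
    have k_int: "integrable P k"
    proof (rule P.integrable_const_bound [where B = 3], rule AE_I2)
      show "norm (k x) \<le> 3" for x using k(1) [of x] k(2) [of x] by simp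
    qed simp
    show c: "1 \<le> c P"
      unfolding c_def using k k_int by (intro P.integral_ge_const) auto
    have k0: "0 \<le> k x / c P" for x using k(1) [of x] c by simp
    have "emeasure (density P (\<lambda>x. k x / c P)) (space P) = (\<integral>\<^sup>+x. ennreal (k x / c P) \<partial>P)"
      by (subst emeasure_density) (auto intro!: nn_integral_cong)
    also have "\<dots> = ennreal (\<integral>x. k x / c P \<partial>P)"
      using k_int k0 by (intro nn_integral_eq_integral) auto
    also have "\<dots> = 1" using c by (simp add: c_def)
    finally interpret D: prob_space "density P (\<lambda>x. k x / c P)"
      by (intro prob_spaceI) simp
    show "real_distribution (Q P)"
      unfolding Q_def by (rule D.real_distribution_distr) simp
    fix h :: "real \<Rightarrow> complex" assume [measurable]: "h \<in> borel_measurable borel"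
    have "(\<integral>x. h x \<partial>Q P) = (\<integral>x. (k x / c P) *\<^sub>R h (p \<bullet> x) \<partial>P)"
      unfolding Q_def using k0 by (subst integral_distr, simp, simp, subst integral_density) auto
    also have "\<dots> = (\<integral>x. of_real (k x) * h (p \<bullet> x) / of_real (c P) \<partial>P)"
      by (simp add: scaleR_conv_of_real)
    finally show "(\<integral>x. h x \<partial>Q P) = (\<integral>x. of_real (k x) * h (p \<bullet> x) \<partial>P) / of_real (c P)"
      by simp
  qed
  \<comment> \<open>The case \<open>t = 0\<close> compares the total masses, so both laws are
    normalised by the same constant.\<close>
  have "complex_of_real (c M) = of_real (c N)"
    using eq [of 0] by (simp add: c_def)
  then have c: "c M = c N" by simp
  have "char (Q M) = char (Q N)"
  proof
    fix t
    show "char (Q M) t = char (Q N) t"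
      unfolding char_def using Q(3) [OF M, of "\<lambda>x. iexp (t * x)"] Q(3) [OF N, of "\<lambda>x. iexp (t * x)"] eq [of t] c
      by simp
  qed
  then have "Q M = Q N" using Q(2) [OF M] Q(2) [OF N] by (rule Levy_uniqueness [rotated 2])
  then show ?thesis
    using Q(3) [OF M, of h] Q(3) [OF N, of h] Q(1) [OF M] c by simp
qed

lemma integral_linear3:
  fixes f g h :: "'a \<Rightarrow> complex"
  assumes "integrable M f" "integrable M g" "integrable M h"
  shows "(\<integral>x. a * f x + b * g x + c * h x \<partial>M) = a * (\<integral>x. f x \<partial>M) + b * (\<integral>x. g x \<partial>M) + c * (\<integral>x. h x \<partial>M)"
  using assms by simp

text \<open>The weights \<open>2 + cos (q \<bullet> x)\<close> and
  \<open>2 + sin (q \<bullet> x)\<close> are positive and linear combinations of 1 and the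
  exponentials at \<open>q\<close> and \<open>- q\<close>, so \<open>charfun\<close> supplies the
  hypothesis of \<open>weighted_law_eq\<close>. The exponential is recovered as the first plus
  \<open>\<i>\<close> times the second minus \<open>2 + 2 * \<i>\<close>.\<close>

lemma charfun_eq_imp_integral_eq:
  fixes M N :: "'a::euclidean_space measure" and h :: "real \<Rightarrow> complex"
  assumes M: "borel_prob M" and N: "borel_prob N" and eq: "charfun M = charfun N"
    and h [measurable]: "h \<in> borel_measurable borel" and h_le: "\<And>x. norm (h x) \<le> B"
  shows "(\<integral>x. h (p \<bullet> x) * iexp (q \<bullet> x) \<partial>M) = (\<integral>x. h (p \<bullet> x) * iexp (q \<bullet> x) \<partial>N)"
proof -
  have int: "integrable P (\<lambda>x. iexp (v \<bullet> x))" if "borel_prob P" for P and v :: 'a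
    using that by (intro borel_prob_bounded_integrable [where B = 1]) auto
  have iexp_add: "iexp ((t *\<^sub>R p + q) \<bullet> x) = iexp (t * (p \<bullet> x)) * iexp (q \<bullet> x)"
    "iexp ((t *\<^sub>R p - q) \<bullet> x) = iexp (t * (p \<bullet> x)) * exp (- (\<i> * of_real (q \<bullet> x)))"
    "iexp ((t *\<^sub>R p) \<bullet> x) = iexp (t * (p \<bullet> x))" for t x
    by (simp_all add: exp_add [symmetric] algebra_simps)
  have cos_eq': "of_real (2 + cos y) = 2 + 1 / 2 * iexp y + 1 / 2 * exp (- (\<i> * of_real y))" for y
    by (simp add: cos_exp_eq cos_of_real [symmetric] add_divide_distrib)
  have sin_eq': "of_real (2 + sin y) = 2 + (- \<i> / 2) * iexp y + \<i> / 2 * exp (- (\<i> * of_real y))" for y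
    by (simp add: sin_exp_eq sin_of_real [symmetric]) (simp add: field_simps)
  have cos: "(\<integral>x. of_real (2 + cos (q \<bullet> x)) * iexp (t * (p \<bullet> x)) \<partial>P)
      = 2 * charfun P (t *\<^sub>R p) + 1 / 2 * charfun P (t *\<^sub>R p + q) + 1 / 2 * charfun P (t *\<^sub>R p - q)"
    if P: "borel_prob P" for P t
  proof -
    have "of_real (2 + cos (q \<bullet> x)) * iexp (t * (p \<bullet> x))
      = 2 * iexp ((t *\<^sub>R p) \<bullet> x) + 1 / 2 * iexp ((t *\<^sub>R p + q) \<bullet> x) + 1 / 2 * iexp ((t *\<^sub>R p - q) \<bullet> x)" for x
      unfolding iexp_add cos_eq' by (simp only: distrib_left distrib_right mult_ac)
    then show ?thesis unfolding charfun_def by (simp only: integral_linear3 [OF int int int, OF P P P])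
  qed
  have sin: "(\<integral>x. of_real (2 + sin (q \<bullet> x)) * iexp (t * (p \<bullet> x)) \<partial>P)
      = 2 * charfun P (t *\<^sub>R p) + (- \<i> / 2) * charfun P (t *\<^sub>R p + q) + \<i> / 2 * charfun P (t *\<^sub>R p - q)"
    if P: "borel_prob P" for P t
  proof -
    have "of_real (2 + sin (q \<bullet> x)) * iexp (t * (p \<bullet> x))
      = 2 * iexp ((t *\<^sub>R p) \<bullet> x) + (- \<i> / 2) * iexp ((t *\<^sub>R p + q) \<bullet> x) + \<i> / 2 * iexp ((t *\<^sub>R p - q) \<bullet> x)" for x
      unfolding iexp_add sin_eq' by (simp only: distrib_left distrib_right mult_ac)
    then show ?thesis unfolding charfun_def by (simp only: integral_linear3 [OF int int int, OF P P P])
  qed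
  let ?I = "\<lambda>P k. (\<integral>x. of_real (k x) * h (p \<bullet> x) \<partial>P)"
  have one: "?I M (\<lambda>x. 1) = ?I N (\<lambda>x. 1)"
  proof (rule weighted_law_eq [OF M N])
    fix t
    have "charfun M (t *\<^sub>R p) = charfun N (t *\<^sub>R p)" by (simp only: eq)
    then show "(\<integral>x. of_real 1 * iexp (t * (p \<bullet> x)) \<partial>M) = (\<integral>x. of_real 1 * iexp (t * (p \<bullet> x)) \<partial>N)"
      unfolding charfun_def by simp
  qed auto
  have cos_eq: "?I M (\<lambda>x. 2 + cos (q \<bullet> x)) = ?I N (\<lambda>x. 2 + cos (q \<bullet> x))"
  proof (rule weighted_law_eq [OF M N])
    show "1 \<le> 2 + cos (q \<bullet> x)" for x using cos_ge_minus_one [of "q \<bullet> x"] by linarith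
    show "2 + cos (q \<bullet> x) \<le> 3" for x using cos_le_one [of "q \<bullet> x"] by linarith
  qed (simp_all only: cos [OF M] cos [OF N] eq, simp_all)
  have sin_eq: "?I M (\<lambda>x. 2 + sin (q \<bullet> x)) = ?I N (\<lambda>x. 2 + sin (q \<bullet> x))"
  proof (rule weighted_law_eq [OF M N])
    show "1 \<le> 2 + sin (q \<bullet> x)" for x using sin_ge_minus_one [of "q \<bullet> x"] by linarith
    show "2 + sin (q \<bullet> x) \<le> 3" for x using sin_le_one [of "q \<bullet> x"] by linarith
  qed (simp_all only: sin [OF M] sin [OF N] eq, simp_all)
  have expand: "(\<integral>x. h (p \<bullet> x) * iexp (q \<bullet> x) \<partial>P)
      = ?I P (\<lambda>x. 2 + cos (q \<bullet> x)) + \<i> * ?I P (\<lambda>x. 2 + sin (q \<bullet> x)) + (- 2 - 2 * \<i>) * ?I P (\<lambda>x. 1)"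
    if P: "borel_prob P" for P
  proof -
    have i: "integrable P (\<lambda>x. of_real (k x) * h (p \<bullet> x))"
      if [measurable]: "k \<in> borel_measurable borel" and "\<And>x. \<bar>k x\<bar> \<le> 3" for k :: "'a \<Rightarrow> real"
      using that h_le order_trans [OF norm_ge_zero h_le]
      by (intro borel_prob_bounded_integrable [OF P, where B = "3 * B"]) (auto simp: norm_mult intro!: mult_mono)
    have "h (p \<bullet> x) * iexp (q \<bullet> x) = 1 * (of_real (2 + cos (q \<bullet> x)) * h (p \<bullet> x))
        + \<i> * (of_real (2 + sin (q \<bullet> x)) * h (p \<bullet> x)) + (- 2 - 2 * \<i>) * (of_real 1 * h (p \<bullet> x))" for x
      by (simp add: exp_Euler cos_of_real sin_of_real algebra_simps)
    moreover have b: "\<bar>2 + cos (q \<bullet> x)\<bar> \<le> 3" "\<bar>2 + sin (q \<bullet> x)\<bar> \<le> 3" for x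
      using cos_ge_minus_one [of "q \<bullet> x"] cos_le_one [of "q \<bullet> x"] sin_ge_minus_one [of "q \<bullet> x"] sin_le_one [of "q \<bullet> x"]
      unfolding abs_le_iff by linarith+
    have i1: "integrable P (\<lambda>x. of_real (2 + cos (q \<bullet> x)) * h (p \<bullet> x))"
      and i2: "integrable P (\<lambda>x. of_real (2 + sin (q \<bullet> x)) * h (p \<bullet> x))"
      and i3: "integrable P (\<lambda>x. of_real 1 * h (p \<bullet> x))"
      using b i [of "\<lambda>_. 1"] by (auto intro!: i simp del: of_real_add)
    ultimately have "(\<integral>x. h (p \<bullet> x) * iexp (q \<bullet> x) \<partial>P)
      = 1 * ?I P (\<lambda>x. 2 + cos (q \<bullet> x)) + \<i> * ?I P (\<lambda>x. 2 + sin (q \<bullet> x)) + (- 2 - 2 * \<i>) * ?I P (\<lambda>x. 1)"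
      by (simp only: integral_linear3 [OF i1 i2 i3])
    then show ?thesis by (simp only: mult_1)
  qed
  show ?thesis unfolding expand [OF M] expand [OF N] one cos_eq sin_eq ..
qed

section \<open>Cofactors of a law on a half-space\<close>

lemma integral_scaled_sum:
  fixes M N :: "'a::euclidean_space measure" and f :: "'a \<Rightarrow> 'b::{banach, second_countable_topology}"
  assumes M: "borel_prob M" and N: "borel_prob N"
    and [measurable]: "f \<in> borel_measurable borel" and f: "\<And>x. norm (f x) \<le> B"
  shows "(\<integral>x. f x \<partial>distr (M \<Otimes>\<^sub>M N) borel (\<lambda>(x, y). r *\<^sub>R x + y)) = (\<integral>x. \<integral>y. f (r *\<^sub>R x + y) \<partial>N \<partial>M)"
proof -
  have MN: "prob_space M" "prob_space N" using M N by (simp_all add: borel_prob_def)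
  have [measurable_cong]: "sets M = sets borel" "sets N = sets borel"
    using M N by (simp_all add: borel_prob_def)
  have "(\<integral>x. f x \<partial>distr (M \<Otimes>\<^sub>M N) borel (\<lambda>(x, y). r *\<^sub>R x + y)) = (\<integral>q. f (r *\<^sub>R fst q + snd q) \<partial>(M \<Otimes>\<^sub>M N))"
    by (subst integral_distr) (auto simp: split_beta)
  also have "\<dots> = (\<integral>x. \<integral>y. f (r *\<^sub>R x + y) \<partial>N \<partial>M)"
    by (subst prob_integral_fst [OF MN, where B = B]) (auto simp: f)
  finally show ?thesis .
qed

lemma borel_prob_scaled_sum:
  fixes M N :: "'a::euclidean_space measure" and r :: real
  assumes M: "borel_prob M" and N: "borel_prob N"
  defines "P \<equiv> distr (M \<Otimes>\<^sub>M N) borel (\<lambda>(x, y). r *\<^sub>R x + y)"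
  shows "borel_prob P" and "charfun P z = charfun M (r *\<^sub>R z) * charfun N z"
proof -
  interpret MN: prob_space "M \<Otimes>\<^sub>M N"
    using M N by (intro prob_space_pair) (simp_all add: borel_prob_def)
  have [measurable_cong]: "sets M = sets borel" "sets N = sets borel"
    using M N by (simp_all add: borel_prob_def)
  show "borel_prob P"
    unfolding P_def borel_prob_def by (auto intro!: MN.prob_space_distr)
  have "charfun P z = (\<integral>x. \<integral>y. iexp (z \<bullet> (r *\<^sub>R x + y)) \<partial>N \<partial>M)"
    unfolding charfun_def P_def by (rule integral_scaled_sum [OF M N, where B = 1]) auto
  moreover have "iexp (z \<bullet> (r *\<^sub>R x + y)) = iexp ((r *\<^sub>R z) \<bullet> x) * iexp (z \<bullet> y)" for x y
    by (simp add: exp_add [symmetric] algebra_simps)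
  ultimately show "charfun P z = charfun M (r *\<^sub>R z) * charfun N z"
    by (simp only: charfun_def integral_mult_right_zero integral_mult_left_zero)
qed

lemma charfun_eq_imp_measure_eq:
  fixes M N :: "'a::euclidean_space measure"
  assumes M: "borel_prob M" and N: "borel_prob N" and eq: "charfun M = charfun N"
    and [measurable]: "S \<in> sets borel"
  shows "measure M {x. p \<bullet> x \<in> S} = measure N {x. p \<bullet> x \<in> S}"
proof -
  have I: "(\<integral>x. indicator S (p \<bullet> x) * iexp (0 \<bullet> x) \<partial>P) = complex_of_real (measure P {x. p \<bullet> x \<in> S})"
    if P: "borel_prob P" for P :: "'a measure"
  proof -
    have [measurable_cong]: "sets P = sets borel" using P by (simp add: borel_prob_def)
    have sp: "space P = UNIV" using P sets_eq_imp_space_eq [of P borel] by (simp add: borel_prob_def)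
    have "(\<integral>x. indicator S (p \<bullet> x) * iexp (0 \<bullet> x) \<partial>P) = (\<integral>x. complex_of_real (indicator {x. p \<bullet> x \<in> S} x) \<partial>P)"
      by (intro Bochner_Integration.integral_cong) (auto simp: indicator_def)
    also have "\<dots> = of_real (\<integral>x. indicator {x. p \<bullet> x \<in> S} x \<partial>P)"
      by (rule integral_complex_of_real)
    also have "(\<integral>x. indicator {x. p \<bullet> x \<in> S} x \<partial>P) = measure P {x. p \<bullet> x \<in> S}"
      by (simp add: sp)
    finally show ?thesis .
  qed
  have "(\<integral>x. indicator S (p \<bullet> x) * iexp (0 \<bullet> x) \<partial>M) = (\<integral>x. indicator S (p \<bullet> x) * iexp (0 \<bullet> x) \<partial>N)"
    by (rule charfun_eq_imp_integral_eq [OF M N eq, where B = 1]) (auto simp: indicator_def)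
  then show ?thesis unfolding I [OF M] I [OF N] by simp
qed

text \<open>
  Comparing essential infima: if \<open>m\<close> is the one of \<open>p \<bullet> x\<close> under \<open>M\<close>, then \<open>m = r * m + m'\<close> for the
  one \<open>m'\<close> under \<open>N\<close>, whence \<open>m' \<ge> 0\<close>.
\<close>

lemma cofactor_nonneg:
  fixes M N :: "'a::euclidean_space measure"
  assumes M: "borel_prob M" and N: "borel_prob N" and r: "0 \<le> r" "r \<le> 1"
    and eq: "\<And>z. charfun M z = charfun M (r *\<^sub>R z) * charfun N z"
    and nonneg: "AE x in M. 0 \<le> p \<bullet> x"
  shows "AE x in N. 0 \<le> p \<bullet> x"
proof (rule ccontr)
  assume neg: "\<not> (AE x in N. 0 \<le> p \<bullet> x)"
  interpret M: prob_space M using M by (simp add: borel_prob_def)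
  interpret N: prob_space N using N by (simp add: borel_prob_def)
  interpret MN: pair_prob_space M N ..
  have [measurable_cong]: "sets M = sets borel" "sets N = sets borel"
    using M N by (simp_all add: borel_prob_def)
  have sp: "space M = UNIV" "space N = UNIV"
    using M N sets_eq_imp_space_eq [of M borel] sets_eq_imp_space_eq [of N borel] by (simp_all add: borel_prob_def)
  define P where "P = distr (M \<Otimes>\<^sub>M N) borel (\<lambda>(x, y). r *\<^sub>R x + y)"
  have P: "borel_prob P" "charfun P = charfun M"
    unfolding P_def by (rule borel_prob_scaled_sum [OF M N], intro ext) (simp only: borel_prob_scaled_sum(2) [OF M N] eq [symmetric])
  define F where "F t = measure M {x. p \<bullet> x < t}" for t
  have F_mono: "F s \<le> F t" if "s \<le> t" for s t
    unfolding F_def using that by (intro M.finite_measure_mono) auto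
  obtain c where c: "0 < c" "0 < measure N {y. p \<bullet> y < - c}"
  proof -
    have "\<exists>n::nat. measure N {y. p \<bullet> y < - (1 / Suc n)} \<noteq> 0"
    proof (rule ccontr)
      assume "\<not> ?thesis"
      then have "AE y in N. - (1 / Suc n) \<le> p \<bullet> y" for n :: nat
        by (subst AE_iff_measurable [where N = "{y. p \<bullet> y < - (1 / Suc n)}"])
           (auto simp: sp not_le N.emeasure_eq_measure)
      then have "AE y in N. \<forall>n::nat. - (1 / Suc n) \<le> p \<bullet> y" by (simp add: AE_all_countable)
      then have "AE y in N. 0 \<le> p \<bullet> y"
      proof (rule eventually_mono)
        fix y assume *: "\<forall>n::nat. - (1 / Suc n) \<le> p \<bullet> y"
        show "0 \<le> p \<bullet> y"
        proof (rule ccontr)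
          assume "\<not> 0 \<le> p \<bullet> y"
          then obtain n :: nat where "1 / Suc n < - (p \<bullet> y)"
            using reals_Archimedean [of "- (p \<bullet> y)"] by (auto simp: inverse_eq_divide)
          with * [rule_format, of n] show False by simp
        qed
      qed
      with neg show False by simp
    qed
    then show thesis using that by (metis divide_pos_pos of_nat_0_less_iff zero_less_Suc zero_less_measure_iff zero_less_one)
  qed
  define T where "T = {t. F t = 0}"
  have "F 0 = 0"
    unfolding F_def using nonneg by (subst M.prob_eq_0) (auto simp: sp not_less)
  then have T0: "0 \<in> T" by (simp add: T_def)
  have "bdd_above T"
  proof -
    interpret L: real_distribution "distr M borel (\<lambda>x. p \<bullet> x)" by (rule M.real_distribution_distr) simp
    obtain R where R: "measure (distr M borel (\<lambda>x. p \<bullet> x)) {x. R \<le> \<bar>x\<bar>} < 1"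
      using L.small_tail [of 1] by auto
    have "t \<le> R" if "t \<in> T" for t
    proof (rule ccontr)
      assume "\<not> t \<le> R"
      have "1 - F t = measure M (space M - {x. p \<bullet> x < t})"
        unfolding F_def by (rule M.prob_compl [symmetric]) (simp add: sp)
      also have "\<dots> \<le> measure M {x. R \<le> \<bar>p \<bullet> x\<bar>}"
        using \<open>\<not> t \<le> R\<close> by (intro M.finite_measure_mono) (auto simp: sp)
      also have "\<dots> < 1" using R by (subst (asm) measure_distr) (auto simp: sp vimage_def)
      finally show False using that by (simp add: T_def)
    qed
    then show ?thesis by (rule bdd_aboveI)
  qed
  define m where "m = Sup T"
  have "0 \<le> m" unfolding m_def using T0 \<open>bdd_above T\<close> by (rule cSup_upper)
  have pos: "F (m + c / 2) \<noteq> 0"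
  proof
    assume "F (m + c / 2) = 0"
    then have "m + c / 2 \<le> m" unfolding m_def using \<open>bdd_above T\<close> by (intro cSup_upper) (auto simp: T_def)
    with c show False by simp
  qed
  have zero: "F (m - c / 2) = 0"
  proof -
    obtain t where "t \<in> T" "m - c / 2 < t"
      using less_cSupD [of T "m - c / 2"] T0 c by (auto simp: m_def)
    then have "F (m - c / 2) \<le> 0" using F_mono [of "m - c / 2" t] by (simp add: T_def)
    then show ?thesis by (simp add: F_def measure_le_0_iff)
  qed
  \<comment> \<open>If \<open>p \<bullet> x\<close> is close to the essential infimum
    \<open>m\<close> and \<open>p \<bullet> y\<close> lies below \<open>- c\<close>, then
    \<open>r *\<^sub>R x + y\<close> falls below \<open>m - c / 2\<close>, where \<open>M\<close>
    has no mass; this uses \<open>r \<le> 1\<close> and \<open>0 \<le> m\<close>.\<close>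
  have "F (m + c / 2) * measure N {y. p \<bullet> y < - c}
      = measure (M \<Otimes>\<^sub>M N) ({x. p \<bullet> x < m + c / 2} \<times> {y. p \<bullet> y < - c})"
    by (simp add: F_def measure_def N.emeasure_pair_measure_Times enn2real_mult)
  also have "\<dots> \<le> measure (M \<Otimes>\<^sub>M N) ((\<lambda>(x, y). r *\<^sub>R x + y) -` {x. p \<bullet> x < m - c / 2} \<inter> space (M \<Otimes>\<^sub>M N))"
  proof (intro MN.finite_measure_mono measurable_sets [where A = borel] subsetI)
    fix q assume "q \<in> {x. p \<bullet> x < m + c / 2} \<times> {y. p \<bullet> y < - c}"
    then obtain x y where q: "q = (x, y)" "p \<bullet> x < m + c / 2" "p \<bullet> y < - c" by auto
    have "r * (p \<bullet> x) \<le> r * (m + c / 2)" using q r by (intro mult_left_mono) auto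
    also have "\<dots> \<le> 1 * (m + c / 2)" using r \<open>0 \<le> m\<close> c by (intro mult_right_mono) auto
    finally have "p \<bullet> (r *\<^sub>R x + y) < m - c / 2" using q by (simp add: inner_add_right)
    then show "q \<in> (\<lambda>(x, y). r *\<^sub>R x + y) -` {x. p \<bullet> x < m - c / 2} \<inter> space (M \<Otimes>\<^sub>M N)"
      using q by (simp add: space_pair_measure sp)
  qed simp_all
  also have "\<dots> = measure P {x. p \<bullet> x < m - c / 2}"
    unfolding P_def by (rule measure_distr [symmetric]) simp_all
  also have "\<dots> = F (m - c / 2)"
    using charfun_eq_imp_measure_eq [OF P(1) M P(2), of "{..<m - c / 2}" p] by (simp add: F_def)
  finally have "F (m + c / 2) * measure N {y. p \<bullet> y < - c} \<le> 0" using zero by simp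
  moreover have "0 < F (m + c / 2)" using pos by (simp add: F_def zero_less_measure_iff)
  ultimately show False using c(2) by (simp add: mult_le_0_iff)
qed

text \<open>Equality of characteristic functions identifies \<open>M\<close> with the law
  \<open>P\<close> of the scaled sum of independent variables, as far as integrals of the form in
  \<open>charfun_eq_imp_integral_eq\<close> go. The exponential of \<open>lf_exponent\<close> is of
  that form, which extends the factorisation from Fourier to Laplace arguments.\<close>

lemma laplace_fourier_factor:
  fixes M N :: "'a::euclidean_space measure"
  assumes M: "borel_prob M" and N: "borel_prob N" and r: "0 \<le> r" "r \<le> 1"
    and eq: "\<And>z. charfun M z = charfun M (r *\<^sub>R z) * charfun N z"
    and nonneg: "AE x in M. 0 \<le> p \<bullet> x"
  shows "laplace_fourier M p q = laplace_fourier M (r *\<^sub>R p) (r *\<^sub>R q) * laplace_fourier N p q"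
proof -
  have nonneg_N: "AE x in N. 0 \<le> p \<bullet> x" using cofactor_nonneg [OF assms] .
  have [measurable_cong]: "sets M = sets borel" "sets N = sets borel"
    using M N by (simp_all add: borel_prob_def)
  define P where "P = distr (M \<Otimes>\<^sub>M N) borel (\<lambda>(x, y). r *\<^sub>R x + y)"
  have P: "borel_prob P" "charfun M = charfun P"
    unfolding P_def by (rule borel_prob_scaled_sum [OF M N], intro ext) (simp only: borel_prob_scaled_sum(2) [OF M N] eq [symmetric])
  \<comment> \<open>The exponential of \<open>- (p \<bullet> x)\<close> on the half-space where both
    laws live, truncated so as to be bounded everywhere.\<close>
  define h where "h s = complex_of_real (exp (- max 0 s))" for s
  have [measurable]: "h \<in> borel_measurable borel" unfolding h_def by measurable
  have h: "norm (h s) \<le> 1" for s by (simp add: h_def)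
  have split: "exp (lf_exponent p q x) = h (p \<bullet> x) * iexp (q \<bullet> x)" if "0 \<le> p \<bullet> x" for x
    using that by (simp add: lf_exponent_def h_def exp_of_real [symmetric] exp_add [symmetric] max_def)
  have "laplace_fourier M p q = (\<integral>x. h (p \<bullet> x) * iexp (q \<bullet> x) \<partial>M)"
    unfolding laplace_fourier_def using nonneg by (intro integral_cong_AE) (auto simp: split elim!: eventually_mono)
  also have "\<dots> = (\<integral>x. h (p \<bullet> x) * iexp (q \<bullet> x) \<partial>P)"
    using h by (intro charfun_eq_imp_integral_eq [OF M P]) auto
  also have "\<dots> = (\<integral>x. \<integral>y. h (p \<bullet> (r *\<^sub>R x + y)) * iexp (q \<bullet> (r *\<^sub>R x + y)) \<partial>N \<partial>M)"
    unfolding P_def using h by (intro integral_scaled_sum [OF M N, where B = 1]) (auto simp: norm_mult)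
  also have "\<dots> = (\<integral>x. exp (lf_exponent (r *\<^sub>R p) (r *\<^sub>R q) x) * laplace_fourier N p q \<partial>M)"
  proof (rule integral_cong_AE)
    show "AE x in M. (\<integral>y. h (p \<bullet> (r *\<^sub>R x + y)) * iexp (q \<bullet> (r *\<^sub>R x + y)) \<partial>N)
        = exp (lf_exponent (r *\<^sub>R p) (r *\<^sub>R q) x) * laplace_fourier N p q"
      using nonneg
    proof (rule eventually_mono)
      fix x assume x: "0 \<le> p \<bullet> x"
      have "(\<integral>y. h (p \<bullet> (r *\<^sub>R x + y)) * iexp (q \<bullet> (r *\<^sub>R x + y)) \<partial>N)
        = (\<integral>y. exp (lf_exponent (r *\<^sub>R p) (r *\<^sub>R q) x) * exp (lf_exponent p q y) \<partial>N)"
      proof (rule integral_cong_AE)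
        show "AE y in N. h (p \<bullet> (r *\<^sub>R x + y)) * iexp (q \<bullet> (r *\<^sub>R x + y))
            = exp (lf_exponent (r *\<^sub>R p) (r *\<^sub>R q) x) * exp (lf_exponent p q y)"
          using nonneg_N
        proof (rule eventually_mono)
          fix y assume "0 \<le> p \<bullet> y"
          with x r have "0 \<le> p \<bullet> (r *\<^sub>R x + y)" by (simp add: inner_add_right)
          from split [OF this] show "h (p \<bullet> (r *\<^sub>R x + y)) * iexp (q \<bullet> (r *\<^sub>R x + y))
            = exp (lf_exponent (r *\<^sub>R p) (r *\<^sub>R q) x) * exp (lf_exponent p q y)"
            by (simp add: exp_add [symmetric] lf_exponent_def algebra_simps)
        qed
      qed auto
      then show "(\<integral>y. h (p \<bullet> (r *\<^sub>R x + y)) * iexp (q \<bullet> (r *\<^sub>R x + y)) \<partial>N)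
        = exp (lf_exponent (r *\<^sub>R p) (r *\<^sub>R q) x) * laplace_fourier N p q"
        by (simp add: laplace_fourier_def)
    qed
    interpret N: prob_space N using N by (simp add: borel_prob_def)
    show "(\<lambda>x. \<integral>y. h (p \<bullet> (r *\<^sub>R x + y)) * iexp (q \<bullet> (r *\<^sub>R x + y)) \<partial>N) \<in> borel_measurable M"
      by measurable
  qed auto
  also have "\<dots> = laplace_fourier M (r *\<^sub>R p) (r *\<^sub>R q) * laplace_fourier N p q"
    by (simp add: laplace_fourier_def)
  finally show ?thesis .
qed

section \<open>Parameter cones and Gaussian semigroups\<close>

lemma parameter_cone_add:
  assumes "parameter_cone K" "u \<in> K" "v \<in> K"
  shows "u + v \<in> K"
proof -
  have "(1 / 2) *\<^sub>R u + (1 / 2) *\<^sub>R v \<in> K"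
    using assms unfolding parameter_cone_def by (intro convexD) auto
  then have "2 *\<^sub>R ((1 / 2) *\<^sub>R u + (1 / 2) *\<^sub>R v) \<in> K"
    using assms(1) unfolding parameter_cone_def by (intro mem_cone) auto
  then show ?thesis by (simp add: scaleR_add_right)
qed

lemma parameter_cone_scaleR:
  assumes "parameter_cone K" "u \<in> K" "0 \<le> t"
  shows "t *\<^sub>R u \<in> K"
  using assms unfolding parameter_cone_def cone_def by blast

lemma parameter_cone_0: "parameter_cone K \<Longrightarrow> 0 \<in> K"
  using parameter_cone_scaleR [of K _ 0] unfolding parameter_cone_def by auto

lemma parameter_cone_sum:
  assumes "parameter_cone K" "finite B" "\<And>b. b \<in> B \<Longrightarrow> f b \<in> K"
  shows "(\<Sum>b\<in>B. f b) \<in> K"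
  using assms(2,3) by (induction B rule: finite_induct) (auto intro: parameter_cone_0 parameter_cone_add assms(1))

lemma parameter_cone_pointed:
  assumes K: "parameter_cone K" and "x \<in> K" "- x \<in> K"
  shows "x = 0"
proof (rule ccontr)
  assume "x \<noteq> 0"
  have "t *\<^sub>R x \<in> K" for t :: real
  proof (cases "0 \<le> t")
    case False
    then show ?thesis using parameter_cone_scaleR [OF K assms(3), of "- t"] by simp
  qed (rule parameter_cone_scaleR [OF K assms(2)])
  then have "range (\<lambda>t::real. t *\<^sub>R x) \<subseteq> K" by auto
  with \<open>x \<noteq> 0\<close> K show False unfolding parameter_cone_def by blast
qed

text \<open>
  Pointedness makes \<open>K - {0}\<close> convex, so the convex hull of the unit vectors of \<open>K\<close> is a compact
  set avoiding \<open>0\<close>.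
\<close>

lemma parameter_cone_functional:
  fixes K :: "'a::euclidean_space set"
  assumes K: "parameter_cone K"
  shows "\<exists>\<theta>. \<forall>u\<in>K. norm u \<le> \<theta> \<bullet> u"
proof -
  define S where "S = K \<inter> sphere 0 1"
  have "compact S"
    using K unfolding S_def parameter_cone_def by (intro closed_Int_compact) auto
  then have C: "compact (convex hull S)" by (rule compact_convex_hull)
  have "convex (K - {0})"
    unfolding convex_alt
  proof (intro ballI allI impI)
    fix x y and t :: real
    assume x: "x \<in> K - {0}" and y: "y \<in> K - {0}" and t: "0 \<le> t \<and> t \<le> 1"
    have xK: "(1 - t) *\<^sub>R x \<in> K" and yK: "t *\<^sub>R y \<in> K"
      using x y t by (auto intro!: parameter_cone_scaleR [OF K])
    have "(1 - t) *\<^sub>R x + t *\<^sub>R y \<noteq> 0"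
    proof
      assume eq: "(1 - t) *\<^sub>R x + t *\<^sub>R y = 0"
      then have "t *\<^sub>R y = - ((1 - t) *\<^sub>R x)" by (simp add: eq_neg_iff_add_eq_0 add.commute)
      with yK have "- ((1 - t) *\<^sub>R x) \<in> K" by simp
      from parameter_cone_pointed [OF K xK this] have "t = 1" using x by simp
      with eq y show False by simp
    qed
    then show "(1 - t) *\<^sub>R x + t *\<^sub>R y \<in> K - {0}"
      using parameter_cone_add [OF K xK yK] by simp
  qed
  then have "convex hull S \<subseteq> K - {0}"
    by (intro hull_minimal) (auto simp: S_def)
  then have "0 \<notin> convex hull S" by auto
  then obtain a b where ab: "0 < b" "\<And>x. x \<in> convex hull S \<Longrightarrow> b < a \<bullet> x"
    using separating_hyperplane_closed_0 [OF convex_convex_hull compact_imp_closed [OF C]] by metis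
  have "norm u \<le> (a /\<^sub>R b) \<bullet> u" if u: "u \<in> K" for u
  proof (cases "u = 0")
    case False
    then have "u /\<^sub>R norm u \<in> S"
      using u parameter_cone_scaleR [OF K u, of "inverse (norm u)"] by (simp add: S_def)
    then have "b < a \<bullet> (u /\<^sub>R norm u)" by (intro ab hull_inc)
    then have "b * norm u < a \<bullet> u" using False by (simp add: field_simps)
    then show ?thesis using ab(1) by (simp add: field_simps)
  qed simp
  then show ?thesis by blast
qed

text \<open>The cone may have empty interior, so a basis of its span is chosen inside it. Terms with
  negative coefficients are moved to the other side of the equation, which leaves sums within the
  cone, where \<open>f\<close> is additive.\<close>

lemma parameter_cone_linear_extension:
  fixes K :: "'a::euclidean_space set" and f :: "'a \<Rightarrow> real"
  assumes K: "parameter_cone K"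
    and add: "\<And>u v. u \<in> K \<Longrightarrow> v \<in> K \<Longrightarrow> f (u + v) = f u + f v"
    and scale: "\<And>t u. 0 \<le> t \<Longrightarrow> u \<in> K \<Longrightarrow> f (t *\<^sub>R u) = t * f u"
  shows "\<exists>v. \<forall>u\<in>K. f u = v \<bullet> u"
proof -
  obtain B where B: "B \<subseteq> K" "independent B" "K \<subseteq> span B"
    using maximal_independent_subset by blast
  have "finite B" using B(2) by (rule independent_imp_finite)
  obtain g where g: "linear g" "\<And>b. b \<in> B \<Longrightarrow> g b = f b"
    using linear_independent_extend [OF B(2)] by metis
  have f0: "f 0 = 0" using scale [of 0 0] parameter_cone_0 [OF K] by simp
  have sum: "f (\<Sum>b\<in>A. d b *\<^sub>R b) = (\<Sum>b\<in>A. d b * f b)" if "finite A" "A \<subseteq> B" "\<And>b. 0 \<le> d b" for A d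
    using that
  proof (induction A rule: finite_induct)
    case (insert b A)
    have "(\<Sum>b\<in>A. d b *\<^sub>R b) \<in> K"
      using insert B(1) by (intro parameter_cone_sum [OF K] parameter_cone_scaleR [OF K]) auto
    moreover have "b \<in> K" "d b *\<^sub>R b \<in> K"
      using insert B(1) by (auto intro!: parameter_cone_scaleR [OF K])
    ultimately show ?case using insert by (simp add: add scale)
  qed (simp add: f0)
  have "f u = g u" if u: "u \<in> K" for u
  proof -
    from B(3) u \<open>finite B\<close> obtain c where c: "u = (\<Sum>b\<in>B. c b *\<^sub>R b)"
      by (auto simp: span_finite)
    define n where "n b = max 0 (- c b)" for b
    define p where "p b = max 0 (c b)" for b
    have np: "0 \<le> n b" "0 \<le> p b" "c b = p b - n b" for b by (auto simp: n_def p_def)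
    have eq: "u + (\<Sum>b\<in>B. n b *\<^sub>R b) = (\<Sum>b\<in>B. p b *\<^sub>R b)"
      unfolding c np(3) by (simp add: scaleR_diff_left sum_subtractf)
    have "(\<Sum>b\<in>B. n b *\<^sub>R b) \<in> K"
      using B(1) np \<open>finite B\<close> by (intro parameter_cone_sum [OF K] parameter_cone_scaleR [OF K]) auto
    then have "f u + (\<Sum>b\<in>B. n b * f b) = (\<Sum>b\<in>B. p b * f b)"
      using add [OF u, of "\<Sum>b\<in>B. n b *\<^sub>R b"] sum [of B n] sum [of B p] np \<open>finite B\<close> unfolding eq by simp
    then have "f u = (\<Sum>b\<in>B. c b * f b)"
      unfolding np(3) by (simp add: left_diff_distrib sum_subtractf)
    also have "\<dots> = (\<Sum>b\<in>B. c b * g b)"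
      using g(2) by simp
    also have "\<dots> = g u"
      unfolding c using g(1) by (simp add: linear_sum linear_scale)
    finally show ?thesis .
  qed
  moreover have "g u = adjoint g 1 \<bullet> u" for u
    using adjoint_works [OF g(1), of u 1] by (simp add: inner_commute)
  ultimately show ?thesis by metis
qed

text \<open>Second countability: countably many basic open null sets cover the complement of
  \<open>K\<close>.\<close>

lemma AE_in_closed_support:
  fixes M :: "'a::euclidean_space measure"
  assumes "sets M = sets borel" "measure_support M \<subseteq> K" "closed K"
  shows "AE x in M. x \<in> K"
proof -
  obtain B :: "'a set set" where B: "countable B" "topological_basis B"
    using ex_countable_basis by blast
  define N where "N = \<Union>{V\<in>B. emeasure M V = 0}"
  have open_B: "open V" if "V \<in> B" for V using topological_basis_open [OF B(2) that] .
  have "N \<in> null_sets M"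
    unfolding N_def using B(1) open_B
    by (intro null_sets_UN' [of _ "\<lambda>V. V", simplified]) (auto simp: null_sets_def assms(1) intro: countable_subset [of _ B])
  moreover have "- K \<subseteq> N"
  proof
    fix x assume "x \<in> - K"
    then have "x \<notin> measure_support M" using assms(2) by auto
    then obtain U where U: "open U" "x \<in> U" "emeasure M U = 0"
      by (auto simp: measure_support_def zero_less_iff_neq_zero)
    then obtain V where V: "V \<in> B" "x \<in> V" "V \<subseteq> U"
      using B(2) by (metis topological_basisE)
    then have "emeasure M V \<le> emeasure M U"
      using U(1) by (intro emeasure_mono) (auto simp: assms(1))
    with U V show "x \<in> N" by (auto simp: N_def)
  qed
  ultimately show ?thesis
    by (intro AE_I' [of N]) auto
qed

section \<open>Linearity of mean and variance of a Gaussian semigroup\<close>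

lemma gaussian_eq_distr:
  assumes "0 \<le> a"
  shows "gaussian a c = distr std_normal_distribution borel (\<lambda>x. sqrt a * x + c)"
proof (cases "a = 0")
  case True
  interpret prob_space std_normal_distribution by (rule prob_space_normal_density) simp
  show ?thesis using True by (simp add: gaussian_def distr_const)
next
  case False
  with assms have a: "0 < sqrt a" by simp
  interpret prob_space std_normal_distribution by (rule prob_space_normal_density) simp
  have "distributed std_normal_distribution lborel (\<lambda>x. x) std_normal_density"
    by (auto simp: distributed_def distr_id2)
  from normal_density_affine [OF this, of "sqrt a" c] a
  have "distributed std_normal_distribution lborel (\<lambda>x. c + sqrt a * x) (normal_density c (sqrt a))"
    by simp
  then have "distr std_normal_distribution lborel (\<lambda>x. c + sqrt a * x) = density lborel (normal_density c (sqrt a))"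
    by (simp add: distributed_def)
  moreover have "distr std_normal_distribution lborel (\<lambda>x. c + sqrt a * x) = distr std_normal_distribution borel (\<lambda>x. sqrt a * x + c)"
    by (intro distr_cong) (auto simp: add.commute)
  ultimately show ?thesis using False by (simp add: gaussian_def)
qed

lemma char_gaussian:
  assumes "0 \<le> a"
  shows "char (gaussian a c) z = exp (\<i> * c * z - a * z\<^sup>2 / 2)"
proof -
  have "char (gaussian a c) z = (CLINT x|std_normal_distribution. iexp (z * (sqrt a * x + c)))"
    unfolding gaussian_eq_distr [OF assms] by (rule char_distr) simp
  also have "\<dots> = (CLINT x|std_normal_distribution. iexp (z * c) * iexp (z * sqrt a * x))"
    by (intro Bochner_Integration.integral_cong) (simp_all add: exp_add [symmetric] algebra_simps)
  also have "\<dots> = iexp (z * c) * char std_normal_distribution (z * sqrt a)"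
    unfolding char_def by simp
  also have "\<dots> = exp (\<i> * c * z - a * z\<^sup>2 / 2)"
    unfolding char_std_normal_distribution using assms
    by (simp add: exp_of_real [symmetric] exp_add [symmetric] power_mult_distrib of_real_power [symmetric] mult_ac del: of_real_power)
  finally show ?thesis .
qed

text \<open>Cauchy's functional equation: the deviation \<open>d\<close> from linearity is additive
  and zero at rationals, so subtracting a rational just below \<open>t\<close> moves the argument
  close to 0, where \<open>d\<close> is small.\<close>

lemma additive_imp_linear:
  fixes f :: "real \<Rightarrow> real"
  assumes add: "\<And>s t. 0 \<le> s \<Longrightarrow> 0 \<le> t \<Longrightarrow> f (s + t) = f s + f t"
    and lim: "(f \<longlongrightarrow> 0) (at_right 0)" and "0 \<le> t"
  shows "f t = t * f 1"
proof -
  define d where "d t = f t - t * f 1" for t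
  have d_add: "d (s + t) = d s + d t" if "0 \<le> s" "0 \<le> t" for s t
    using add [OF that] by (simp add: d_def algebra_simps)
  have d0: "d 0 = 0" using d_add [of 0 0] by simp
  have d_mult: "d (of_nat n * t) = of_nat n * d t" if "0 \<le> t" for n t
  proof (induction n)
    case (Suc n)
    have "d (of_nat (Suc n) * t) = d (t + of_nat n * t)" by (simp add: algebra_simps)
    also have "\<dots> = d t + d (of_nat n * t)" using that by (intro d_add) auto
    finally show ?case using Suc by (simp add: algebra_simps)
  qed (simp add: d0)
  have "d 1 = 0" by (simp add: d_def)
  have d_rat: "d q = 0" if q_rat: "q \<in> \<rat>" "0 \<le> q" for q
  proof -
    obtain m n :: nat where q: "n \<noteq> 0" "q = m / n"
      using Rats_abs_nat_div_natE [OF q_rat(1)] q_rat(2) by (metis abs_of_nonneg)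
    have "of_nat n * d q = d (of_nat n * q)" using d_mult q_rat by simp
    also have "of_nat n * q = of_nat m * 1" using q by simp
    also have "d (of_nat m * 1) = 0" using d_mult [of 1 m] \<open>d 1 = 0\<close> by simp
    finally show ?thesis using q by simp
  qed
  have "((\<lambda>t. f t - t * f 1) \<longlongrightarrow> 0 - 0 * f 1) (at_right 0)"
    by (intro tendsto_intros lim)
  then have d_lim: "(d \<longlongrightarrow> 0) (at_right 0)" by (simp add: d_def [abs_def])
  have "\<bar>d t\<bar> \<le> e" if "0 < e" for e
  proof (cases "t = 0")
    case False
    with \<open>0 \<le> t\<close> have "0 < t" by simp
    have "eventually (\<lambda>x. dist (d x) 0 < e) (at_right 0)" using d_lim that by (rule tendstoD)
    then obtain b where b: "0 < b" "\<And>x. 0 < x \<Longrightarrow> x < b \<Longrightarrow> \<bar>d x\<bar> < e"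
      by (auto simp: eventually_at_right_field)
    have "max 0 (t - b) < t" using b \<open>0 < t\<close> by simp
    then obtain q where q: "q \<in> \<rat>" "max 0 (t - b) < q" "q < t" using Rats_dense_in_real by blast
    then have "d t = d (t - q)" using d_add [of "t - q" q] d_rat [of q] by simp
    with b(2) [of "t - q"] q show ?thesis by simp
  qed (use that d0 in simp)
  then have "d t = 0" by (metis abs_le_zero_iff field_le_epsilon add_0)
  then show ?thesis by (simp add: d_def)
qed

text \<open>A single \<open>z\<close> determines \<open>c n * z\<close> only up to sign and
  multiples of \<open>2 * pi\<close>. Averaging over \<open>z\<close> with the normal law turns the
  cosine into \<open>exp (- (c n)\<^sup>2 / 2)\<close>, which determines
  \<open>\<bar>c n\<bar>\<close>.\<close>

lemma tendsto_0_if_cos_tendsto_1: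
  fixes c :: "nat \<Rightarrow> real"
  assumes "\<And>z. (\<lambda>n. cos (c n * z)) \<longlonglongrightarrow> 1"
  shows "c \<longlonglongrightarrow> 0"
proof -
  interpret S: prob_space std_normal_distribution by (rule prob_space_normal_density) simp
  have "(\<lambda>n. \<integral>z. cos (c n * z) \<partial>std_normal_distribution) \<longlonglongrightarrow> (\<integral>z. 1 \<partial>std_normal_distribution)"
    using assms by (intro integral_dominated_convergence [where w = "\<lambda>_. 1"]) auto
  moreover have "(\<integral>z. 1 \<partial>std_normal_distribution) = (1 :: real)" using S.prob_space by simp
  moreover have "(\<integral>z. cos (c n * z) \<partial>std_normal_distribution) = exp (- (c n)\<^sup>2 / 2)" for n
  proof -
    have "integrable std_normal_distribution (\<lambda>z. iexp (c n * z))"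
      by (intro S.integrable_const_bound [where B = 1]) auto
    then have "(\<integral>z. cos (c n * z) \<partial>std_normal_distribution) = Re (char std_normal_distribution (c n))"
      unfolding char_def by (simp add: integral_Re [symmetric] Re_exp)
    then show ?thesis by (simp add: char_std_normal_distribution)
  qed
  ultimately have "(\<lambda>n. exp (- (c n)\<^sup>2 / 2)) \<longlonglongrightarrow> 1" by (simp only:)
  then have "(\<lambda>n. sqrt (- 2 * ln (exp (- (c n)\<^sup>2 / 2)))) \<longlonglongrightarrow> sqrt (- 2 * ln 1)"
    by (intro tendsto_intros) auto
  then have "(\<lambda>n. \<bar>c n\<bar>) \<longlonglongrightarrow> 0" by simp
  then show ?thesis by (rule tendsto_rabs_zero_cancel)
qed

lemma real_distribution_iff_borel_prob: "real_distribution M \<longleftrightarrow> borel_prob M"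
  by (auto simp: real_distribution_def real_distribution_axioms_def borel_prob_def)

text \<open>The modulus of the characteristic function yields additivity of the variance, its phase
  at all \<open>z\<close> that of the mean. Weak continuity along rays upgrades additivity to
  homogeneity, after which both extend to linear functionals.\<close>

lemma gaussian_semigroup_linear:
  fixes K :: "'k::euclidean_space set"
  assumes K: "parameter_cone K" and \<mu>: "gaussian_semigroup K \<mu>"
  shows "\<exists>a g. \<forall>u\<in>K. 0 \<le> a \<bullet> u \<and> \<mu> u = gaussian (a \<bullet> u) (g \<bullet> u)"
proof -
  have "\<forall>u\<in>K. \<exists>a c. 0 \<le> a \<and> \<mu> u = gaussian a c"
    using \<mu> by (simp add: gaussian_semigroup_def)
  then obtain \<alpha> \<gamma> where ag: "\<And>u. u \<in> K \<Longrightarrow> 0 \<le> \<alpha> u" "\<And>u. u \<in> K \<Longrightarrow> \<mu> u = gaussian (\<alpha> u) (\<gamma> u)"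
    by metis
  have conv: "convolution_semigroup K \<mu>" using \<mu> by (simp add: gaussian_semigroup_def)
  then have dist: "real_distribution (\<mu> u)" if "u \<in> K" for u
    using that by (simp add: real_distribution_iff_borel_prob convolution_semigroup_def)
  have char_\<mu>: "char (\<mu> u) z = exp (\<i> * \<gamma> u * z - \<alpha> u * z\<^sup>2 / 2)" if "u \<in> K" for u z
    using ag that by (simp add: char_gaussian)
  have char_add: "char (\<mu> (u + v)) z = char (\<mu> u) z * char (\<mu> v) z" if "u \<in> K" "v \<in> K" for u v z
    using conv char_convolution(2) [OF dist dist] that unfolding convolution_semigroup_def by metis
  have \<alpha>_add: "\<alpha> (u + v) = \<alpha> u + \<alpha> v" if "u \<in> K" "v \<in> K" for u v
  proof -
    have "norm (char (\<mu> (u + v)) 1) = norm (char (\<mu> u) 1) * norm (char (\<mu> v) 1)"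
      using char_add [OF that] by (simp add: norm_mult)
    then have "exp (- \<alpha> (u + v) / 2) = exp (- \<alpha> u / 2 - \<alpha> v / 2)"
      using that parameter_cone_add [OF K that] by (simp add: char_\<mu> exp_add [symmetric])
    then show ?thesis by simp
  qed
  have \<gamma>_add: "\<gamma> (u + v) = \<gamma> u + \<gamma> v" if "u \<in> K" "v \<in> K" for u v
  proof -
    define D where "D = \<gamma> (u + v) - (\<gamma> u + \<gamma> v)"
    have "iexp (D * z) = 1" for z
    proof -
      have "exp (\<i> * \<gamma> (u + v) * z - \<alpha> (u + v) * z\<^sup>2 / 2)
        = exp (\<i> * (\<gamma> u + \<gamma> v) * z - \<alpha> (u + v) * z\<^sup>2 / 2)"
        using char_add [OF that, of z] that parameter_cone_add [OF K that]
        by (simp add: char_\<mu> \<alpha>_add exp_add [symmetric] algebra_simps add_divide_distrib)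
      then have "exp (\<i> * \<gamma> (u + v) * z - \<alpha> (u + v) * z\<^sup>2 / 2 - (\<i> * (\<gamma> u + \<gamma> v) * z - \<alpha> (u + v) * z\<^sup>2 / 2)) = 1"
        by (simp add: exp_diff)
      then show ?thesis by (simp add: D_def algebra_simps)
    qed
    then have "cos (D * z) = 1" for z
      by (metis Re_exp cis_conv_exp cis.sel(1) one_complex.sel(1))
    \<comment> \<open>The limit lemma for a constant sequence says that
      \<open>D = 0\<close>.\<close>
    then have "(\<lambda>n::nat. D) \<longlonglongrightarrow> 0" by (intro tendsto_0_if_cos_tendsto_1) simp
    then show ?thesis by (simp add: D_def LIMSEQ_const_iff)
  qed
  have cos_lim: "((\<lambda>t. exp (- (\<alpha> (t *\<^sub>R u) * z\<^sup>2 / 2)) * cos (\<gamma> (t *\<^sub>R u) * z)) \<longlongrightarrow> 1) (at_right 0)" if u: "u \<in> K" for u z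
  proof -
    have "weakly_tendsto (\<lambda>t::real. \<mu> (t *\<^sub>R u)) (return borel 0) (at_right 0)"
      using conv u by (simp add: convolution_semigroup_def)
    moreover have "continuous_on UNIV (\<lambda>x::real. cos (z * x))" by (intro continuous_intros)
    moreover have "bounded (range (\<lambda>x::real. cos (z * x)))" by (rule boundedI [of _ 1]) auto
    ultimately have "((\<lambda>t. \<integral>x. cos (z * x) \<partial>\<mu> (t *\<^sub>R u)) \<longlongrightarrow> (\<integral>x. cos (z * x) \<partial>return borel 0)) (at_right 0)"
      unfolding weakly_tendsto_def by blast
    also have "(\<integral>x. cos (z * x) \<partial>return borel 0) = 1" by (simp add: integral_return)
    finally show ?thesis
    proof (rule Lim_transform_eventually)
      have "eventually (\<lambda>t::real. 0 < t) (at_right 0)" by (simp add: eventually_at_filter)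
      then show "eventually (\<lambda>t. (\<integral>x. cos (z * x) \<partial>\<mu> (t *\<^sub>R u)) = exp (- (\<alpha> (t *\<^sub>R u) * z\<^sup>2 / 2)) * cos (\<gamma> (t *\<^sub>R u) * z)) (at_right 0)"
      proof (rule eventually_mono)
        fix t :: real assume "0 < t"
        then have tu: "t *\<^sub>R u \<in> K" using u by (intro parameter_cone_scaleR [OF K]) auto
        interpret real_distribution "\<mu> (t *\<^sub>R u)" by (rule dist [OF tu])
        have "integrable (\<mu> (t *\<^sub>R u)) (\<lambda>x. iexp (z * x))"
          by (intro integrable_const_bound [where B = 1]) auto
        then have "(\<integral>x. cos (z * x) \<partial>\<mu> (t *\<^sub>R u)) = Re (char (\<mu> (t *\<^sub>R u)) z)"
          unfolding char_def by (simp add: integral_Re [symmetric] Re_exp)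
        also have "\<dots> = exp (- (\<alpha> (t *\<^sub>R u) * z\<^sup>2 / 2)) * cos (\<gamma> (t *\<^sub>R u) * z)"
          unfolding char_\<mu> [OF tu] by (simp add: Re_exp)
        finally show "(\<integral>x. cos (z * x) \<partial>\<mu> (t *\<^sub>R u)) = \<dots>" .
      qed
    qed
  qed
  \<comment> \<open>The cosine is at most 1, so the product in \<open>cos_lim\<close> is a lower
    bound. The variance is thus settled first and can then be divided out to treat the mean.\<close>
  have exp_lim: "((\<lambda>t. exp (- (\<alpha> (t *\<^sub>R u) / 2))) \<longlongrightarrow> 1) (at_right 0)" if u: "u \<in> K" for u
  proof (rule tendsto_sandwich [OF _ _ cos_lim [OF u, of 1] tendsto_const])
    have pos: "eventually (\<lambda>t::real. 0 < t) (at_right 0)" by (simp add: eventually_at_filter)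
    show "eventually (\<lambda>t. exp (- (\<alpha> (t *\<^sub>R u) * 1\<^sup>2 / 2)) * cos (\<gamma> (t *\<^sub>R u) * 1) \<le> exp (- (\<alpha> (t *\<^sub>R u) / 2))) (at_right 0)"
      by (intro always_eventually) (simp add: mult_left_le)
    show "eventually (\<lambda>t. exp (- (\<alpha> (t *\<^sub>R u) / 2)) \<le> 1) (at_right 0)"
      using pos by (rule eventually_mono) (auto intro!: ag parameter_cone_scaleR [OF K] u)
  qed
  have \<alpha>_lim: "((\<lambda>t. \<alpha> (t *\<^sub>R u)) \<longlongrightarrow> 0) (at_right 0)" if u: "u \<in> K" for u
  proof -
    have "((\<lambda>t. - 2 * ln (exp (- (\<alpha> (t *\<^sub>R u) / 2)))) \<longlongrightarrow> - 2 * ln 1) (at_right 0)"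
      by (intro tendsto_intros exp_lim [OF u]) auto
    then show ?thesis by simp
  qed
  have \<gamma>_lim: "((\<lambda>t. \<gamma> (t *\<^sub>R u)) \<longlongrightarrow> 0) (at_right 0)" if u: "u \<in> K" for u
    unfolding tendsto_at_iff_sequentially
  proof (intro allI impI)
    fix X :: "nat \<Rightarrow> real" assume X: "\<forall>i. X i \<in> {0<..} - {0}" "X \<longlonglongrightarrow> 0"
    have X_lim: "(\<lambda>n. f (X n)) \<longlonglongrightarrow> l" if "(f \<longlongrightarrow> l) (at_right 0)" for f and l :: real
      using that X unfolding tendsto_at_iff_sequentially by (auto simp: o_def)
    have "(\<lambda>n. cos (\<gamma> (X n *\<^sub>R u) * z)) \<longlonglongrightarrow> 1" for z
    proof -
      have "(\<lambda>n. exp (- (\<alpha> (X n *\<^sub>R u) * z\<^sup>2 / 2)) * cos (\<gamma> (X n *\<^sub>R u) * z) / exp (- (\<alpha> (X n *\<^sub>R u) * z\<^sup>2 / 2)))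
          \<longlonglongrightarrow> 1 / exp (- (0 * z\<^sup>2 / 2))"
        by (intro tendsto_intros X_lim [OF cos_lim [OF u]] X_lim [OF \<alpha>_lim [OF u]]) simp_all
      then show ?thesis by simp
    qed
    then show "((\<lambda>t. \<gamma> (t *\<^sub>R u)) \<circ> X) \<longlonglongrightarrow> 0"
      unfolding o_def by (rule tendsto_0_if_cos_tendsto_1)
  qed
  have scale: "f (t *\<^sub>R u) = t * f u"
    if add: "\<And>u v. u \<in> K \<Longrightarrow> v \<in> K \<Longrightarrow> f (u + v) = f u + f v"
      and lim: "((\<lambda>t. f (t *\<^sub>R u)) \<longlongrightarrow> 0) (at_right 0)" and "u \<in> K" "0 \<le> t" for f :: "'k \<Rightarrow> real" and t u
  proof -
    have "f (t *\<^sub>R u) = t * f (1 *\<^sub>R u)"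
    proof (rule additive_imp_linear [where f = "\<lambda>t. f (t *\<^sub>R u)"])
      show "f ((s + t) *\<^sub>R u) = f (s *\<^sub>R u) + f (t *\<^sub>R u)" if "0 \<le> s" "0 \<le> t" for s t
        using that \<open>u \<in> K\<close> by (simp add: scaleR_add_left add parameter_cone_scaleR [OF K])
    qed (use lim \<open>0 \<le> t\<close> in auto)
    then show ?thesis by simp
  qed
  obtain a where "\<And>u. u \<in> K \<Longrightarrow> \<alpha> u = a \<bullet> u"
    using parameter_cone_linear_extension [OF K \<alpha>_add scale [OF \<alpha>_add \<alpha>_lim]] by blast
  moreover obtain g where "\<And>u. u \<in> K \<Longrightarrow> \<gamma> u = g \<bullet> u"
    using parameter_cone_linear_extension [OF K \<gamma>_add scale [OF \<gamma>_add \<gamma>_lim]] by blast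
  ultimately show ?thesis using ag by metis
qed

section \<open>The subordinated law as a Gaussian mixture\<close>

lemma subordinated_gaussian:
  fixes K :: "'k::euclidean_space set" and a g :: 'k
  assumes \<rho>: "borel_prob (\<rho> s)" and ae: "AE u in \<rho> s. u \<in> K" and "closed K"
    and \<mu>: "\<And>u. u \<in> K \<Longrightarrow> 0 \<le> a \<bullet> u" "\<And>u. u \<in> K \<Longrightarrow> \<mu> u = gaussian (a \<bullet> u) (g \<bullet> u)"
  shows "real_distribution (subordinated K \<mu> \<rho> s)"
    and "char (subordinated K \<mu> \<rho> s) z = laplace_fourier (\<rho> s) ((z\<^sup>2 / 2) *\<^sub>R a) (z *\<^sub>R g)"
proof -
  interpret \<rho>: prob_space "\<rho> s" using \<rho> by (simp add: borel_prob_def)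
  define S where "S = std_normal_distribution"
  interpret S: prob_space S unfolding S_def by (rule prob_space_normal_density) simp
  interpret P: pair_prob_space "\<rho> s" S ..
  have [measurable_cong]: "sets (\<rho> s) = sets borel" "sets S = sets borel"
    using \<rho> by (simp_all add: borel_prob_def S_def)
  \<comment> \<open>A variable with the subordinated law: \<open>u\<close> has law
    \<open>\<rho> s\<close>, and \<open>x\<close> is standard normal and independent of
    \<open>u\<close>.\<close>
  define f where "f = (\<lambda>(u, x). sqrt (max 0 (a \<bullet> u)) * x + g \<bullet> u)"
  have [measurable]: "f \<in> borel_measurable (\<rho> s \<Otimes>\<^sub>M S)" unfolding f_def by measurable
  define \<Sigma> where "\<Sigma> = distr (\<rho> s \<Otimes>\<^sub>M S) borel f"
  \<comment> \<open>The set function in \<open>subordinated\<close> agrees with that of the measure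
    \<open>\<Sigma>\<close>, so \<open>measure_of\<close> does not collapse to the null
    measure.\<close>
  have "subordinated K \<mu> \<rho> s = measure_of UNIV (sets borel) (emeasure \<Sigma>)"
    unfolding subordinated_def
  proof (rule measure_of_eq)
    fix B :: "real set" assume "B \<in> sigma_sets UNIV (sets borel)"
    then have [measurable]: "B \<in> sets borel" using sets.sigma_sets_eq [of "borel :: real measure"] by simp
    have "emeasure \<Sigma> B = (\<integral>\<^sup>+q. indicator B (f q) \<partial>(\<rho> s \<Otimes>\<^sub>M S))"
      unfolding \<Sigma>_def by (subst nn_integral_indicator [symmetric], simp, subst nn_integral_distr) auto
    also have "\<dots> = (\<integral>\<^sup>+u. \<integral>\<^sup>+x. indicator B (f (u, x)) \<partial>S \<partial>\<rho> s)"
      by (rule S.nn_integral_fst [symmetric]) simp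
    also have "\<dots> = (\<integral>\<^sup>+u\<in>K. emeasure (\<mu> u) B \<partial>\<rho> s)"
    proof (rule nn_integral_cong_AE)
      show "AE u in \<rho> s. (\<integral>\<^sup>+x. indicator B (f (u, x)) \<partial>S) = emeasure (\<mu> u) B * indicator K u"
        using ae
      proof (rule eventually_mono)
        fix u assume u: "u \<in> K"
        have "emeasure (\<mu> u) B = (\<integral>\<^sup>+x. indicator B x \<partial>distr S borel (\<lambda>x. sqrt (a \<bullet> u) * x + g \<bullet> u))"
          using \<mu> u by (simp add: gaussian_eq_distr S_def)
        also have "\<dots> = (\<integral>\<^sup>+x. indicator B (f (u, x)) \<partial>S)"
          using \<mu>(1) [OF u] by (subst nn_integral_distr) (auto simp: f_def)
        finally show "(\<integral>\<^sup>+x. indicator B (f (u, x)) \<partial>S) = emeasure (\<mu> u) B * indicator K u"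
          using u by simp
      qed
    qed
    finally show "(\<integral>\<^sup>+u\<in>K. emeasure (\<mu> u) B \<partial>\<rho> s) = emeasure \<Sigma> B" by simp
  qed auto
  also have "\<dots> = \<Sigma>"
    using measure_of_of_measure [of \<Sigma>] by (simp add: \<Sigma>_def)
  finally have eq: "subordinated K \<mu> \<rho> s = \<Sigma>" .
  show "real_distribution (subordinated K \<mu> \<rho> s)"
    unfolding eq \<Sigma>_def by (rule P.real_distribution_distr) simp
  have "char \<Sigma> z = (\<integral>q. iexp (z * f q) \<partial>(\<rho> s \<Otimes>\<^sub>M S))"
    unfolding \<Sigma>_def by (rule char_distr) simp
  also have "\<dots> = (\<integral>u. \<integral>x. iexp (z * f (u, x)) \<partial>S \<partial>\<rho> s)"
    by (rule prob_integral_fst [OF \<rho>.prob_space_axioms S.prob_space_axioms, where B = 1]) auto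
  also have "\<dots> = laplace_fourier (\<rho> s) ((z\<^sup>2 / 2) *\<^sub>R a) (z *\<^sub>R g)"
    unfolding laplace_fourier_def
  proof (rule integral_cong_AE)
    show "AE u in \<rho> s. (\<integral>x. iexp (z * f (u, x)) \<partial>S) = exp (lf_exponent ((z\<^sup>2 / 2) *\<^sub>R a) (z *\<^sub>R g) u)"
      using ae
    proof (rule eventually_mono)
      fix u assume u: "u \<in> K"
      have "(\<integral>x. iexp (z * f (u, x)) \<partial>S) = char (gaussian (a \<bullet> u) (g \<bullet> u)) z"
        using \<mu>(1) [OF u] unfolding gaussian_eq_distr [OF \<mu>(1) [OF u]]
        by (subst char_distr) (auto simp: f_def S_def)
      also have "\<dots> = exp (lf_exponent ((z\<^sup>2 / 2) *\<^sub>R a) (z *\<^sub>R g) u)"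
        unfolding char_gaussian [OF \<mu>(1) [OF u]] by (rule arg_cong [where f = exp]) (simp add: lf_exponent_def)
      finally show "(\<integral>x. iexp (z * f (u, x)) \<partial>S) = exp (lf_exponent ((z\<^sup>2 / 2) *\<^sub>R a) (z *\<^sub>R g) u)" .
    qed
  qed auto
  finally show "char (subordinated K \<mu> \<rho> s) z = laplace_fourier (\<rho> s) ((z\<^sup>2 / 2) *\<^sub>R a) (z *\<^sub>R g)"
    unfolding eq .
qed

theorem theorem2p1:
  fixes K1 :: "(real ^ 'n1) set" and K2 :: "(real ^ 'n2) set"
    and \<mu> :: "real ^ 'n2 \<Rightarrow> real measure"
    and \<rho> :: "real ^ 'n1 \<Rightarrow> (real ^ 'n2) measure"
    and s :: "real ^ 'n1"
  assumes "parameter_cone K1" and "parameter_cone K2"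
    and "gaussian_semigroup K2 \<mu>"
    and "convolution_semigroup K1 \<rho>"
    and "semigroup_supported_on K1 \<rho> K2"
    and "s \<in> K1"
    and "selfdecomposable (\<rho> s)"
  shows "selfdecomposable (subordinated K2 \<mu> \<rho> s)"
proof -
  have \<rho>: "borel_prob (\<rho> s)" using assms(7) by (simp add: selfdecomposable_def)
  have closed: "closed K2" using assms(2) by (simp add: parameter_cone_def)
  have ae: "AE u in \<rho> s. u \<in> K2"
    using \<rho> assms(5,6) closed
    by (intro AE_in_closed_support) (auto simp: borel_prob_def semigroup_supported_on_def)
  obtain a g where ag: "\<And>u. u \<in> K2 \<Longrightarrow> 0 \<le> a \<bullet> u" "\<And>u. u \<in> K2 \<Longrightarrow> \<mu> u = gaussian (a \<bullet> u) (g \<bullet> u)"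
    using gaussian_semigroup_linear [OF assms(2,3)] by blast
  obtain \<theta> where \<theta>: "\<And>u. u \<in> K2 \<Longrightarrow> norm u \<le> \<theta> \<bullet> u"
    using parameter_cone_functional [OF assms(2)] by blast
  \<comment> \<open>Selfdecomposability with \<open>b = exp h\<close>. The condition
    \<open>0 < h\<close> sits below the quantifiers so that one function \<open>R\<close> can be
    chosen.\<close>
  have "\<forall>h. \<exists>R. 0 < h \<longrightarrow> borel_prob R \<and> (\<forall>z. charfun (\<rho> s) z = charfun (\<rho> s) (exp (- h) *\<^sub>R z) * charfun R z)"
  proof
    fix h :: real
    have "\<exists>R. borel_prob R \<and> (\<forall>z. charfun (\<rho> s) z = charfun (\<rho> s) (inverse (exp h) *\<^sub>R z) * charfun R z)" if "0 < h"
      using assms(7) that unfolding selfdecomposable_def by simp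
    then show "\<exists>R. 0 < h \<longrightarrow> borel_prob R \<and> (\<forall>z. charfun (\<rho> s) z = charfun (\<rho> s) (exp (- h) *\<^sub>R z) * charfun R z)"
      by (auto simp: exp_minus)
  qed
  then obtain R where R: "\<And>h. 0 < h \<Longrightarrow> borel_prob (R h)"
      "\<And>h z. 0 < h \<Longrightarrow> charfun (\<rho> s) z = charfun (\<rho> s) (exp (- h) *\<^sub>R z) * charfun (R h) z"
    by metis
  interpret selfdecomposable_on_cone "\<rho> s" R \<theta>
  proof (rule selfdecomposable_on_cone.intro)
    show "AE u in \<rho> s. 0 \<le> \<theta> \<bullet> u"
      using ae by (rule eventually_mono) (use \<theta> in \<open>auto intro: order_trans [OF norm_ge_zero]\<close>)
    show "prob_space (R h)" "sets (R h) = sets borel" if "0 < h" for h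
      using R(1) [OF that] by (auto simp: borel_prob_def)
    show "AE u in R h. 0 \<le> p \<bullet> u" if "0 < h" "AE u in \<rho> s. 0 \<le> p \<bullet> u" for h p
      using that by (intro cofactor_nonneg [OF \<rho> R(1) _ _ R(2)]) auto
    show "laplace_fourier (\<rho> s) p q = laplace_fourier (\<rho> s) (exp (- h) *\<^sub>R p) (exp (- h) *\<^sub>R q) * laplace_fourier (R h) p q"
      if "0 < h" "AE u in \<rho> s. 0 \<le> p \<bullet> u" for h p q
      using that by (intro laplace_fourier_factor [OF \<rho> R(1) _ _ R(2)]) auto
  qed (use \<rho> in \<open>auto simp: borel_prob_def\<close>)
  \<comment> \<open>The constant results from Cauchy-Schwarz and
    \<open>norm u \<le> \<theta> \<bullet> u\<close> on the cone.\<close>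
  have dom: "dominated (norm a + norm g) a g"
    unfolding dominated_def
  proof (intro conjI)
    have le: "\<bar>v \<bullet> u\<bar> \<le> (norm a + norm g) * (\<theta> \<bullet> u)" if "u \<in> K2" "v = a \<or> v = g" for u v
    proof -
      have "\<bar>v \<bullet> u\<bar> \<le> norm v * norm u" by (rule Cauchy_Schwarz_ineq2)
      also have "\<dots> \<le> (norm a + norm g) * (\<theta> \<bullet> u)"
        using that \<theta> by (intro mult_mono) auto
      finally show ?thesis .
    qed
    show "AE u in \<rho> s. 0 \<le> ((norm a + norm g) *\<^sub>R \<theta> - a) \<bullet> u"
      using ae by (rule eventually_mono) (use le [of _ a] in \<open>auto simp: inner_diff_left abs_le_iff\<close>)
    show "AE u in \<rho> s. 0 \<le> ((norm a + norm g) *\<^sub>R \<theta> - g) \<bullet> u"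
      using ae by (rule eventually_mono) (use le [of _ g] in \<open>auto simp: inner_diff_left abs_le_iff\<close>)
    show "AE u in \<rho> s. 0 \<le> ((norm a + norm g) *\<^sub>R \<theta> + g) \<bullet> u"
      using ae by (rule eventually_mono) (use le [of _ g] in \<open>force simp: inner_add_left abs_le_iff\<close>)
    show "AE u in \<rho> s. 0 \<le> a \<bullet> u"
      using ae by (rule eventually_mono) (rule ag)
  qed simp
  let ?\<sigma> = "subordinated K2 \<mu> \<rho> s"
  let ?\<Phi> = "\<lambda>z. laplace_fourier (\<rho> s) ((z\<^sup>2 / 2) *\<^sub>R a) (z *\<^sub>R g)"
  have sub: "real_distribution ?\<sigma>" "char ?\<sigma> z = ?\<Phi> z" for z
    using subordinated_gaussian [where \<rho> = \<rho> and s = s and K = K2 and a = a and g = g and \<mu> = \<mu>, OF \<rho> ae closed] ag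
    by auto
  have \<Phi>: "is_char ?\<Phi>"
    unfolding is_char_def using sub by (intro exI [of _ ?\<sigma>]) (simp add: fun_eq_iff)
  show ?thesis
    unfolding selfdecomposable_def charfun_real
  proof (intro conjI allI impI)
    show "borel_prob ?\<sigma>" using sub(1) by (simp add: real_distribution_iff_borel_prob)
    fix b :: real assume "1 < b"
    from is_char_cofactor [OF this dom \<Phi>] obtain M' where M': "real_distribution M'"
      "\<And>z. ?\<Phi> z = ?\<Phi> (inverse b * z) * char M' z"
      unfolding is_char_def by metis
    have "char ?\<sigma> z = char ?\<sigma> (inverse b *\<^sub>R z) * char M' z" for z
      unfolding sub(2) real_scaleR_def by (rule M'(2))
    with M'(1) show "\<exists>M'. borel_prob M' \<and> (\<forall>z. char ?\<sigma> z = char ?\<sigma> (inverse b *\<^sub>R z) * char M' z)"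
      unfolding real_distribution_iff_borel_prob by blast
  qed
qed

end
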